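(* For any integer $g\ge 2$ and any even integer $p\ge 6$ such that $\frac{8(g-1)}{p-4}$ is an integer, there exists a compact, orientable hyperbolic surface of genus $g$ that is the quotient of a right-angled Fuchsian building with $p$-gons as chambers; that is, there exist a $p$-tuple $\mathbf q$ and a lattice $\Gamma$ of $\mathrm{Aut}(I_{p,\mathbf q})$ such that $I_{p,\mathbf q}/\Gamma$ is a compact orientable hyperbolic surface of genus $g$.
   Context: Building. Let $p\ge5$ and let $\mathbf q=\{q_1,\dots,q_p\}$ be a $p$-tuple of integers $q_i\ge 3$. Let $P$ be a right-angled regular $p$-gon in the hyperbolic plane (curvature $-1$) with edges labelled clockwise $1,\dots,p$; the vertex between edges $i$ and $i+1$ is labelled $\{i,i+1\}$ (indices mod $p$). Let $G(P)$ be the complex of groups over $P$ with trivial group on the face, $\mathbb Z/q_i\mathbb Z$ on edge $i$, and $\mathbb Z/q_i\mathbb Z\times\mathbb Z/q_{i+1}\mathbb Z$ on the vertex $\{i,i+1\}$, with the natural inclusions. The right-angled Fuchsian building $I_{p,\mathbf q}$ is the universal cover of $G(P)$. Equivalently, it is the unique simply connected polygonal $2$-complex whose $2$-cells (chambers) are copies of the labelled polygon $P$ (possibly with reversed orientation), and in which the link of each vertex of type $\{i,i+1\}$ is the complete bipartite graph $K_{q_i,q_{i+1}}$. Lattices. $\mathrm{Aut}(I_{p,\mathbf q})$ is the group of automorphisms of the polygonal complex (labels need not be preserved) with the compact-open topology. A lattice is a discrete subgroup of finite covolume. Compact surfaces are without boundary; the quotient surface carries the induced tessellation by right-angled regular $p$-gons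 (images of chambers). *)

theory Defs
  imports
    "HOL-Complex_Analysis.Complex_Analysis"
    "HOL-Algebra.Generated_Groups"
    "HOL-Algebra.Bij"
begin

section \<open>Topological preliminaries\<close>

definition quotient_topology :: "'a topology \<Rightarrow> ('a \<Rightarrow> 'b) \<Rightarrow> 'b topology" where
  "quotient_topology X f =
     topology (\<lambda>U. U \<subseteq> f ` topspace X \<and> openin X {x \<in> topspace X. f x \<in> U})"

lemma openin_quotient_topology:
  "openin (quotient_topology X f) U \<longleftrightarrow>
     U \<subseteq> f ` topspace X \<and> openin X {x \<in> topspace X. f x \<in> U}"
proof -
  have "istopology (\<lambda>U. U \<subseteq> f ` topspace X \<and> openin X {x \<in> topspace X. f x \<in> U})"
    unfolding istopology_def
  proof (intro conjI allI impI)
    fix S T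
    assume "S \<subseteq> f ` topspace X \<and> openin X {x \<in> topspace X. f x \<in> S}"
      and "T \<subseteq> f ` topspace X \<and> openin X {x \<in> topspace X. f x \<in> T}"
    then have "openin X ({x \<in> topspace X. f x \<in> S} \<inter> {x \<in> topspace X. f x \<in> T})"
      by blast
    also have "{x \<in> topspace X. f x \<in> S} \<inter> {x \<in> topspace X. f x \<in> T}
                 = {x \<in> topspace X. f x \<in> S \<inter> T}"
      by blast
    finally show "openin X {x \<in> topspace X. f x \<in> S \<inter> T}" .
  next
    fix \<K>
    assume *: "\<forall>K\<in>\<K>. K \<subseteq> f ` topspace X \<and> openin X {x \<in> topspace X. f x \<in> K}"
    then have "openin X (\<Union>K\<in>\<K>. {x \<in> topspace X. f x \<in> K})"
      by blast
    also have "(\<Union>K\<in>\<K>. {x \<in> topspace X. f x \<in> K}) = {x \<in> topspace X. f x \<in> \<Union>\<K>}"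
      by blast
    finally show "openin X {x \<in> topspace X. f x \<in> \<Union>\<K>}" .
  qed blast+
  then show ?thesis
    by (simp add: quotient_topology_def)
qed

lemma topspace_quotient_topology: "topspace (quotient_topology X f) = f ` topspace X"
proof (rule antisym)
  show "topspace (quotient_topology X f) \<subseteq> f ` topspace X"
    using openin_quotient_topology[of X f] by (metis openin_topspace)
  have "{x \<in> topspace X. f x \<in> f ` topspace X} = topspace X"
    by blast
  then have "openin (quotient_topology X f) (f ` topspace X)"
    by (simp add: openin_quotient_topology)
  then show "f ` topspace X \<subseteq> topspace (quotient_topology X f)"
    by (rule openin_subset)
qed

lemma quotient_map_quotient_topology: "quotient_map X (quotient_topology X f) f"
  by (auto simp: quotient_map_def topspace_quotient_topology openin_quotient_topology)

definition compact_open_topology :: "'a topology \<Rightarrow> ('a \<Rightarrow> 'a) set \<Rightarrow> ('a \<Rightarrow> 'a) topology" where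
  "compact_open_topology X A =
     topology_generated_by {{\<phi> \<in> A. \<phi> ` K \<subseteq> U} | K U. compactin X K \<and> openin X U}"

text \<open>
  A finite CW structure of dimension at most 2 on a Hausdorff space: the vertices V, the open
  edges E and the open faces F partition the space, and every open edge (face) is the image of the
  interior of a closed interval (disc) under a characteristic map that carries the boundary into
  the union of the cells of lower dimension.
\<close>

definition finite_CW_2 :: "'a topology \<Rightarrow> 'a set \<Rightarrow> 'a set set \<Rightarrow> 'a set set \<Rightarrow> bool" where
  "finite_CW_2 X V E F \<longleftrightarrow>
     Hausdorff_space X \<and> finite V \<and> finite E \<and> finite F \<and>
     E \<inter> F = {} \<and> partition_on (topspace X) ((\<lambda>v. {v}) ` V \<union> E \<union> F) \<and>
     (\<forall>e\<in>E. \<exists>\<Phi>. continuous_map (top_of_set {0..1::real}) X \<Phi> \<and> inj_on \<Phi> {0<..<1} \<and>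
        \<Phi> ` {0<..<1} = e \<and> \<Phi> ` {0, 1} \<subseteq> V) \<and>
     (\<forall>f\<in>F. \<exists>\<Phi>. continuous_map (top_of_set (cball (0::complex) 1)) X \<Phi> \<and> inj_on \<Phi> (ball 0 1) \<and>
        \<Phi> ` ball 0 1 = f \<and> \<Phi> ` sphere 0 1 \<subseteq> V \<union> \<Union>E)"

text \<open>
  The Euler characteristic does not depend on the CW structure, so a relation with an existential
  quantifier is adequate.
\<close>

definition has_Euler_characteristic :: "'a topology \<Rightarrow> int \<Rightarrow> bool" where
  "has_Euler_characteristic X n \<longleftrightarrow>
     (\<exists>V E F. finite_CW_2 X V E F \<and> n = int (card V) - int (card E) + int (card F))"


section \<open>The hyperbolic plane (Poincare disc) and hyperbolic surfaces\<close>

definition hyp_dist :: "complex \<Rightarrow> complex \<Rightarrow> real" where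
  "hyp_dist z w = arcosh (1 + 2 * (cmod (z - w))\<^sup>2 / ((1 - (cmod z)\<^sup>2) * (1 - (cmod w)\<^sup>2)))"

text \<open>
  An oriented hyperbolic atlas is an atlas of an (Isom+(H), H)-structure on X, where H is the disc:
  the orientation-preserving isometries of H are exactly the maps \<^term>\<open>Moebius_function t w\<close>
  with norm of w less than 1. Charts take values in open subsets of H, so there is no boundary.
\<close>

definition oriented_hyperbolic_atlas :: "'a topology \<Rightarrow> ('a set \<times> ('a \<Rightarrow> complex)) set \<Rightarrow> bool" where
  "oriented_hyperbolic_atlas X \<A> \<longleftrightarrow>
     \<Union>(fst ` \<A>) = topspace X \<and>
     (\<forall>(U, \<phi>)\<in>\<A>. openin X U \<and> open (\<phi> ` U) \<and> \<phi> ` U \<subseteq> ball 0 1 \<and>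
        homeomorphic_map (subtopology X U) (top_of_set (\<phi> ` U)) \<phi>) \<and>
     (\<forall>(U, \<phi>)\<in>\<A>. \<forall>(V, \<psi>)\<in>\<A>. \<forall>x \<in> U \<inter> V. \<exists>W t w.
        openin X W \<and> x \<in> W \<and> W \<subseteq> U \<inter> V \<and> cmod w < 1 \<and>
        (\<forall>y\<in>W. \<psi> y = Moebius_function t w (\<phi> y)))"

definition compact_oriented_hyperbolic_surface ::
    "'a topology \<Rightarrow> ('a set \<times> ('a \<Rightarrow> complex)) set \<Rightarrow> bool" where
  "compact_oriented_hyperbolic_surface X \<A> \<longleftrightarrow>
     compact_space X \<and> connected_space X \<and> Hausdorff_space X \<and> oriented_hyperbolic_atlas X \<A>"

text \<open>
  The genus of a closed connected orientable surface, through its Euler characteristic 2 - 2g.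
\<close>

definition has_genus :: "'a topology \<Rightarrow> nat \<Rightarrow> bool" where
  "has_genus X g \<longleftrightarrow> has_Euler_characteristic X (2 - 2 * int g)"

definition locally_isometric ::
    "complex set \<Rightarrow> ('a set \<times> ('a \<Rightarrow> complex)) set \<Rightarrow> (complex \<Rightarrow> 'a) \<Rightarrow> bool" where
  "locally_isometric P \<A> f \<longleftrightarrow>
     (\<forall>(U, \<phi>)\<in>\<A>. \<forall>x\<in>P. f x \<in> U \<longrightarrow>
        (\<exists>N. openin (top_of_set P) N \<and> x \<in> N \<and> f ` N \<subseteq> U \<and>
           (\<forall>y\<in>N. \<forall>z\<in>N. hyp_dist (\<phi> (f y)) (\<phi> (f z)) = hyp_dist y z)))"


section \<open>The right-angled regular polygon\<close>

text \<open>
  For p at least 5, the right-angled regular p-gon centred at 0. Edge i (for i < p, the indices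
  being taken mod p) lies on the geodesic cut out by the Euclidean circle with centre c i and radius
  r. The circle is orthogonal to the unit circle iff the square of |c i| is 1 + r^2; consecutive
  circles are orthogonal to each other iff the square of |c i - c (i+1)| is 2 r^2. Together these
  give 1 + r^2 = 1 / cos (2 pi / p). The negative angle makes the labelling clockwise.
\<close>

definition side_centre :: "nat \<Rightarrow> nat \<Rightarrow> complex" where
  "side_centre p i = complex_of_real (sqrt (1 / cos (2 * pi / p))) * cis (- (2 * pi * i / p))"

definition side_radius :: "nat \<Rightarrow> real" where
  "side_radius p = sqrt (1 / cos (2 * pi / p) - 1)"

definition ra_polygon :: "nat \<Rightarrow> complex set" where
  "ra_polygon p = {z \<in> ball 0 1. \<forall>i<p. side_radius p \<le> dist z (side_centre p i)}"

definition ra_edge :: "nat \<Rightarrow> nat \<Rightarrow> complex set" where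
  "ra_edge p i = {z \<in> ra_polygon p. dist z (side_centre p i) = side_radius p}"


section \<open>The right-angled Fuchsian building\<close>

text \<open>
  The fundamental group of G(P): since P is simply connected it is the direct limit of the local
  groups, i.e. it is presented by generators s 0, ..., s (p-1) with relations s i ^ q i = 1 and
  [s i, s (i+1)] = 1, indices mod p. Its elements are classes of positive words, which suffice
  because the generators have finite order.
\<close>

inductive word_eq :: "nat \<Rightarrow> (nat \<Rightarrow> nat) \<Rightarrow> nat list \<Rightarrow> nat list \<Rightarrow> bool" for p q where
  power: "i < p \<Longrightarrow> word_eq p q (u @ replicate (q i) i @ v) (u @ v)"
| comm: "i < p \<Longrightarrow> word_eq p q (u @ [i, Suc i mod p] @ v) (u @ [Suc i mod p, i] @ v)"
| refl: "word_eq p q u u"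
| sym: "word_eq p q u v \<Longrightarrow> word_eq p q v u"
| trans: "word_eq p q u v \<Longrightarrow> word_eq p q v w \<Longrightarrow> word_eq p q u w"

definition word_class :: "nat \<Rightarrow> (nat \<Rightarrow> nat) \<Rightarrow> nat list \<Rightarrow> nat list set" where
  "word_class p q u = {v. word_eq p q u v}"

definition pi1_group :: "nat \<Rightarrow> (nat \<Rightarrow> nat) \<Rightarrow> nat list set monoid" where
  "pi1_group p q =
     \<lparr>carrier = word_class p q ` lists {..<p},
      mult = (\<lambda>A B. \<Union>u\<in>A. \<Union>v\<in>B. word_class p q (u @ v)),
      one = word_class p q []\<rparr>"

lemma word_eq_cong: "word_eq p q u u' \<Longrightarrow> word_eq p q (a @ u @ b) (a @ u' @ b)"
proof (induction rule: word_eq.induct)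
  case (power i u v)
  then show ?case using word_eq.power[of i p q "a @ u" "v @ b"] by simp
next
  case (comm i u v)
  then show ?case using word_eq.comm[of i p q "a @ u" "v @ b"] by simp
qed (blast intro: word_eq.intros)+

lemma word_eq_append:
  "word_eq p q u u' \<Longrightarrow> word_eq p q v v' \<Longrightarrow> word_eq p q (u @ v) (u' @ v')"
  using word_eq_cong[of p q u u' "[]" v] word_eq_cong[of p q v v' u' "[]"]
  by (auto intro: word_eq.trans)

lemma word_class_eq_iff: "word_class p q u = word_class p q v \<longleftrightarrow> word_eq p q u v"
  unfolding word_class_def set_eq_iff mem_Collect_eq
  by (metis word_eq.refl word_eq.sym word_eq.trans)

lemma mult_word_class:
  "word_class p q u \<otimes>\<^bsub>pi1_group p q\<^esub> word_class p q v = word_class p q (u @ v)"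
  unfolding pi1_group_def word_class_def
  by (auto intro: word_eq.intros word_eq_append)

lemma group_pi1_group:
  assumes "\<And>i. i < p \<Longrightarrow> 0 < q i"
  shows "group (pi1_group p q)"
proof (rule groupI)
  let ?G = "pi1_group p q"
  have carr: "carrier ?G = word_class p q ` lists {..<p}" and one: "\<one>\<^bsub>?G\<^esub> = word_class p q []"
    by (simp_all add: pi1_group_def)
  show "\<one>\<^bsub>?G\<^esub> \<in> carrier ?G"
    by (simp add: carr one)
  show "\<And>x y. x \<in> carrier ?G \<Longrightarrow> y \<in> carrier ?G \<Longrightarrow> x \<otimes>\<^bsub>?G\<^esub> y \<in> carrier ?G"
    by (auto simp: carr mult_word_class intro!: imageI)
  show "\<And>x y z. x \<in> carrier ?G \<Longrightarrow> y \<in> carrier ?G \<Longrightarrow> z \<in> carrier ?G \<Longrightarrow>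
          x \<otimes>\<^bsub>?G\<^esub> y \<otimes>\<^bsub>?G\<^esub> z = x \<otimes>\<^bsub>?G\<^esub> (y \<otimes>\<^bsub>?G\<^esub> z)"
    by (auto simp: carr mult_word_class)
  show "\<And>x. x \<in> carrier ?G \<Longrightarrow> \<one>\<^bsub>?G\<^esub> \<otimes>\<^bsub>?G\<^esub> x = x"
    by (auto simp: carr one mult_word_class)
  have "\<exists>v\<in>lists {..<p}. word_eq p q (v @ u) []" if "u \<in> lists {..<p}" for u
    using that
  proof (induction u)
    case Nil
    then show ?case by (auto intro: bexI[of _ "[]"] word_eq.refl)
  next
    case (Cons i u)
    then obtain v where v: "v \<in> lists {..<p}" "word_eq p q (v @ u) []" and i: "i < p"
      by auto
    let ?w = "v @ replicate (q i - 1) i"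
    have "replicate (q i) i = replicate (q i - 1) i @ [i]"
      using assms[OF i] by (metis Suc_pred' replicate_Suc replicate_append_same)
    then have "?w @ i # u = v @ replicate (q i) i @ u"
      by (metis append.assoc append_Cons append_Nil)
    then have "word_eq p q (?w @ i # u) (v @ u)"
      using word_eq.power[OF i, of q v u] by (simp only:)
    moreover have "?w \<in> lists {..<p}"
      using v i by (auto simp: in_lists_conv_set)
    ultimately show ?case
      using v(2) word_eq.trans by blast
  qed
  then show "\<And>x. x \<in> carrier ?G \<Longrightarrow> \<exists>y\<in>carrier ?G. y \<otimes>\<^bsub>?G\<^esub> x = \<one>\<^bsub>?G\<^esub>"
    by (force simp: carr one mult_word_class word_class_eq_iff)
qed

text \<open>
  The local group at the smallest cell of P containing x: trivial in the interior, Z/q i on edge i,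
  and the product of Z/q i and Z/q (i+1) at the vertex common to edges i and i+1.
\<close>

definition local_group :: "nat \<Rightarrow> (nat \<Rightarrow> nat) \<Rightarrow> complex \<Rightarrow> nat list set set" where
  "local_group p q x = generate (pi1_group p q) {word_class p q [i] | i. i < p \<and> x \<in> ra_edge p i}"

text \<open>
  The universal cover of G(P) is the quotient of the product of its fundamental group with P by
  (h, x) ~ (h', x') iff x = x' and h, h' lie in the same left coset of the local group at x.
  The class of (h, x) is encoded by that coset together with x; the chamber of h consists of the
  points (h, x) with x in P.
\<close>

type_synonym building_point = "nat list set set \<times> complex"

definition bpoint :: "nat \<Rightarrow> (nat \<Rightarrow> nat) \<Rightarrow> nat list set \<Rightarrow> complex \<Rightarrow> building_point" where
  "bpoint p q h x = (h <#\<^bsub>pi1_group p q\<^esub> local_group p q x, x)"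

definition building :: "nat \<Rightarrow> (nat \<Rightarrow> nat) \<Rightarrow> building_point topology" where
  "building p q =
     quotient_topology
       (prod_topology (discrete_topology (carrier (pi1_group p q))) (top_of_set (ra_polygon p)))
       (\<lambda>(h, x). bpoint p q h x)"

definition polygon_isometry :: "nat \<Rightarrow> (complex \<Rightarrow> complex) \<Rightarrow> bool" where
  "polygon_isometry p \<sigma> \<longleftrightarrow>
     \<sigma> ` ra_polygon p = ra_polygon p \<and>
     (\<forall>x\<in>ra_polygon p. \<forall>y\<in>ra_polygon p. hyp_dist (\<sigma> x) (\<sigma> y) = hyp_dist x y)"

text \<open>
  Automorphisms carry chambers isometrically onto chambers; they need not respect the labels.
\<close>

definition building_auts :: "nat \<Rightarrow> (nat \<Rightarrow> nat) \<Rightarrow> (building_point \<Rightarrow> building_point) set" where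
  "building_auts p q =
     {\<phi> \<in> Bij (topspace (building p q)).
        \<forall>h\<in>carrier (pi1_group p q). \<exists>h'\<in>carrier (pi1_group p q). \<exists>\<sigma>. polygon_isometry p \<sigma> \<and>
          (\<forall>x\<in>ra_polygon p. \<phi> (bpoint p q h x) = bpoint p q h' (\<sigma> x))}"

definition Aut_building :: "nat \<Rightarrow> (nat \<Rightarrow> nat) \<Rightarrow> (building_point \<Rightarrow> building_point) monoid" where
  "Aut_building p q = (BijGroup (topspace (building p q)))\<lparr>carrier := building_auts p q\<rparr>"

definition Aut_topology :: "nat \<Rightarrow> (nat \<Rightarrow> nat) \<Rightarrow> (building_point \<Rightarrow> building_point) topology" where
  "Aut_topology p q = compact_open_topology (building p q) (building_auts p q)"


section \<open>Lattices\<close>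

text \<open>
  Left Haar measures on a locally compact, second countable Hausdorff group G with topology T;
  regularity is automatic for such groups.
\<close>

definition left_Haar_measure :: "('a, 'b) monoid_scheme \<Rightarrow> 'a topology \<Rightarrow> 'a measure \<Rightarrow> bool" where
  "left_Haar_measure G T \<mu> \<longleftrightarrow>
     space \<mu> = carrier G \<and> sets \<mu> = sigma_sets (carrier G) {U. openin T U} \<and>
     (\<forall>a\<in>carrier G. \<forall>B\<in>sets \<mu>. emeasure \<mu> (a <#\<^bsub>G\<^esub> B) = emeasure \<mu> B) \<and>
     emeasure \<mu> (carrier G) \<noteq> 0 \<and>
     (\<forall>a\<in>carrier G. \<exists>U. openin T U \<and> a \<in> U \<and> emeasure \<mu> U < \<infinity>)"

text \<open>
  The covolume of a discrete subgroup is the Haar measure of a Borel strict fundamental domain for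
  its action by left translations. A Haar measure exists and is unique up to a positive factor, so
  "for every Haar measure" and "for some Haar measure" mean the same here.
\<close>

definition finite_covolume :: "('a, 'b) monoid_scheme \<Rightarrow> 'a topology \<Rightarrow> 'a set \<Rightarrow> bool" where
  "finite_covolume G T \<Gamma> \<longleftrightarrow>
     (\<forall>\<mu>. left_Haar_measure G T \<mu> \<longrightarrow>
        (\<exists>D\<in>sets \<mu>. emeasure \<mu> D < \<infinity> \<and> (\<forall>a\<in>carrier G. \<exists>!\<gamma>. \<gamma> \<in> \<Gamma> \<and> \<gamma> \<otimes>\<^bsub>G\<^esub> a \<in> D)))"

definition lattice_in :: "('a, 'b) monoid_scheme \<Rightarrow> 'a topology \<Rightarrow> 'a set \<Rightarrow> bool" where
  "lattice_in G T \<Gamma> \<longleftrightarrow>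
     subgroup \<Gamma> G \<and> subtopology T \<Gamma> = discrete_topology \<Gamma> \<and> finite_covolume G T \<Gamma>"


section \<open>Quotients of the building\<close>

definition orbit_of :: "('a \<Rightarrow> 'a) set \<Rightarrow> 'a \<Rightarrow> 'a set" where
  "orbit_of \<Gamma> x = (\<lambda>\<gamma>. \<gamma> x) ` \<Gamma>"

definition building_quotient ::
    "nat \<Rightarrow> (nat \<Rightarrow> nat) \<Rightarrow> (building_point \<Rightarrow> building_point) set \<Rightarrow> building_point set topology" where
  "building_quotient p q \<Gamma> = quotient_topology (building p q) (orbit_of \<Gamma>)"

text \<open>
  The hyperbolic structure on the quotient is the one induced from the building: every chamber is
  mapped to it by a local isometry. At the boundary points of a chamber this forces the cone angles
  to be 2 pi, and it makes the images of the chambers a tessellation by right-angled regular p-gons.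
\<close>

definition chambers_locally_isometric ::
    "nat \<Rightarrow> (nat \<Rightarrow> nat) \<Rightarrow> (building_point \<Rightarrow> building_point) set \<Rightarrow>
      (building_point set set \<times> (building_point set \<Rightarrow> complex)) set \<Rightarrow> bool" where
  "chambers_locally_isometric p q \<Gamma> \<A> \<longleftrightarrow>
     (\<forall>h\<in>carrier (pi1_group p q).
        locally_isometric (ra_polygon p) \<A> (\<lambda>x. orbit_of \<Gamma> (bpoint p q h x)))"

end

theory Submission
  imports Defs
begin

text \<open>
  Take \<open>q\<close> constantly equal to 4, and let \<open>W\<close> be the fundamental group of \<open>G(P)\<close>. Let \<open>B\<close> be a
  finite group with involutions \<open>\<theta> i\<close>, one for each side of \<open>P\<close>, such that the
  involutions of adjacent sides are distinct and commute. They define a homomorphism \<open>\<Theta>\<close>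
  from \<open>W\<close> to \<open>B\<close> whose kernel meets each local group in its squares. Dividing the building by
  the kernel glues copies \<open>(b, P)\<close> of the polygon, one for each \<open>b\<close> in \<open>B\<close>, where \<open>(b, P)\<close> and
  \<open>(b \<theta> i, P)\<close> share their side \<open>i\<close>. Two polygons meet along a side and four around a
  vertex, and the angles are right: this is a closed hyperbolic surface. The kernel has torsion,
  since it contains the squares of the generators, but it acts freely on the chambers, and this
  is enough for a lattice.

  Fewer polygons are obtained by dividing by symmetries of the polygon as well. Let a subgroup
  \<open>A\<close> of \<open>B\<close> act on \<open>P\<close> by isometries so that conjugation by \<open>a\<close> permutes the \<open>\<theta> i\<close> as
  \<open>a\<close> permutes the sides. Then \<open>a\<close> maps the point \<open>x\<close> of the polygon \<open>b\<close> to the point \<open>a x\<close> of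
  the polygon \<open>b a\<^sup>-\<^sup>1\<close>. The combined group \<open>Gam\<close> consists of the automorphisms
  "\<open>a\<close>, followed by the left translation by \<open>h\<close>" with \<open>\<Theta> h \<cdot> a = 1\<close>; lemma
  \<open>orbit_eq\<close> describes its orbits by an equation in \<open>B\<close>. A fixed point in the surface would be a
  point \<open>x\<close> of \<open>P\<close> with \<open>a x = x\<close> and with \<open>a\<close> in the group generated by the involutions of the
  sides through \<open>x\<close>; the conditions \<open>free_side\<close> and \<open>free_vertex\<close> exclude it. The quotient has
  \<open>n = |B| / |A|\<close> faces, \<open>n p / 2\<close> edges and \<open>n p / 4\<close> vertices, hence Euler characteristic \<open>n
  (4 - p) / 4\<close>, and genus \<open>g\<close> means \<open>n = 8 (g - 1) / (p - 4)\<close>.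

  So a group \<open>B\<close> with \<open>|B| = n |A|\<close> is needed for every such \<open>n\<close> (lemma
  \<open>surface_data_dihedral\<close>). It is the product of a dihedral group of order \<open>2 m\<close> with a group of
  order 2. Even sides get reflections of the dihedral group and odd sides the central
  involution; here \<open>p\<close> must be even. As \<open>|B| = 4 m\<close>, the group \<open>A\<close> is trivial if 4 divides \<open>n\<close>.
  If \<open>n\<close> is 2 modulo 4, then 4 divides \<open>p\<close>, and \<open>A\<close> is generated by the reflection of \<open>P\<close> in an
  axis through two odd sides. If \<open>n\<close> is odd, then \<open>p\<close> is 4 modulo 8, and \<open>A\<close> has order 4 and is
  generated by this reflection and the one in the perpendicular axis, which passes through two
  even sides.

  Charts are obtained by unfolding the four polygons around a vertex with the two commuting
  reflections in the sides at this vertex (\<open>corner_map\<close>); \<open>corner_map_germ\<close> shows that the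
  transition maps are isometries, and \<open>corner_map_locally_inj\<close> uses the freeness. The covolume
  of \<open>Gam\<close> is finite (\<open>finite_covolume_Gam\<close>) because an automorphism carrying the base chamber
  to a given chamber is determined on a finite set of chambers up to finitely many
  possibilities, isometries of the polygon being determined by permutations of its vertices. For
  the Euler characteristic, \<open>card_fibre\<close> counts the pairs of a polygon and a cell of it that
  represent a given cell of the surface.
\<close>

section \<open>Isometries of the Poincare disc\<close>

text \<open>
  The isometries of the disc in the form given by the matrices of \<open>SU(1,1)\<close>, up to a positive
  scalar. The flag says whether the isometry preserves the orientation. This form is closed
  under composition by an elementary computation, which is all that the transition maps of the
  atlas below require.
\<close>

definition disc_isometry :: "bool \<Rightarrow> (complex \<Rightarrow> complex) \<Rightarrow> bool" where
  "disc_isometry s T \<longleftrightarrow> (\<exists>A B. cmod B < cmod A \<and>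
     (\<forall>z\<in>ball 0 1. T z = (let u = (if s then z else cnj z) in (A * u + B) / (cnj B * u + cnj A))))"

lemma disc_isometryI:
  assumes "cmod B < cmod A"
    and "\<And>z. cmod z < 1 \<Longrightarrow> T z = (A * (if s then z else cnj z) + B) / (cnj B * (if s then z else cnj z) + cnj A)"
  shows "disc_isometry s T"
  unfolding disc_isometry_def Let_def using assms by auto

lemma disc_denominator_nonzero:
  assumes "cmod B < cmod A" "cmod u < 1"
  shows "cnj B * u + cnj A \<noteq> 0"
proof
  assume "cnj B * u + cnj A = 0"
  then have "cnj A = - (cnj B * u)" by (simp add: eq_neg_iff_add_eq_0 add.commute)
  then have "cmod A = cmod B * cmod u"
    by (metis complex_mod_cnj norm_minus_cancel norm_mult)
  moreover have "cmod B * cmod u \<le> cmod B * 1"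
    using assms(2) by (intro mult_left_mono) auto
  ultimately show False
    using assms(1) by linarith
qed

text \<open>
  The form \<open>|a|\<^sup>2 - |b|\<^sup>2\<close> is multiplied by the determinant \<open>|A|\<^sup>2 -
  |B|\<^sup>2\<close>; this gives invariance of the disc and of the hyperbolic distance.
\<close>

lemma SU11_norm:
  assumes "cmod B < cmod A" "cmod u < 1"
  shows "1 - (cmod ((A * u + B) / (cnj B * u + cnj A)))\<^sup>2 =
    ((cmod A)\<^sup>2 - (cmod B)\<^sup>2) * (1 - (cmod u)\<^sup>2) / (cmod (cnj B * u + cnj A))\<^sup>2"
proof -
  have nz: "(cmod (cnj B * u + cnj A))\<^sup>2 \<noteq> 0"
    using disc_denominator_nonzero[OF assms] by simp
  have "(cmod (cnj B * u + cnj A))\<^sup>2 - (cmod (A * u + B))\<^sup>2 = ((cmod A)\<^sup>2 - (cmod B)\<^sup>2) * (1 - (cmod u)\<^sup>2)"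
    unfolding cmod_power2 by (simp, algebra)
  then show ?thesis
    using nz by (simp add: norm_divide power_divide field_simps)
qed

lemma disc_isometry_norm:
  assumes "disc_isometry s T" "cmod z < 1"
  shows "cmod (T z) < 1"
proof -
  obtain A B where AB: "cmod B < cmod A"
    "T z = (A * (if s then z else cnj z) + B) / (cnj B * (if s then z else cnj z) + cnj A)"
    using assms unfolding disc_isometry_def Let_def by auto
  have "cmod (if s then z else cnj z) < 1" using assms by auto
  note nz = disc_denominator_nonzero[OF AB(1) this] and eq = SU11_norm[OF AB(1) this]
  have "(cmod B)\<^sup>2 < (cmod A)\<^sup>2" using AB(1) by (simp add: power_strict_mono)
  moreover have "(cmod (if s then z else cnj z))\<^sup>2 < 1" using assms by (simp add: abs_square_less_1)
  ultimately have "1 - (cmod (T z))\<^sup>2 > 0"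
    unfolding AB(2) eq using nz by (intro divide_pos_pos mult_pos_pos) auto
  then show ?thesis by (simp add: abs_square_less_1)
qed

lemma hyp_dist_disc_isometry:
  assumes "disc_isometry s T" "cmod z < 1" "cmod w < 1"
  shows "hyp_dist (T z) (T w) = hyp_dist z w"
proof -
  obtain A B where AB: "cmod B < cmod A"
    "T z = (A * (if s then z else cnj z) + B) / (cnj B * (if s then z else cnj z) + cnj A)"
    "T w = (A * (if s then w else cnj w) + B) / (cnj B * (if s then w else cnj w) + cnj A)"
    using assms unfolding disc_isometry_def Let_def by auto
  define u v where uv: "u = (if s then z else cnj z)" "v = (if s then w else cnj w)"
  have n: "cmod u < 1" "cmod v < 1" and cu: "cmod u = cmod z" "cmod v = cmod w"
    and cuv: "cmod (u - v) = cmod (z - w)"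
    using assms unfolding uv by (auto simp flip: complex_cnj_diff)
  let ?a = "cnj B * u + cnj A" and ?b = "cnj B * v + cnj A"
  have nz: "?a \<noteq> 0" "?b \<noteq> 0" using disc_denominator_nonzero[OF AB(1)] n by auto
  define d where "d = (cmod A)\<^sup>2 - (cmod B)\<^sup>2"
  have d: "d > 0" using AB(1) by (simp add: power_strict_mono d_def)
  have "T z - T w = (A * cnj A - B * cnj B) * (u - v) / (?a * ?b)"
    unfolding AB uv[symmetric] using nz by (simp add: divide_simps) algebra
  also have "A * cnj A - B * cnj B = of_real d"
    by (simp add: d_def complex_mult_cnj cmod_power2)
  finally have "(cmod (T z - T w))\<^sup>2 = d\<^sup>2 * (cmod (z - w))\<^sup>2 / ((cmod ?a)\<^sup>2 * (cmod ?b)\<^sup>2)"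
    using d by (simp add: norm_mult norm_divide power_mult_distrib power_divide cuv)
  moreover have "1 - (cmod (T z))\<^sup>2 = d * (1 - (cmod z)\<^sup>2) / (cmod ?a)\<^sup>2"
    "1 - (cmod (T w))\<^sup>2 = d * (1 - (cmod w)\<^sup>2) / (cmod ?b)\<^sup>2"
    using SU11_norm[OF AB(1) n(1)] SU11_norm[OF AB(1) n(2)]
    unfolding AB(2,3) uv[symmetric] d_def cu by auto
  moreover have quot: "(d\<^sup>2 * n / (x * y)) / ((d * k / x) * (d * l / y)) = n / (k * l)"
    if "d \<noteq> 0" "x \<noteq> 0" "y \<noteq> 0" for d n x y k l :: real
    using that by (cases "k = 0 \<or> l = 0") (auto simp: field_simps power2_eq_square)
  ultimately have "(cmod (T z - T w))\<^sup>2 / ((1 - (cmod (T z))\<^sup>2) * (1 - (cmod (T w))\<^sup>2))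
     = (cmod (z - w))\<^sup>2 / ((1 - (cmod z)\<^sup>2) * (1 - (cmod w)\<^sup>2))"
    using quot[of d "(cmod ?a)\<^sup>2" "(cmod ?b)\<^sup>2"] d nz by simp
  then show ?thesis
    unfolding hyp_dist_def by (metis times_divide_eq_right)
qed

lemma disc_isometry_compose:
  assumes "disc_isometry s T" "disc_isometry s' T'"
  shows "disc_isometry (s = s') (T \<circ> T')"
proof -
  obtain A B where AB: "cmod B < cmod A"
    and T: "\<And>z. cmod z < 1 \<Longrightarrow> T z = (A * (if s then z else cnj z) + B) / (cnj B * (if s then z else cnj z) + cnj A)"
    using assms unfolding disc_isometry_def Let_def by auto
  obtain C D where CD: "cmod D < cmod C"
    and T': "\<And>z. cmod z < 1 \<Longrightarrow> T' z = (C * (if s' then z else cnj z) + D) / (cnj D * (if s' then z else cnj z) + cnj C)"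
    using assms unfolding disc_isometry_def Let_def by auto
  define C' where "C' = (if s then C else cnj C)"
  define D' where "D' = (if s then D else cnj D)"
  have CD': "cmod D' < cmod C'" using CD by (simp add: C'_def D'_def)
  let ?A = "A * C' + B * cnj D'" and ?B = "A * D' + B * cnj C'"
  have "(cmod ?A)\<^sup>2 - (cmod ?B)\<^sup>2 = ((cmod A)\<^sup>2 - (cmod B)\<^sup>2) * ((cmod C')\<^sup>2 - (cmod D')\<^sup>2)"
    unfolding cmod_power2 by (simp, algebra)
  moreover have "(cmod A)\<^sup>2 - (cmod B)\<^sup>2 > 0" "(cmod C')\<^sup>2 - (cmod D')\<^sup>2 > 0"
    using AB CD' by (simp_all add: power_strict_mono)
  ultimately have "(cmod ?A)\<^sup>2 > (cmod ?B)\<^sup>2" by (metis diff_gt_0_iff_gt mult_pos_pos)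
  then have lt: "cmod ?B < cmod ?A" by (rule power_less_imp_less_base) simp
  show ?thesis
  proof (rule disc_isometryI[OF lt])
    fix z :: complex assume z: "cmod z < 1"
    define u where "u = (if s = s' then z else cnj z)"
    have u: "cmod u < 1" using z by (simp add: u_def)
    have nT: "cmod (T' z) < 1" using disc_isometry_norm[OF assms(2) z] .
    have *: "(if s then T' z else cnj (T' z)) = (C' * u + D') / (cnj D' * u + cnj C')"
      unfolding T'[OF z] C'_def D'_def u_def by auto
    have nz: "cnj D' * u + cnj C' \<noteq> 0" using disc_denominator_nonzero[OF CD' u] .
    have nz2: "cnj ?B * u + cnj ?A \<noteq> 0" using disc_denominator_nonzero[OF lt u] .
    have "cmod ((C' * u + D') / (cnj D' * u + cnj C')) < 1" using nT * by (metis complex_mod_cnj)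
    then have nz3: "cnj B * ((C' * u + D') / (cnj D' * u + cnj C')) + cnj A \<noteq> 0"
      by (rule disc_denominator_nonzero[OF AB])
    have "(T \<circ> T') z = (A * ((C' * u + D') / (cnj D' * u + cnj C')) + B) /
            (cnj B * ((C' * u + D') / (cnj D' * u + cnj C')) + cnj A)"
      using T[OF nT] * by simp
    also have "\<dots> = (?A * u + ?B) / (cnj ?B * u + cnj ?A)"
      using nz nz2 nz3 by (simp add: divide_simps) algebra
    finally show "(T \<circ> T') z = (?A * (if s = s' then z else cnj z) + ?B) /
        (cnj ?B * (if s = s' then z else cnj z) + cnj ?A)"
      by (simp add: u_def)
  qed
qed

lemma disc_isometry_id: "disc_isometry True (\<lambda>z. z)"
  by (rule disc_isometryI[of 0 1]) auto

lemma disc_isometry_cnj: "disc_isometry False cnj"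
  by (rule disc_isometryI[of 0 1]) auto

lemma disc_isometry_scale:
  assumes "cmod c = 1"
  shows "disc_isometry True (\<lambda>z. c * z)" "disc_isometry False (\<lambda>z. c * cnj z)"
proof -
  (* a rotation by the angle t is the matrix with the diagonal entries cis (t / 2), cis (- t /
     2) *)
  define a where "a = csqrt c"
  have c: "c = a * a" by (metis a_def power2_csqrt power2_eq_square)
  have "cmod a = 1" using assms unfolding a_def by simp
  then have "a * cnj a = 1" by (simp flip: complex_norm_square)
  then have "c * cnj a = a" "a \<noteq> 0" by (auto simp: c mult.assoc)
  then have a: "c = a / cnj a" "a \<noteq> 0" by (auto simp: eq_divide_eq)
  show "disc_isometry True (\<lambda>z. c * z)"
    by (rule disc_isometryI[of 0 a]) (use a in auto)
  show "disc_isometry False (\<lambda>z. c * cnj z)"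
    by (rule disc_isometryI[of 0 a]) (use a in auto)
qed

lemma disc_isometry_continuous:
  assumes "disc_isometry s T"
  shows "continuous_on (ball 0 1) T"
proof -
  obtain A B where AB: "cmod B < cmod A"
    and T: "\<And>z. cmod z < 1 \<Longrightarrow> T z = (A * (if s then z else cnj z) + B) / (cnj B * (if s then z else cnj z) + cnj A)"
    using assms unfolding disc_isometry_def Let_def by auto
  have "continuous_on (ball 0 1) (\<lambda>z. (A * (if s then z else cnj z) + B) / (cnj B * (if s then z else cnj z) + cnj A))"
    using disc_denominator_nonzero[OF AB] by (cases s) (auto intro!: continuous_intros)
  then show ?thesis
    by (rule continuous_on_cong[THEN iffD1, rotated -1]) (use T in auto)
qed

text \<open>
  Multiplying numerator and denominator by a scalar leaves the map unchanged, so the rotation is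
  \<open>A / cnj A\<close> and the zero of the map is \<open>- B / A\<close>.
\<close>

lemma disc_isometry_Moebius:
  assumes "disc_isometry True T"
  obtains t w where "cmod w < 1" "\<And>z. cmod z < 1 \<Longrightarrow> T z = Moebius_function t w z"
proof -
  obtain A B where AB: "cmod B < cmod A"
    and T: "\<And>z. cmod z < 1 \<Longrightarrow> T z = (A * z + B) / (cnj B * z + cnj A)"
    using assms unfolding disc_isometry_def Let_def by auto
  have A: "A \<noteq> 0" using AB by auto
  have "cmod (A / cnj A) = 1" using A by (simp add: norm_divide)
  then obtain t where t: "A / cnj A = exp (\<i> * of_real t)"
    using complex_unimodular_polar by (metis cis_conv_exp cis.ctr)
  show ?thesis
  proof (rule that[of "- B / A" t])
    show "cmod (- B / A) < 1" using AB A by (simp add: norm_divide divide_simps)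
    fix z :: complex assume "cmod z < 1"
    then have nz: "cnj B * z + cnj A \<noteq> 0" by (rule disc_denominator_nonzero[OF AB])
    have "1 - cnj (- B / A) * z = (cnj B * z + cnj A) / cnj A" "z - (- B / A) = (A * z + B) / A"
      using A by (simp_all add: field_simps)
    then show "T z = Moebius_function t (- B / A) z"
      unfolding T[OF \<open>cmod z < 1\<close>] Moebius_function_def t[symmetric]
      using nz A by simp
  qed
qed

section \<open>The right-angled polygon with an even number of sides\<close>

text \<open>
  The power of \<open>z\<close> with respect to the circle of side \<open>i\<close>: it is negative beyond the side, zero
  on it, and positive on the polygon's side of it.
\<close>

definition side :: "nat \<Rightarrow> nat \<Rightarrow> complex \<Rightarrow> real" where
  "side p i z = 1 + (cmod z)\<^sup>2 - 2 * Re (z * cnj (side_centre p i))"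

definition sides :: "nat \<Rightarrow> complex \<Rightarrow> nat set" where
  "sides p z = {i. i < p \<and> side p i z = 0}"

definition nxt :: "nat \<Rightarrow> nat \<Rightarrow> nat" where
  "nxt p i = Suc i mod p"

definition adjacent :: "nat \<Rightarrow> nat \<Rightarrow> nat \<Rightarrow> bool" where
  "adjacent p i j \<longleftrightarrow> i < p \<and> j < p \<and> (j = nxt p i \<or> i = nxt p j)"

locale even_polygon =
  fixes p :: nat
  assumes p_ge: "6 \<le> p" and p_even: "even p"
begin

abbreviation "P \<equiv> ra_polygon p"

text \<open>
  Each side is seen from the centre under the angle \<open>2 * q0\<close>; \<open>kap\<close> is the distance of the
  centres of the circles from 0; \<open>rho\<close> is the distance of the vertices from 0, the smaller root
  of \<open>1 + x\<^sup>2 = 2 * al * x\<close>.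
\<close>

definition "q0 = pi / p"
definition "kap = sqrt (1 / cos (2 * pi / p))"
definition "al = kap * cos q0"
definition "rho = al - sqrt (al\<^sup>2 - 1)"
definition vert :: "nat \<Rightarrow> complex" where
  "vert i = of_real rho * cis (- ((2 * i + 1) * q0))"

lemma q0: "0 < q0" "q0 \<le> pi / 6" "real p * q0 = pi"
  using p_ge by (auto simp: q0_def field_simps)

lemma cos_2q0: "0 < cos (2 * q0)" "cos (2 * q0) < 1"
proof -
  show "0 < cos (2 * q0)" using q0 by (intro cos_gt_zero_pi) auto
  have "cos (2 * q0) < cos 0" using q0 by (intro cos_monotone_0_pi) auto
  then show "cos (2 * q0) < 1" by simp
qed

lemma cos_q0: "cos (2 * q0) < cos q0"
  using q0 by (intro cos_monotone_0_pi) auto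

lemma kap_sq: "kap\<^sup>2 = 1 / cos (2 * q0)" and kap_gt: "1 < kap"
proof -
  have e: "kap = sqrt (1 / cos (2 * q0))" by (simp add: kap_def q0_def)
  show "kap\<^sup>2 = 1 / cos (2 * q0)" unfolding e using cos_2q0 by simp
  show "1 < kap" unfolding e using cos_2q0 by (auto simp: real_less_rsqrt)
qed

lemma centre: "side_centre p i = of_real kap * cis (- (2 * i * q0))"
  by (simp add: side_centre_def kap_def q0_def mult_ac)

lemma norm_centre: "(cmod (side_centre p i))\<^sup>2 = kap\<^sup>2"
  using kap_gt by (simp add: centre norm_mult power_mult_distrib)

lemma side_radius_sq: "(side_radius p)\<^sup>2 = kap\<^sup>2 - 1" and side_radius_pos: "0 < side_radius p"
proof -
  have e: "side_radius p = sqrt (kap\<^sup>2 - 1)" unfolding kap_sq by (simp add: side_radius_def q0_def)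
  have "kap\<^sup>2 > 1" using kap_gt by (simp add: one_less_power)
  then show "(side_radius p)\<^sup>2 = kap\<^sup>2 - 1" "0 < side_radius p" unfolding e by auto
qed

lemma centre_mod: "side_centre p (i mod p) = side_centre p i"
proof -
  have "2 * real i * q0 = 2 * real (i mod p) * q0 + 2 * pi * real (i div p)"
  proof -
    have "real i = real (i mod p) + real p * real (i div p)"
      by (metis mod_mult_div_eq of_nat_add of_nat_mult)
    then have "2 * real i * q0 = 2 * real (i mod p) * q0 + 2 * (real p * q0) * real (i div p)"
      by (simp add: algebra_simps)
    then show ?thesis using q0(3) by simp
  qed
  moreover have "cis (- (x + 2 * pi * real n)) = cis (- x)" for x n
  proof -
    have "cis (- (x + 2 * pi * real n)) = cis (- x) * cis (2 * pi * (- of_nat n))"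
      by (simp add: cis_mult algebra_simps)
    also have "cis (2 * pi * (- of_nat n)) = 1"
      by (metis Ints_minus Ints_of_nat cis_multiple_2pi)
    finally show ?thesis by simp
  qed
  ultimately show ?thesis
    unfolding centre by metis
qed

lemma side_mod: "side p (i mod p) z = side p i z"
  by (simp add: side_def centre_mod)

lemma side_dist: "(dist z (side_centre p i))\<^sup>2 - (side_radius p)\<^sup>2 = side p i z"
proof -
  have "(dist z (side_centre p i))\<^sup>2 =
      (cmod z)\<^sup>2 + (cmod (side_centre p i))\<^sup>2 - 2 * Re (z * cnj (side_centre p i))"
    unfolding dist_norm cmod_power2 by (simp add: power2_eq_square algebra_simps)
  then show ?thesis unfolding norm_centre side_radius_sq side_def by simp
qed

lemma polygon_iff: "z \<in> P \<longleftrightarrow> cmod z < 1 \<and> (\<forall>i<p. 0 \<le> side p i z)"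
proof -
  have "side_radius p \<le> dist z (side_centre p i) \<longleftrightarrow> 0 \<le> side p i z" for i
    unfolding side_dist[symmetric] using side_radius_pos
    by (metis abs_le_square_iff abs_of_nonneg diff_ge_0_iff_ge less_imp_le zero_le_dist)
  then show ?thesis by (auto simp: ra_polygon_def)
qed

lemma polygonD: "z \<in> P \<Longrightarrow> cmod z < 1" "z \<in> P \<Longrightarrow> 0 \<le> side p i z"
  using polygon_iff side_mod[of i z] p_ge by (auto, metis mod_less_divisor not_numeral_le_zero gr0I)

lemma edge_iff: "z \<in> ra_edge p i \<longleftrightarrow> z \<in> P \<and> side p i z = 0"
proof -
  have "dist z (side_centre p i) = side_radius p \<longleftrightarrow> side p i z = 0"
    unfolding side_dist[symmetric] using side_radius_pos
    by (metis less_imp_le power2_eq_iff_nonneg right_minus_eq zero_le_dist)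
  then show ?thesis by (auto simp: ra_edge_def)
qed

lemma sides_edge: "z \<in> P \<Longrightarrow> sides p z = {i. i < p \<and> z \<in> ra_edge p i}"
  by (auto simp: sides_def edge_iff)

lemma zero_in: "0 \<in> P" "sides p 0 = {}"
  by (auto simp: polygon_iff side_def sides_def)

lemma side_polar: "side p j (of_real r * cis (- x)) = 1 + r\<^sup>2 - 2 * (r * kap * cos (x - 2 * j * q0))"
proof -
  have "of_real r * cis (- x) * cnj (side_centre p j) = of_real (r * kap) * (cis (- x) * cis (2 * j * q0))"
    by (simp add: centre cis_cnj)
  also have "\<dots> = of_real (r * kap) * cis (- (x - 2 * j * q0))"
    unfolding cis_mult by simp
  finally have "Re (of_real r * cis (- x) * cnj (side_centre p j)) =
      Re (of_real (r * kap) * cis (- (x - 2 * j * q0)))"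
    by (rule arg_cong)
  also have "\<dots> = r * kap * cos (x - 2 * j * q0)" by (simp del: minus_diff_eq)
  finally have "Re (of_real r * cis (- x) * cnj (side_centre p j)) = r * kap * cos (x - 2 * j * q0)" .
  then show ?thesis unfolding side_def by (simp add: norm_mult)
qed

subsection \<open>The two sides nearest to a direction\<close>

text \<open>
  Every direction lies within the angle \<open>q0\<close> of a vertex. Only the two sides at that vertex can
  contain a point of the polygon in this direction, because the centres of all other circles are
  seen under an angle of at least \<open>2 * q0\<close> from it (\<open>far_sides\<close>).
\<close>

lemma nearest_vertex:
  obtains i s where "i < p" "\<bar>s\<bar> \<le> q0" "z = of_real (cmod z) * cis (- ((2 * real i + 1) * q0 + s))"
proof -
  define th where "th = - Arg z"
  have z: "z = of_real (cmod z) * cis (- th)"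
    using rcis_cmod_Arg[of z] by (simp add: th_def rcis_def)
  define n where "n = \<lfloor>th / (2 * q0)\<rfloor>"
  define i where "i = nat (n mod int p)"
  define s where "s = th - 2 * q0 * n - q0"
  have fl: "of_int n \<le> th / (2 * q0)" "th / (2 * q0) < of_int n + 1"
    unfolding n_def by linarith+
  have p0: "int p > 0" using p_ge by simp
  have i: "int i = n mod int p" "i < p" using p0
    by (simp_all add: i_def nat_less_iff)
  have "\<bar>s\<bar> \<le> q0" using fl q0(1) by (auto simp: s_def field_simps abs_le_iff)
  have "real_of_int n = real i + real p * of_int (n div int p)"
    using i(1) by (metis mod_mult_div_eq of_int_add of_int_mult of_int_of_nat_eq)
  then have "th = (2 * real i + 1) * q0 + s + 2 * (real p * q0) * of_int (n div int p)"
    unfolding s_def by (simp add: algebra_simps)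
  then have th: "- th = - ((2 * real i + 1) * q0 + s) + 2 * pi * of_int (- (n div int p))"
    using q0(3) by simp
  have "cis (- th) = cis (- ((2 * real i + 1) * q0 + s)) * cis (2 * pi * of_int (- (n div int p)))"
    unfolding th cis_mult by simp
  also have "cis (2 * pi * of_int (- (n div int p))) = 1"
    by (rule cis_multiple_2pi) auto
  finally show ?thesis using that[of i s] i \<open>\<bar>s\<bar> \<le> q0\<close> z by simp
qed

lemma cos_le_far:
  assumes "0 \<le> x" "x \<le> y" "y \<le> 2 * pi - x"
  shows "cos y \<le> cos x"
proof (cases "y \<le> pi")
  case True then show ?thesis using assms by (intro cos_monotone_0_pi_le) auto
next
  case False
  then have "cos (2 * pi - y) \<le> cos x" using assms by (intro cos_monotone_0_pi_le) auto
  then show ?thesis by (simp add: cos_diff)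
qed

lemma far_sides:
  assumes "i < p" "\<bar>s\<bar> \<le> q0" "j < p" "j \<noteq> i" "j \<noteq> nxt p i"
  shows "cos ((2 * real i + 1) * q0 + s - 2 * real j * q0) \<le> cos (2 * q0)"
proof -
  define e where "e = (int i - int j) mod int p"
  define k where "k = (int i - int j) div int p"
  have p0: "int p > 0" using p_ge by simp
  have e: "0 \<le> e" "e < int p" using p0 by (auto simp: e_def)
  have ik: "int i - int j = int p * k + e" by (simp add: e_def k_def)
  have "e \<noteq> 0"
  proof
    assume "e = 0"
    then have "int i mod int p = int j mod int p" by (simp add: e_def mod_eq_dvd_iff dvd_eq_mod_eq_0)
    then show False using assms by simp
  qed
  moreover have "e \<noteq> int p - 1"
  proof
    assume "e = int p - 1"
    then have "int i - int j = int p * (k + 1) - 1" using ik by (simp add: algebra_simps)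
    then have "int j - int (Suc i) = int p * (- (k + 1))" by (simp add: algebra_simps)
    then have "int p dvd int j - int (Suc i)" by (metis dvd_triv_left)
    then have "int j mod int p = int (Suc i) mod int p" by (simp only: mod_eq_dvd_iff)
    then have "j mod p = Suc i mod p" by (metis of_nat_mod of_nat_eq_iff)
    then show False using assms by (simp add: nxt_def)
  qed
  ultimately have e': "1 \<le> real_of_int e" "real_of_int e \<le> real p - 2" using e by linarith+
  have "real i - real j = real p * real_of_int k + e"
    using ik by (metis of_int_add of_int_diff of_int_mult of_int_of_nat_eq)
  note h = this
  have "(2 * real i + 1) * q0 + s - 2 * real j * q0 = (2 * (real i - real j) + 1) * q0 + s"
    by (simp add: algebra_simps)
  also have "\<dots> = (2 * e + 1) * q0 + s + 2 * (real p * q0) * k"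
    unfolding h by (simp add: algebra_simps)
  finally have *: "(2 * real i + 1) * q0 + s - 2 * real j * q0 = (2 * e + 1) * q0 + s + 2 * pi * k"
    using q0(3) by simp
  have "cos ((2 * e + 1) * q0 + s + 2 * pi * k) = cos ((2 * e + 1) * q0 + s)"
    by (simp add: cos_add sin_int_2pin cos_int_2pin)
  moreover have "cos ((2 * e + 1) * q0 + s) \<le> cos (2 * q0)"
  proof (rule cos_le_far)
    have "2 * q0 \<le> 2 * e * q0" using e'(1) q0(1) by simp
    then show "2 * q0 \<le> (2 * e + 1) * q0 + s" using assms(2) by (simp add: algebra_simps)
    have "e * q0 \<le> (real p - 2) * q0" using e'(2) q0(1) by simp
    then have "e * q0 \<le> pi - 2 * q0" using q0(3) by (simp add: algebra_simps)
    then show "(2 * e + 1) * q0 + s \<le> 2 * pi - 2 * q0" using assms(2) by (simp add: algebra_simps)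
  qed (use q0 in auto)
  ultimately show ?thesis unfolding * by simp
qed

lemma near_angles:
  "(2 * real i + 1) * q0 + s - 2 * real i * q0 = q0 + s"
  "(2 * real i + 1) * q0 + s - 2 * real (Suc i) * q0 = s - q0"
  by (simp_all add: algebra_simps)

lemma al_gt: "1 < al"
proof -
  have "al\<^sup>2 = (cos q0)\<^sup>2 / cos (2 * q0)" unfolding al_def power_mult_distrib kap_sq by simp
  also have "\<dots> > 1" using cos_2q0 cos_double_cos[of q0] by (simp add: divide_simps)
  finally show ?thesis
    using kap_gt cos_2q0 cos_q0 by (intro power_less_imp_less_base[of 1 2 al]) (auto simp: al_def)
qed

lemma rho: "0 < rho" "rho < 1" "1 + rho\<^sup>2 = 2 * al * rho"
proof -
  define s where "s = sqrt (al\<^sup>2 - 1)"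
  have "al\<^sup>2 - 1 > 0" using al_gt by (simp add: one_less_power)
  then have s: "s\<^sup>2 = al\<^sup>2 - 1" "0 < s" by (auto simp: s_def)
  have r: "rho = al - s" by (simp add: rho_def s_def)
  have "s < al" using s al_gt by (intro power_less_imp_less_base[of s 2 al]) auto
  then show "0 < rho" by (simp add: r)
  have "(al - 1)\<^sup>2 < s\<^sup>2" unfolding s using al_gt by (simp add: power2_eq_square algebra_simps)
  then have "al - 1 < s" using s by (intro power_less_imp_less_base[of "al - 1" 2 s]) auto
  then show "rho < 1" by (simp add: r)
  show "1 + rho\<^sup>2 = 2 * al * rho" unfolding r using s(1) by (simp add: power2_eq_square algebra_simps)
qed

lemma le_rho:
  assumes "t < 1" "2 * al * t \<le> 1 + t\<^sup>2"
  shows "t \<le> rho"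
proof (rule ccontr)
  assume "\<not> t \<le> rho"
  moreover from this have "rho * t < 1 * 1" using rho assms(1) by (intro mult_strict_mono) auto
  ultimately have "(t - rho) * (1 - rho * t) > 0"
    by (intro mult_pos_pos) auto
  moreover have "(t - rho) * (1 - rho * t) = (1 + rho\<^sup>2) * t - rho * (1 + t\<^sup>2)"
    by (simp add: power2_eq_square algebra_simps)
  moreover have "\<dots> = rho * (2 * al * t - (1 + t\<^sup>2))"
    unfolding rho(3) by (simp add: algebra_simps)
  ultimately have "2 * al * t - (1 + t\<^sup>2) > 0" using rho(1) by (simp add: zero_less_mult_iff)
  then show False using assms by simp
qed

lemma vert_norm: "cmod (vert i) = rho"
  using rho by (simp add: vert_def norm_mult)

text \<open>
  All combinatorial facts on the polygon come from here: the vertices are its points farthest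
  from the centre, and two sides meet at most in a vertex, where they are consecutive.
\<close>

lemma polygon_point:
  assumes "z \<in> P"
  obtains i where "i < p" "cmod z \<le> rho" "sides p z \<subseteq> {i, nxt p i}"
    "sides p z = {i, nxt p i} \<Longrightarrow> z = vert i" "cmod z = rho \<Longrightarrow> z = vert i"
proof -
  obtain i s where i: "i < p" "\<bar>s\<bar> \<le> q0" and z: "z = of_real (cmod z) * cis (- ((2 * real i + 1) * q0 + s))"
    by (rule nearest_vertex)
  define r where "r = cmod z"
  define C where "C j = cos ((2 * real i + 1) * q0 + s - 2 * real j * q0)" for j :: nat
  have r: "0 \<le> r" "r < 1" using assms by (auto simp: r_def polygon_iff)
  have sd: "side p j z = 1 + r\<^sup>2 - 2 * (r * kap * C j)" for j
    unfolding C_def r_def by (subst (1) z) (rule side_polar)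
  have le: "2 * (r * kap * C j) \<le> 1 + r\<^sup>2" for j using polygonD(2)[OF assms, of j] sd by simp
  have C0: "C i = cos (q0 + s)" "C (Suc i) = cos (q0 - s)"
    unfolding C_def near_angles by (auto simp: cos_diff)
  obtain j where j: "j \<in> {i, Suc i}" "C j = cos (q0 - \<bar>s\<bar>)"
    using C0 by (cases "s \<ge> 0") auto
  have Cj: "C j \<ge> cos q0" unfolding j using q0 i(2) by (intro cos_monotone_0_pi_le) auto
  have rk: "0 \<le> r * kap" using r kap_gt by simp
  have "2 * al * r \<le> 2 * (r * kap * C j)"
    using mult_left_mono[OF Cj rk] by (simp add: al_def algebra_simps)
  also note le
  (* the nearer of the two sides already confines z to the disc of radius rho *)
  finally have a: "2 * al * r \<le> 1 + r\<^sup>2" .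
  have rr: "r \<le> rho" by (rule le_rho[OF r(2) a])
  have vz: "z = vert i" if "s = 0" "r = rho"
    unfolding vert_def using that z r_def by simp
  have sub: "sides p z \<subseteq> {i, nxt p i}"
  proof
    fix k assume k: "k \<in> sides p z"
    show "k \<in> {i, nxt p i}"
    proof (rule ccontr)
      assume "k \<notin> {i, nxt p i}"
      then have "C k \<le> cos (2 * q0)" unfolding C_def using far_sides[OF i, of k] k by (auto simp: sides_def)
      then have "C k < C j" using cos_q0 Cj by simp
      have eq: "2 * (r * kap * C k) = 1 + r\<^sup>2" using k sd[of k] by (simp add: sides_def)
      then have "r * kap \<noteq> 0" by (metis add_pos_nonneg less_numeral_extra(3) mult_zero_left mult_zero_right zero_le_power2 zero_less_one)
      then have "0 < r * kap" using rk by linarith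
      then have "r * kap * C k < r * kap * C j" using \<open>C k < C j\<close> by (intro mult_strict_left_mono)
      then show False using eq le[of j] by simp
    qed
  qed
  show ?thesis
  proof (rule that[OF i(1) _ sub])
    show "cmod z \<le> rho" using rr r_def by simp
    show "z = vert i" if "cmod z = rho"
    proof -
      have "r = rho" using that r_def by simp
      then have "2 * (rho * kap * C j) \<le> 2 * al * rho" using le[of j] rho(3) by simp
      then have "rho * kap * C j \<le> rho * kap * cos q0" by (simp add: al_def mult_ac)
      then have "C j \<le> cos q0" using rho(1) kap_gt by simp
      then have *: "cos (q0 - \<bar>s\<bar>) = cos q0" using Cj j by simp
      have "q0 - \<bar>s\<bar> = q0" by (rule cos_inj_pi[OF _ _ _ _ *]) (use q0 i(2) in linarith)+
      then show ?thesis using vz \<open>r = rho\<close> by simp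
    qed
    show "z = vert i" if sz: "sides p z = {i, nxt p i}"
    proof -
      have "i \<in> sides p z" "nxt p i \<in> sides p z" using sz by blast+
      then have e1: "side p i z = 0" and e2: "side p (Suc i) z = 0"
        by (simp_all add: sides_def nxt_def side_mod)
      then have *: "r * kap * C i = r * kap * C (Suc i)" and **: "2 * (r * kap * C i) = 1 + r\<^sup>2"
        using sd[of i] sd[of "Suc i"] unfolding e1 e2 by linarith+
      have "r * kap \<noteq> 0" using ** by (metis add_pos_nonneg less_numeral_extra(3) mult_zero_left mult_zero_right zero_le_power2 zero_less_one)
      then have cs: "cos (q0 + s) = cos (q0 - s)" using * C0 by simp
      have "q0 + s = q0 - s" by (rule cos_inj_pi[OF _ _ _ _ cs]) (use q0 i(2) in linarith)+
      then have s: "s = 0" by simp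
      have e: "2 * al * r = 1 + r\<^sup>2" using ** C0(1) s by (simp add: al_def algebra_simps)
      have "(r - rho) * (1 - rho * r) = (1 + rho\<^sup>2) * r - rho * (1 + r\<^sup>2)"
        by (simp add: power2_eq_square algebra_simps)
      also have "\<dots> = 0" unfolding rho(3) e[symmetric] by simp
      finally have "r = rho \<or> rho * r = 1" by auto
      moreover have "rho * r < 1" using rho r mult_strict_mono[of rho 1 r 1] by auto
      ultimately show ?thesis using vz s by auto
    qed
  qed
qed

lemma nxt: "i < p \<Longrightarrow> nxt p i < p" "i < p \<Longrightarrow> nxt p i \<noteq> i" "i < p \<Longrightarrow> nxt p (nxt p i) \<noteq> i"
  using p_ge by (auto simp: nxt_def mod_Suc)

lemma nxt_pair_inj: "i < p \<Longrightarrow> j < p \<Longrightarrow> {i, nxt p i} = {j, nxt p j} \<Longrightarrow> i = j"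
  using nxt by (metis doubleton_eq_iff)

lemma adjacent_nxt: "i < p \<Longrightarrow> adjacent p i (nxt p i)"
  by (simp add: adjacent_def nxt)

lemma cos_odd: "cos ((2 * of_int d + 1) * q0) \<le> cos q0"
proof -
  define e where "e = d mod int p"
  have p0: "int p > 0" using p_ge by simp
  have e: "0 \<le> e" "e \<le> int p - 1" using p0 by (auto simp: e_def)
  then have e': "0 \<le> real_of_int e" "real_of_int e \<le> real p - 1" by linarith+
  have "real_of_int d = e + real p * of_int (d div int p)"
    by (metis e_def mod_mult_div_eq of_int_add of_int_mult of_int_of_nat_eq)
  then have "(2 * of_int d + 1) * q0 = (2 * of_int e + 1) * q0 + 2 * (real p * q0) * of_int (d div int p)"
    by (simp add: algebra_simps)
  then have "(2 * of_int d + 1) * q0 = (2 * of_int e + 1) * q0 + 2 * pi * of_int (d div int p)"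
    using q0(3) by simp
  then have "cos ((2 * of_int d + 1) * q0) = cos ((2 * of_int e + 1) * q0)"
    by (simp add: cos_add sin_int_2pin cos_int_2pin)
  also have "\<dots> \<le> cos q0"
  proof (rule cos_le_far)
    show "q0 \<le> (2 * of_int e + 1) * q0" using e'(1) q0(1) by simp
    have "e * q0 \<le> (real p - 1) * q0" using e'(2) q0(1) by simp
    then have "e * q0 \<le> pi - q0" using q0(3) by (simp add: algebra_simps)
    then show "(2 * of_int e + 1) * q0 \<le> 2 * pi - q0" by (simp add: algebra_simps)
  qed (use q0 in auto)
  finally show ?thesis .
qed

lemma side_vert: "side p j (vert i) = 2 * rho * kap * (cos q0 - cos ((2 * of_int (int i - int j) + 1) * q0))"
proof -
  have "side p j (vert i) = 1 + rho\<^sup>2 - 2 * (rho * kap * cos ((2 * real i + 1) * q0 - 2 * real j * q0))"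
    unfolding vert_def using side_polar[of j rho "(2 * real i + 1) * q0"] by (simp add: add.commute)
  also have "(2 * real i + 1) * q0 - 2 * real j * q0 = (2 * of_int (int i - int j) + 1) * q0"
    by (simp add: algebra_simps)
  finally show ?thesis using rho(3) by (simp add: al_def algebra_simps)
qed

lemma vert_in: "vert i \<in> P"
  unfolding polygon_iff vert_norm side_vert
  using rho kap_gt cos_odd by (auto intro!: mult_nonneg_nonneg simp del: of_int_diff)

lemma sides_vert: assumes "i < p" shows "sides p (vert i) = {i, nxt p i}"
proof -
  have "side p i (vert i) = 0" unfolding side_vert by simp
  moreover have "side p (Suc i) (vert i) = 0"
  proof -
    have e: "(2 * real_of_int (int i - int (Suc i)) + 1) * q0 = - q0" by simp
    show ?thesis unfolding side_vert e by simp
  qed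
  ultimately have sub: "{i, nxt p i} \<subseteq> sides p (vert i)"
    using assms nxt(1) side_mod[of "Suc i"] by (auto simp: sides_def nxt_def)
  obtain j where j: "j < p" "sides p (vert i) \<subseteq> {j, nxt p j}"
    using polygon_point[OF vert_in[of i]] by blast
  have "card {i, nxt p i} = 2" "card {j, nxt p j} = 2" using nxt(2) assms j
    by (metis card_2_iff)+
  then have "{i, nxt p i} = {j, nxt p j}"
    using sub j(2) by (intro card_subset_eq) auto
  then show ?thesis using sub j by auto
qed

lemma sides_eq_pair: "z \<in> P \<Longrightarrow> i < p \<Longrightarrow> sides p z = {i, nxt p i} \<longleftrightarrow> z = vert i"
proof
  assume z: "z \<in> P" "i < p" "sides p z = {i, nxt p i}"
  obtain j where j: "j < p" "sides p z \<subseteq> {j, nxt p j}" "sides p z = {j, nxt p j} \<Longrightarrow> z = vert j"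
    using polygon_point[OF z(1)] by metis
  have "card {i, nxt p i} = 2" "card {j, nxt p j} = 2" using nxt(2) z j
    by (metis card_2_iff)+
  then have "{i, nxt p i} = {j, nxt p j}"
    using z j(2) by (intro card_subset_eq) auto
  then show "z = vert i" using j z nxt_pair_inj by metis
qed (use sides_vert in auto)

lemma sides_cases:
  assumes "z \<in> P"
  obtains "sides p z = {}" | j where "j < p" "sides p z = {j}"
    | j where "j < p" "sides p z = {j, nxt p j}" "z = vert j"
proof -
  obtain j where j: "j < p" "sides p z \<subseteq> {j, nxt p j}" using polygon_point[OF assms] by metis
  then consider "sides p z = {}" | "sides p z = {j}" | "sides p z = {nxt p j}" | "sides p z = {j, nxt p j}"
    by blast
  then show ?thesis
  proof cases
    case 4
    then show ?thesis using that(3)[of j] j(1) sides_eq_pair[OF assms j(1)] by simp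
  qed (use that(1,2) j(1) nxt(1) in auto)
qed

lemma side_open:
  assumes "x \<in> S" "side p j x > 0"
  shows "eventually (\<lambda>y. side p j y > 0) (nhds x)"
proof -
  have "isCont (side p j) x" unfolding side_def[abs_def] by (auto intro!: continuous_intros isCont_Re)
  then have "(side p j \<longlongrightarrow> side p j x) (nhds x)" by (simp add: isCont_def tendsto_at_iff_tendsto_nhds)
  then show ?thesis using assms order_tendstoD(1) by blast
qed

subsection \<open>Shape of the polygon\<close>

lemma polygon_norm: "z \<in> P \<Longrightarrow> cmod z \<le> rho"
  using polygon_point by metis

lemma side_continuous: "continuous_on S (side p i)"
  unfolding side_def[abs_def] by (intro continuous_intros)

lemma polygon_eq: "P = {z \<in> cball 0 rho. \<forall>i<p. 0 \<le> side p i z}"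
  using polygon_norm rho by (auto simp: polygon_iff)

lemma compact_polygon: "compact P"
proof -
  have "closed (\<Inter>i\<in>{..<p}. {z. 0 \<le> side p i z})"
    by (intro closed_INT ballI closed_Collect_le continuous_on_const side_continuous)
  moreover have "P = cball 0 rho \<inter> (\<Inter>i\<in>{..<p}. {z. 0 \<le> side p i z})"
    by (subst polygon_eq) auto
  ultimately show ?thesis by (metis compact_Int_closed compact_cball)
qed

lemma open_interior_polygon: "open {z \<in> P. sides p z = {}}"
proof -
  have "open (\<Inter>i\<in>{..<p}. {z. 0 < side p i z})"
    by (intro open_INT finite_lessThan ballI open_Collect_less continuous_on_const side_continuous)
  moreover have "{z \<in> P. sides p z = {}} = ball 0 1 \<inter> (\<Inter>i\<in>{..<p}. {z. 0 < side p i z})"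
    by (auto simp: polygon_iff sides_def order_less_le)
  ultimately show ?thesis by auto
qed

text \<open>
  If \<open>side p i z\<close> is nonnegative, then the value at \<open>t z\<close> is at least \<open>(1 - t) (1 - t
  |z|\<^sup>2)\<close>. So the polygon is star-shaped with respect to 0, and the inner points of its
  radii lie on no side.
\<close>

lemma side_scale:
  assumes "z \<in> P" "0 \<le> t" "t < 1"
  shows "0 < side p i (t *\<^sub>R z)"
proof -
  have "2 * Re (z * cnj (side_centre p i)) \<le> 1 + (cmod z)\<^sup>2"
    using polygonD(2)[OF assms(1), of i] by (simp add: side_def)
  then have "t * (2 * Re (z * cnj (side_centre p i))) \<le> t * (1 + (cmod z)\<^sup>2)"
    using assms by (intro mult_left_mono)
  moreover have "side p i (t *\<^sub>R z) = 1 + t\<^sup>2 * (cmod z)\<^sup>2 - t * (2 * Re (z * cnj (side_centre p i)))"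
    by (simp add: side_def power_mult_distrib algebra_simps)
  moreover have "(1 - t) * (1 - t * (cmod z)\<^sup>2) > 0"
  proof -
    have "t * (cmod z)\<^sup>2 \<le> 1 * 1"
      using assms polygonD(1)[OF assms(1)] by (intro mult_mono) (auto simp: abs_square_le_1)
    moreover have "t * (cmod z)\<^sup>2 \<noteq> 1"
    proof
      assume a: "t * (cmod z)\<^sup>2 = 1"
      then have "t * (cmod z)\<^sup>2 \<le> t * 1" using assms polygonD(1)[OF assms(1)] by (intro mult_left_mono) (auto simp: abs_square_le_1)
      then show False using a assms by simp
    qed
    ultimately show ?thesis using assms by auto
  qed
  moreover have "(1 - t) * (1 - t * (cmod z)\<^sup>2) = 1 + t\<^sup>2 * (cmod z)\<^sup>2 - t * (1 + (cmod z)\<^sup>2)"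
    by (simp add: power2_eq_square algebra_simps)
  ultimately show ?thesis by linarith
qed

lemma polygon_scale:
  assumes "z \<in> P" "0 \<le> t" "t < 1"
  shows "t *\<^sub>R z \<in> P" "sides p (t *\<^sub>R z) = {}"
proof -
  have "cmod (t *\<^sub>R z) < 1"
    using assms polygonD(1)[OF assms(1)] mult_le_one[of t "cmod z"] mult_strict_mono[of t 1 "cmod z" 1]
    by (cases "cmod z = 0") auto
  then show "t *\<^sub>R z \<in> P" using side_scale[OF assms] by (auto simp: polygon_iff less_imp_le)
  show "sides p (t *\<^sub>R z) = {}" using side_scale[OF assms] by (auto simp: sides_def) (metis less_irrefl)
qed

lemma connected_polygon: "connected P"
proof (rule starlike_imp_connected)
  show "starlike P"
    unfolding starlike_def
  proof (intro bexI[of _ 0] ballI subsetI)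
    fix x y assume "x \<in> P" "y \<in> closed_segment 0 x"
    then obtain t where "0 \<le> t" "t \<le> 1" "y = t *\<^sub>R x" by (auto simp: in_segment)
    then show "y \<in> P" using polygon_scale(1)[OF \<open>x \<in> P\<close>, of t] \<open>x \<in> P\<close> by (cases "t = 1") auto
  qed (use zero_in in auto)
qed

lemma interior_polygon: "interior P = {z \<in> P. sides p z = {}}"
proof
  show "{z \<in> P. sides p z = {}} \<subseteq> interior P"
    using open_interior_polygon by (intro interior_maximal) auto
  show "interior P \<subseteq> {z \<in> P. sides p z = {}}"
  proof
    fix z assume z: "z \<in> interior P"
    then have zP: "z \<in> P" using interior_subset by auto
    obtain e where e: "e > 0" "ball z e \<subseteq> P" using z by (meson mem_interior)
    (* pushing z outwards by the factor 1 + e / 2 does not leave P, so z = t (z / t) is a proper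
       contraction of a point of P *)
    define t where "t = 1 / (1 + e / 2)"
    have t: "0 \<le> t" "t < 1" using e by (auto simp: t_def field_simps)
    have "cmod z < 1" using zP polygonD by auto
    then have "cmod ((e / 2) *\<^sub>R z) < e" using e mult_strict_left_mono[of "cmod z" 1 "e/2"] by simp
    then have "(1 + e / 2) *\<^sub>R z \<in> ball z e" by (simp add: dist_norm algebra_simps)
    then have "(1 + e / 2) *\<^sub>R z \<in> P" using e by auto
    from polygon_scale(2)[OF this t] have "sides p z = {}" using e by (simp add: t_def)
    then show "z \<in> {z \<in> P. sides p z = {}}" using zP by simp
  qed
qed

text \<open>
  A compact set all of whose radii from an interior point run, up to their ends, in the interior
  is homeomorphic to a disc. By invariance of domain the homeomorphism matches interior with
  interior. It serves as characteristic map of the faces.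
\<close>

lemma polygon_disc:
  obtains f where "continuous_on (cball 0 1) f" "inj_on f (cball 0 1)" "f ` cball (0::complex) 1 = P"
    "f ` ball 0 1 = {z \<in> P. sides p z = {}}" "f ` sphere 0 1 \<subseteq> {z \<in> P. sides p z \<noteq> {}}"
proof -
  have 0: "0 \<in> interior P" using zero_in by (simp add: interior_polygon)
  then have [simp]: "affine hull P = UNIV" by (intro affine_hull_nonempty_interior) auto
  have ri: "rel_interior P = interior P" by (simp add: rel_interior_interior)
  have "P homeomorphic cball 0 1 \<inter> affine hull P"
  proof (rule starlike_compact_projective2[OF compact_polygon])
    show "0 \<in> rel_interior P" using 0 ri by simp
    fix x assume "x \<in> P"
    then show "open_segment 0 x \<subseteq> rel_interior P"
      unfolding ri interior_polygon using polygon_scale[OF \<open>x \<in> P\<close>]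
      by (auto simp: in_segment scaleR_conv_of_real)
  qed
  then have "P homeomorphic cball (0::complex) 1" by simp
  then have "cball (0::complex) 1 homeomorphic P" by (rule homeomorphic_sym[THEN iffD1])
  then obtain f g where fg: "homeomorphism (cball (0::complex) 1) P f g" by (auto simp: homeomorphic_def)
  have c: "continuous_on (cball 0 1) f" "continuous_on P g" and im: "f ` cball 0 1 = P" "g ` P = cball 0 1"
    and gf: "\<And>x. x \<in> cball 0 1 \<Longrightarrow> g (f x) = x" and fg': "\<And>x. x \<in> P \<Longrightarrow> f (g x) = x"
    using fg by (auto simp: homeomorphism_def)
  have inj: "inj_on f (cball 0 1)" "inj_on g P" using gf fg' by (metis inj_onI)+
  have "f \<in> interior (cball 0 1) \<rightarrow> interior (f ` cball 0 1)"
    by (rule continuous_image_subset_interior) (use c inj in auto)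
  then have 1: "f ` ball 0 1 \<subseteq> interior P" by (auto simp: im)
  have "g \<in> interior P \<rightarrow> interior (g ` P)"
    by (rule continuous_image_subset_interior) (use c inj in auto)
  then have 2: "g x \<in> ball 0 1" if "x \<in> interior P" for x using that by (auto simp: im)
  show ?thesis
  proof (rule that[OF c(1) inj(1) im(1)])
    show "f ` ball 0 1 = {z \<in> P. sides p z = {}}"
      unfolding interior_polygon[symmetric]
    proof (rule antisym[OF 1], rule subsetI)
      fix x assume "x \<in> interior P"
      then show "x \<in> f ` ball 0 1"
        using 2[of x] fg'[of x] interior_subset[of P] by (intro image_eqI[of _ _ "g x"]) auto
    qed
    show "f ` sphere 0 1 \<subseteq> {z \<in> P. sides p z \<noteq> {}}"
    proof clarify
      fix x :: complex assume x: "x \<in> sphere 0 1"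
      then have "f x \<in> P" using im by auto
      moreover have "sides p (f x) \<noteq> {}"
      proof
        assume "sides p (f x) = {}"
        then have "g (f x) \<in> ball 0 1" using 2[of "f x"] \<open>f x \<in> P\<close> by (simp add: interior_polygon)
        then show False using gf[of x] x by auto
      qed
      ultimately show "f x \<in> P \<and> sides p (f x) \<noteq> {}" by simp
    qed
  qed
qed

subsection \<open>The sides as arcs\<close>

text \<open>
  A side is parametrised by the angle \<open>s\<close> under which its points are seen from the centre of
  the polygon, measured from the midpoint of the side.
\<close>

definition side_modulus :: "real \<Rightarrow> real" where
  "side_modulus s = kap * cos s - sqrt ((kap * cos s)\<^sup>2 - 1)"

definition side_arc :: "nat \<Rightarrow> real \<Rightarrow> complex" where
  "side_arc j s = of_real (side_modulus s) * cis (- (2 * j * q0 + s))"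

text \<open>
  The product of the two roots of \<open>1 + x\<^sup>2 = 2 * k * x\<close> is 1, so only one of them lies in
  the open unit interval.
\<close>

lemma root_unique:
  fixes r t k :: real
  assumes "0 < r" "r < 1" "0 < t" "t < 1" "1 + r\<^sup>2 = 2 * k * r" "1 + t\<^sup>2 = 2 * k * t"
  shows "r = t"
proof -
  have "(r - t) * (1 - r * t) = (1 + t\<^sup>2) * r - (1 + r\<^sup>2) * t" by (simp add: power2_eq_square algebra_simps)
  also have "\<dots> = 0" unfolding assms(5,6) by simp
  finally have "r = t \<or> r * t = 1" by auto
  moreover have "r * t < 1" using mult_strict_mono[of r 1 t 1] assms by auto
  ultimately show ?thesis by auto
qed

lemma side_modulus:
  assumes "\<bar>s\<bar> \<le> q0"
  shows "0 < side_modulus s" "side_modulus s < 1" "1 + (side_modulus s)\<^sup>2 = 2 * (kap * cos s) * side_modulus s"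
proof -
  have "cos q0 \<le> cos \<bar>s\<bar>" using assms q0 by (intro cos_monotone_0_pi_le) auto
  then have "al \<le> kap * cos s" using kap_gt by (simp add: al_def)
  then have k: "1 < kap * cos s" using al_gt by simp
  define k where "k = kap * cos s"
  define r where "r = sqrt (k\<^sup>2 - 1)"
  have "k\<^sup>2 - 1 > 0" using k by (simp add: k_def one_less_power)
  then have s: "r\<^sup>2 = k\<^sup>2 - 1" "0 < r" by (auto simp: r_def)
  have e: "side_modulus s = k - r" by (simp add: side_modulus_def k_def r_def)
  have "r < k" using s k by (intro power_less_imp_less_base[of r 2 k]) (auto simp: k_def)
  then show "0 < side_modulus s" by (simp add: e)
  have "(k - 1)\<^sup>2 < r\<^sup>2" unfolding s using k by (simp add: power2_eq_square algebra_simps k_def)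
  then have "k - 1 < r" using s by (intro power_less_imp_less_base[of "k - 1" 2 r]) auto
  then show "side_modulus s < 1" by (simp add: e)
  show "1 + (side_modulus s)\<^sup>2 = 2 * (kap * cos s) * side_modulus s"
    unfolding e k_def[symmetric] using s(1) by (simp add: power2_eq_square algebra_simps)
qed

lemma cos_add_2pi_int: "cos (x + 2 * pi * of_int n) = cos x"
  by (simp add: cos_add)

lemma cos_le_near:
  assumes "\<bar>s\<bar> \<le> q0"
  shows "cos (2 * of_int d * q0 + s) \<le> cos s"
proof -
  define e where "e = d mod int p"
  have p0: "int p > 0" using p_ge by simp
  have e: "0 \<le> e" "e \<le> int p - 1" using p0 by (auto simp: e_def)
  have "real_of_int d = e + real p * of_int (d div int p)"
    by (metis e_def mod_mult_div_eq of_int_add of_int_mult of_int_of_nat_eq)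
  then have "2 * of_int d * q0 + s = 2 * of_int e * q0 + s + 2 * (real p * q0) * of_int (d div int p)"
    by (simp add: algebra_simps)
  then have "cos (2 * of_int d * q0 + s) = cos (2 * of_int e * q0 + s + 2 * pi * of_int (d div int p))"
    using q0(3) by (simp add: add_ac)
  also have "\<dots> = cos (2 * of_int e * q0 + s)"
    by (rule cos_add_2pi_int)
  finally have *: "cos (2 * of_int d * q0 + s) = cos (2 * of_int e * q0 + s)" .
  show ?thesis
  proof (cases "e = 0")
    case False
    then have e': "1 \<le> real_of_int e" "real_of_int e \<le> real p - 1" using e by linarith+
    have "cos (2 * of_int e * q0 + s) \<le> cos \<bar>s\<bar>"
    proof (rule cos_le_far)
      have "2 * q0 \<le> 2 * e * q0" using e'(1) q0(1) by simp
      then show "\<bar>s\<bar> \<le> 2 * of_int e * q0 + s" using assms by (simp add: algebra_simps abs_le_iff)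
      have "e * q0 \<le> (real p - 1) * q0" using e'(2) q0(1) by simp
      then have "e * q0 \<le> pi - q0" using q0(3) by (simp add: algebra_simps)
      moreover have "s + \<bar>s\<bar> \<le> 2 * q0" using assms by linarith
      ultimately show "2 * of_int e * q0 + s \<le> 2 * pi - \<bar>s\<bar>" by (simp add: algebra_simps)
    qed auto
    then show ?thesis unfolding * by simp
  qed (use * in simp)
qed

lemma side_side_arc:
  assumes "\<bar>s\<bar> \<le> q0"
  shows "side p k (side_arc j s) = 2 * kap * side_modulus s * (cos s - cos (2 * of_int (int j - int k) * q0 + s))"
proof -
  have "side p k (side_arc j s) = 1 + (side_modulus s)\<^sup>2
     - 2 * (side_modulus s * kap * cos (2 * real j * q0 + s - 2 * real k * q0))"
    unfolding side_arc_def by (rule side_polar)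
  also have "2 * real j * q0 + s - 2 * real k * q0 = 2 * of_int (int j - int k) * q0 + s"
    by (simp add: algebra_simps)
  finally show ?thesis using side_modulus(3)[OF assms] by (simp add: algebra_simps)
qed

lemma norm_side_arc: "\<bar>s\<bar> \<le> q0 \<Longrightarrow> cmod (side_arc j s) = side_modulus s"
  using side_modulus(1)[of s] by (simp add: side_arc_def norm_mult)

lemma side_arc_in:
  assumes "\<bar>s\<bar> \<le> q0"
  shows "side_arc j s \<in> P" "side p j (side_arc j s) = 0"
  unfolding polygon_iff norm_side_arc[OF assms] side_side_arc[OF assms]
  using side_modulus[OF assms] kap_gt cos_le_near[OF assms]
  by (auto intro!: mult_nonneg_nonneg simp del: of_int_diff)

lemma side_modulus_rho:
  assumes "\<bar>s\<bar> \<le> q0" "side_modulus s = rho"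
  shows "\<bar>s\<bar> = q0"
proof -
  have "2 * (kap * cos s) * rho = 2 * al * rho"
    using side_modulus(3)[OF assms(1)] unfolding assms(2) rho(3) by (rule HOL.sym)
  then have "kap * cos s = al" using rho(1) by (metis mult_cancel_left mult_cancel_right less_irrefl zero_neq_numeral)
  then have e: "cos \<bar>s\<bar> = cos q0" using kap_gt by (simp add: al_def)
  show ?thesis by (rule cos_inj_pi[OF _ _ _ _ e]) (use assms(1) q0(1,2) pi_gt_zero in linarith)+
qed

lemma sides_side_arc:
  assumes "\<bar>s\<bar> < q0" "j < p"
  shows "sides p (side_arc j s) = {j}"
proof -
  have s: "\<bar>s\<bar> \<le> q0" using assms by simp
  have j: "j \<in> sides p (side_arc j s)" using side_arc_in(2)[OF s] assms by (simp add: sides_def)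
  from side_arc_in(1)[OF s, of j] show ?thesis
  proof (cases rule: sides_cases)
    case (3 i)
    then have "side_modulus s = rho" using norm_side_arc[OF s, of j] vert_norm by simp
    then show ?thesis using side_modulus_rho[OF s] assms by simp
  qed (use j in auto)
qed

lemma side_arc_end:
  assumes "\<bar>s\<bar> = q0"
  obtains i where "i < p" "side_arc j s = vert i"
proof -
  have s: "\<bar>s\<bar> \<le> q0" using assms by simp
  have "cos s = cos q0" using assms by (metis cos_abs_real)
  then have e: "1 + (side_modulus s)\<^sup>2 = 2 * al * side_modulus s"
    using side_modulus(3)[OF s] by (simp add: al_def)
  have "side_modulus s = rho"
    by (rule root_unique[OF side_modulus(1,2)[OF s] rho(1,2) e rho(3)])
  then have "cmod (side_arc j s) = rho" using norm_side_arc[OF s] by simp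
  then show ?thesis using that polygon_point[OF side_arc_in(1)[OF s]] by metis
qed

text \<open>
  The equation of the circle determines the modulus of a point from its angle \<open>s\<close>. Since no
  point of the polygon is farther from 0 than \<open>rho\<close>, the angle is at most \<open>q0\<close>.
\<close>

lemma side_arc_surj:
  assumes "z \<in> P" "j < p" "sides p z = {j}"
  obtains s where "\<bar>s\<bar> < q0" "z = side_arc j s"
proof -
  define r where "r = cmod z"
  define s where "s = - Arg (z * cnj (side_centre p j))"
  have e: "side p j z = 0" using assms by (auto simp: sides_def)
  have n: "cmod (z * cnj (side_centre p j)) = r * kap"
    using kap_gt by (simp add: norm_mult r_def centre)
  have "z * cnj (side_centre p j) = of_real (r * kap) * cis (- s)"
    using rcis_cmod_Arg[of "z * cnj (side_centre p j)"] unfolding n by (simp add: s_def rcis_def)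
  then have "z * cis (2 * real j * q0) * of_real kap = of_real r * cis (- s) * of_real kap"
    by (simp add: centre cis_cnj mult_ac)
  then have "z * cis (2 * real j * q0) = of_real r * cis (- s)" using kap_gt by simp
  then have "z * (cis (2 * real j * q0) * cis (- (2 * real j * q0))) = of_real r * (cis (- s) * cis (- (2 * real j * q0)))"
    by (simp only: mult.assoc[symmetric])
  then have z: "z = of_real r * cis (- (2 * real j * q0 + s))"
    unfolding cis_mult by (simp add: add.commute)
  have "side p j z = 1 + r\<^sup>2 - 2 * (r * kap * cos (2 * real j * q0 + s - 2 * real j * q0))"
    by (subst (1) z) (rule side_polar)
  then have q: "1 + r\<^sup>2 = 2 * (kap * cos s) * r" using e by simp
  have r: "0 < r" "r < 1" "r \<le> rho"
  proof -
    show "r < 1" "r \<le> rho" using polygonD(1) polygon_norm assms r_def by auto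
    have "r \<noteq> 0"
    proof
      assume "r = 0" then show False using q by simp
    qed
    then show "0 < r" by (simp add: r_def)
  qed
  have "(rho - r) * (1 - r * rho) \<ge> 0"
    using r rho(1,2) mult_le_one[of r rho] by (intro mult_nonneg_nonneg) auto
  also have "(rho - r) * (1 - r * rho) = (1 + r\<^sup>2) * rho - (1 + rho\<^sup>2) * r"
    by (simp add: power2_eq_square algebra_simps)
  also have "\<dots> = 2 * kap * (r * rho) * (cos s - cos q0)" unfolding q rho(3) by (simp add: al_def algebra_simps)
  finally have "0 \<le> 2 * kap * (r * rho) * (cos s - cos q0)" .
  moreover have "2 * kap * (r * rho) > 0" using r(1) rho(1) kap_gt by simp
  ultimately have "0 \<le> cos s - cos q0" by (metis zero_le_mult_iff not_less)
  then have "cos q0 \<le> cos \<bar>s\<bar>" by simp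
  moreover have "\<bar>s\<bar> \<le> pi" using Arg_bounded[of "z * cnj (side_centre p j)"] by (auto simp: s_def)
  ultimately have s: "\<bar>s\<bar> \<le> q0"
    using q0 cos_monotone_0_pi[of q0 "\<bar>s\<bar>"] by (cases "\<bar>s\<bar> \<le> q0") auto
  have "r = side_modulus s" by (rule root_unique[OF r(1,2) side_modulus(1,2)[OF s] q side_modulus(3)[OF s]])
  then have za: "z = side_arc j s" using z by (simp add: side_arc_def)
  moreover have "\<bar>s\<bar> \<noteq> q0"
  proof
    assume "\<bar>s\<bar> = q0"
    then obtain i where "i < p" "z = vert i" using side_arc_end za by metis
    then show False using sides_vert[of i] assms(3) nxt(2)[of i] by auto
  qed
  ultimately show ?thesis using that s by force
qed

lemma side_arc_continuous: "continuous_on {- q0..q0} (side_arc j)"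
proof -
  have "continuous_on {- q0..q0} side_modulus"
    unfolding side_modulus_def[abs_def] by (intro continuous_intros)
  then show ?thesis unfolding side_arc_def[abs_def] by (intro continuous_intros)
qed

lemma side_arc_inj: "inj_on (side_arc j) {- q0..q0}"
proof (rule inj_onI)
  fix s t assume st: "s \<in> {- q0..q0}" "t \<in> {- q0..q0}" "side_arc j s = side_arc j t"
  then have a: "\<bar>s\<bar> \<le> q0" "\<bar>t\<bar> \<le> q0" by auto
  then have m: "side_modulus s = side_modulus t" using norm_side_arc st(3) by metis
  have "cis (- (2 * j * q0 + s)) = cis (- (2 * j * q0 + t))"
    using st(3) side_modulus(1)[OF a(1)] side_modulus(1)[OF a(2)] m by (simp add: side_arc_def)
  then have "cis (- (2 * j * q0)) * cis (- s) = cis (- (2 * j * q0)) * cis (- t)"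
    by (simp add: cis_mult add.commute)
  then have "cis (- s) = cis (- t)" by simp
  then have "sin (- s) = sin (- t)" by (metis cis.sel(2))
  then have e: "sin s = sin t" by simp
  show "s = t" by (rule sin_inj_pi[OF _ _ _ _ e]) (use a q0(2) pi_gt_zero in linarith)+
qed

lemma side_midpoint: "j < p \<Longrightarrow> side_arc j 0 \<in> P" "j < p \<Longrightarrow> sides p (side_arc j 0) = {j}"
  using side_arc_in(1)[of 0 j] sides_side_arc[of 0 j] q0 by auto

subsection \<open>Reflections in the sides\<close>

text \<open>
  Inversion in the circle of side \<open>i\<close>. As \<open>|c|\<^sup>2 = r\<^sup>2 + 1\<close> for centre \<open>c\<close> and
  radius \<open>r\<close>, the usual \<open>c + r\<^sup>2 / cnj (z - c)\<close> takes this form.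
\<close>

definition mirror :: "nat \<Rightarrow> complex \<Rightarrow> complex" where
  "mirror i z = (side_centre p i * cnj z - 1) / (cnj z - cnj (side_centre p i))"

lemma norm_centre_gt: "1 < cmod (side_centre p i)"
  using kap_gt by (simp add: centre norm_mult)

lemma mirror_isometry: "disc_isometry False (mirror i)"
proof (rule disc_isometryI[of "- \<i>" "\<i> * side_centre p i"])
  show "cmod (- \<i>) < cmod (\<i> * side_centre p i)" using norm_centre_gt by (simp add: norm_mult)
  fix z :: complex assume "cmod z < 1"
  then have nz: "cnj z - cnj (side_centre p i) \<noteq> 0" using norm_centre_gt[of i] by (auto simp flip: complex_cnj_diff)
  have "mirror i z = (\<i> * (side_centre p i * cnj z - 1)) / (\<i> * (cnj z - cnj (side_centre p i)))"
    by (simp add: mirror_def)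
  then show "mirror i z = (\<i> * side_centre p i * (if False then z else cnj z) + - \<i>) /
            (cnj (- \<i>) * (if False then z else cnj z) + cnj (\<i> * side_centre p i))"
    by (simp add: algebra_simps)
qed

lemma mirror_norm: "cmod z < 1 \<Longrightarrow> cmod (mirror i z) < 1"
  using mirror_isometry disc_isometry_norm by blast

lemma centre_ne: "cmod z < 1 \<Longrightarrow> cnj z - cnj (side_centre p i) \<noteq> 0"
  using norm_centre_gt[of i] by (auto simp flip: complex_cnj_diff)

lemma fraction_shift:
  fixes c w x y :: complex
  assumes "w \<noteq> 0"
  shows "c * (x / w) - 1 = (c * x - w) / w" "x / w - y = (x - y * w) / w"
  using assms by (simp_all add: diff_divide_distrib)

lemma mirror_mirror:
  assumes "cmod z < 1"
  shows "mirror i (mirror i z) = z"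
proof -
  define c where "c = side_centre p i"
  have n: "cnj z - cnj c \<noteq> 0" "z - c \<noteq> 0" "cnj (mirror i z) - cnj c \<noteq> 0"
    using centre_ne[OF assms, of i] centre_ne[OF mirror_norm[OF assms], of i i] by (auto simp: c_def)
  have cc: "c * cnj c - 1 \<noteq> 0"
  proof
    assume "c * cnj c - 1 = 0"
    then have "(cmod c)\<^sup>2 = 1" using complex_norm_square[of c] by (metis of_real_1 of_real_eq_iff right_minus_eq)
    then show False using norm_centre_gt[of i] by (simp add: c_def power2_eq_1_iff)
  qed
  have cr: "cnj (mirror i z) = (cnj c * z - 1) / (z - c)" by (simp add: mirror_def c_def)
  have "mirror i (mirror i z) = (c * cnj (mirror i z) - 1) / (cnj (mirror i z) - cnj c)"
    by (simp add: mirror_def c_def)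
  also have "\<dots> = ((c * (cnj c * z - 1) - (z - c)) / (z - c)) / (((cnj c * z - 1) - cnj c * (z - c)) / (z - c))"
    unfolding cr fraction_shift[OF n(2)] by (rule HOL.refl)
  also have "\<dots> = (c * (cnj c * z - 1) - (z - c)) / ((cnj c * z - 1) - cnj c * (z - c))"
    using n by simp
  also have "c * (cnj c * z - 1) - (z - c) = (c * cnj c - 1) * z" by (simp add: algebra_simps)
  also have "(cnj c * z - 1) - cnj c * (z - c) = c * cnj c - 1" by (simp add: algebra_simps)
  finally show ?thesis using cc by simp
qed

lemma mirror_fixed: "cmod z < 1 \<Longrightarrow> mirror i z = z \<longleftrightarrow> side p i z = 0"
proof -
  assume "cmod z < 1"
  then have "mirror i z = z \<longleftrightarrow> side_centre p i * cnj z - 1 = z * (cnj z - cnj (side_centre p i))"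
    using centre_ne[of z i] by (simp add: mirror_def divide_eq_eq)
  also have "\<dots> \<longleftrightarrow> 1 + z * cnj z - (z * cnj (side_centre p i) + cnj (z * cnj (side_centre p i))) = 0"
    by (auto simp: algebra_simps)
  also have "\<dots> \<longleftrightarrow> of_real (side p i z) = (0::complex)"
    unfolding complex_add_cnj side_def by (simp add: complex_norm_square[symmetric])
  finally show ?thesis by simp
qed

lemma centre_adjacent:
  assumes "adjacent p i j"
  shows "Re (side_centre p i * cnj (side_centre p j)) = 1"
proof -
  have *: "Re (side_centre p i * cnj (side_centre p (Suc i))) = 1" for i
  proof -
    have "side_centre p i * cnj (side_centre p (Suc i)) = of_real (kap\<^sup>2) * (cis (- (2 * i * q0)) * cis (2 * Suc i * q0))"
      by (simp add: centre cis_cnj power2_eq_square)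
    also have "\<dots> = of_real (kap\<^sup>2) * cis (2 * q0)" unfolding cis_mult by (simp add: algebra_simps)
    finally show ?thesis using cos_2q0 by (simp add: kap_sq flip: of_real_power)
  qed
  have "Re (x * cnj y) = Re (y * cnj x)" for x y by simp
  then show ?thesis using assms * unfolding adjacent_def nxt_def by (metis centre_mod)
qed

lemma side_mirror_aux:
  assumes "cmod z < 1"
  shows "(cmod (z - side_centre p i))\<^sup>2 * side p j (mirror i z) =
    (cmod (z - side_centre p i))\<^sup>2 + (cmod (side_centre p i * cnj z - 1))\<^sup>2
     - 2 * Re ((side_centre p i * cnj z - 1) * (z - side_centre p i) * cnj (side_centre p j))"
proof -
  define c where "c = side_centre p i"
  have n: "z - c \<noteq> 0" using centre_ne[OF assms, of i] by (auto simp: c_def)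
  then have N: "(cmod (z - c))\<^sup>2 \<noteq> 0" by simp
  have r: "mirror i z = (c * cnj z - 1) * (z - c) / of_real ((cmod (z - c))\<^sup>2)"
    unfolding complex_norm_square mirror_def c_def[symmetric] using n by simp
  have "(cmod (mirror i z))\<^sup>2 = (cmod (c * cnj z - 1))\<^sup>2 / (cmod (z - c))\<^sup>2"
    unfolding mirror_def c_def[symmetric] by (simp add: norm_divide power_divide flip: complex_cnj_diff)
  moreover have "Re (mirror i z * cnj (side_centre p j)) =
      Re ((c * cnj z - 1) * (z - c) * cnj (side_centre p j)) / (cmod (z - c))\<^sup>2"
    unfolding r times_divide_eq_left Re_divide_of_real by (rule HOL.refl)
  ultimately show ?thesis
    unfolding side_def c_def[symmetric] using N by (simp add: field_simps)
qed

text \<open>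
  The inversion multiplies the power with respect to any circle orthogonal to the mirror by a
  positive factor, and the power with respect to the mirror itself by its negative.
\<close>

lemma side_mirror:
  assumes "cmod z < 1"
  obtains K where "0 < K" "side p i (mirror i z) = - K * side p i z"
    "\<And>j. adjacent p i j \<Longrightarrow> side p j (mirror i z) = K * side p j z"
proof -
  define c where "c = side_centre p i"
  define N where "N = (cmod (z - c))\<^sup>2"
  have n: "z - c \<noteq> 0" using centre_ne[OF assms, of i] by (auto simp: c_def)
  then have N: "N > 0" by (simp add: N_def)
  define K where "K = ((cmod c)\<^sup>2 - 1) / N"
  have "(cmod c)\<^sup>2 > 1" using norm_centre_gt[of i] by (simp add: c_def one_less_power)
  then have K: "K > 0" using N by (simp add: K_def)
  have 1: "N * side p i (mirror i z) = - ((cmod c)\<^sup>2 - 1) * side p i z"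
    unfolding N_def c_def side_mirror_aux[OF assms] unfolding side_def cmod_power2
    by (simp, algebra)
  have 2: "N * side p j (mirror i z) = ((cmod c)\<^sup>2 - 1) * side p j z" if "adjacent p i j" for j
    unfolding N_def c_def side_mirror_aux[OF assms] unfolding side_def cmod_power2
    using centre_adjacent[OF that] by (simp, algebra)
  show ?thesis
  proof (rule that[OF K])
    show "side p i (mirror i z) = - K * side p i z" using 1 N by (simp add: K_def field_simps)
    show "side p j (mirror i z) = K * side p j z" if "adjacent p i j" for j
      using 2[OF that] N by (simp add: K_def field_simps)
  qed
qed

text \<open>
  By orthogonality, numerators and denominators of the two composites are the negatives of each
  other.
\<close>

lemma mirror_commute:
  assumes "adjacent p i j" "cmod z < 1"
  shows "mirror i (mirror j z) = mirror j (mirror i z)"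
proof -
  define c d where "c = side_centre p i" and "d = side_centre p j"
  have n: "z - c \<noteq> 0" "z - d \<noteq> 0" "cnj (mirror j z) - cnj c \<noteq> 0" "cnj (mirror i z) - cnj d \<noteq> 0"
    using centre_ne[OF assms(2), of i] centre_ne[OF assms(2), of j]
      centre_ne[OF mirror_norm[OF assms(2)], of j i] centre_ne[OF mirror_norm[OF assms(2)], of i j]
    by (auto simp: c_def d_def)
  have cj: "cnj (mirror j z) = (cnj d * z - 1) / (z - d)" "cnj (mirror i z) = (cnj c * z - 1) / (z - c)"
    by (simp_all add: mirror_def c_def d_def)
  have "c * cnj d + cnj (c * cnj d) = of_real (2 * 1)"
    by (simp only: complex_add_cnj c_def d_def centre_adjacent[OF assms(1)])
  then have cd: "c * cnj d + cnj c * d = 2" by simp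
  have e1: "mirror i (mirror j z) = (c * (cnj d * z - 1) - (z - d)) / ((cnj d * z - 1) - cnj c * (z - d))"
  proof -
    have "mirror i (mirror j z) = (c * cnj (mirror j z) - 1) / (cnj (mirror j z) - cnj c)"
      by (simp add: mirror_def c_def)
    also have "\<dots> = ((c * (cnj d * z - 1) - (z - d)) / (z - d)) / (((cnj d * z - 1) - cnj c * (z - d)) / (z - d))"
      unfolding cj fraction_shift[OF n(2)] by (rule HOL.refl)
    finally show ?thesis using n by simp
  qed
  have e2: "mirror j (mirror i z) = (d * (cnj c * z - 1) - (z - c)) / ((cnj c * z - 1) - cnj d * (z - c))"
  proof -
    have "mirror j (mirror i z) = (d * cnj (mirror i z) - 1) / (cnj (mirror i z) - cnj d)"
      by (simp add: mirror_def d_def)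
    also have "\<dots> = ((d * (cnj c * z - 1) - (z - c)) / (z - c)) / (((cnj c * z - 1) - cnj d * (z - c)) / (z - c))"
      unfolding cj fraction_shift[OF n(1)] by (rule HOL.refl)
    finally show ?thesis using n by simp
  qed
  have "c * (cnj d * z - 1) - (z - d) + (d * (cnj c * z - 1) - (z - c)) = (c * cnj d + cnj c * d - 2) * z"
    "(cnj d * z - 1) - cnj c * (z - d) + ((cnj c * z - 1) - cnj d * (z - c)) = c * cnj d + cnj c * d - 2"
    by (simp_all add: algebra_simps)
  then have neg: "c * (cnj d * z - 1) - (z - d) = - (d * (cnj c * z - 1) - (z - c))"
    "(cnj d * z - 1) - cnj c * (z - d) = - ((cnj c * z - 1) - cnj d * (z - c))"
    unfolding cd eq_neg_iff_add_eq_0 by simp_all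
  show ?thesis unfolding e1 e2 neg by (rule minus_divide_divide)
qed

subsection \<open>Isometries of the polygon\<close>

text \<open>
  This is \<open>(sinh (d / 2))\<^sup>2\<close> for the hyperbolic distance \<open>d\<close>; as it is rational,
  equalities of distances become algebraic.
\<close>

definition dist_ratio :: "complex \<Rightarrow> complex \<Rightarrow> real" where
  "dist_ratio z w = (cmod (z - w))\<^sup>2 / ((1 - (cmod z)\<^sup>2) * (1 - (cmod w)\<^sup>2))"

lemma disc_pos: "cmod z < 1 \<Longrightarrow> 0 < 1 - (cmod z)\<^sup>2"
  by (simp add: abs_square_less_1)

lemma hyp_dist_eq_iff:
  assumes "cmod x < 1" "cmod y < 1" "cmod u < 1" "cmod v < 1"
  shows "hyp_dist x y = hyp_dist u v \<longleftrightarrow> dist_ratio x y = dist_ratio u v"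
proof -
  have e: "hyp_dist a b = arcosh (1 + 2 * dist_ratio a b)" for a b
    by (simp add: hyp_dist_def dist_ratio_def)
  have n: "0 \<le> dist_ratio x y" "0 \<le> dist_ratio u v"
    using disc_pos[OF assms(1)] disc_pos[OF assms(2)] disc_pos[OF assms(3)] disc_pos[OF assms(4)]
    by (simp_all add: dist_ratio_def)
  show ?thesis
  proof
    assume "hyp_dist x y = hyp_dist u v"
    then have "cosh (arcosh (1 + 2 * dist_ratio x y)) = cosh (arcosh (1 + 2 * dist_ratio u v))"
      unfolding e by simp
    then show "dist_ratio x y = dist_ratio u v" using n by (simp add: cosh_arcosh_real)
  qed (simp add: e)
qed

lemma isometry_ratio:
  assumes "polygon_isometry p \<sigma>" "x \<in> P" "y \<in> P"
  shows "\<sigma> x \<in> P" "dist_ratio (\<sigma> x) (\<sigma> y) = dist_ratio x y"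
proof -
  have s: "\<sigma> x \<in> P" "\<sigma> y \<in> P" using assms by (auto simp: polygon_isometry_def)
  then show "\<sigma> x \<in> P" by simp
  have "hyp_dist (\<sigma> x) (\<sigma> y) = hyp_dist x y" using assms by (auto simp: polygon_isometry_def)
  then show "dist_ratio (\<sigma> x) (\<sigma> y) = dist_ratio x y"
    using s assms polygonD(1) by (simp add: hyp_dist_eq_iff)
qed

lemma isometry_inj: "polygon_isometry p \<sigma> \<Longrightarrow> inj_on \<sigma> P"
proof (rule inj_onI)
  fix x y assume s: "polygon_isometry p \<sigma>" and xy: "x \<in> P" "y \<in> P" "\<sigma> x = \<sigma> y"
  then have "dist_ratio x y = 0" using isometry_ratio(2)[OF s xy(1,2)] by (simp add: dist_ratio_def)
  then show "x = y" using disc_pos[OF polygonD(1)] xy by (fastforce simp: dist_ratio_def)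
qed

lemma isometry_compose:
  assumes "polygon_isometry p \<sigma>" "polygon_isometry p \<tau>"
  shows "polygon_isometry p (\<lambda>x. \<sigma> (\<tau> x))"
proof -
  have "(\<lambda>x. \<sigma> (\<tau> x)) ` P = \<sigma> ` (\<tau> ` P)" by (simp add: image_image)
  moreover have "\<tau> x \<in> P" if "x \<in> P" for x using isometry_ratio(1)[OF assms(2) that that] .
  ultimately show ?thesis using assms by (simp add: polygon_isometry_def)
qed

lemma isometry_inverse:
  assumes "polygon_isometry p \<sigma>"
  shows "polygon_isometry p (inv_into P \<sigma>)"
proof -
  have im: "\<sigma> ` P = P" using assms by (simp add: polygon_isometry_def)
  have b: "bij_betw \<sigma> P P" using isometry_inj[OF assms] im by (simp add: bij_betw_def)
  then have "bij_betw (inv_into P \<sigma>) P P" by (rule bij_betw_inv_into)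
  moreover have "hyp_dist (inv_into P \<sigma> x) (inv_into P \<sigma> y) = hyp_dist x y" if "x \<in> P" "y \<in> P" for x y
  proof -
    have "inv_into P \<sigma> x \<in> P" "inv_into P \<sigma> y \<in> P" "\<sigma> (inv_into P \<sigma> x) = x" "\<sigma> (inv_into P \<sigma> y) = y"
      using that im by (simp_all add: inv_into_into f_inv_into_f)
    then show ?thesis using assms unfolding polygon_isometry_def by metis
  qed
  ultimately show ?thesis by (simp add: polygon_isometry_def bij_betw_def)
qed

text \<open>
  Opposite vertices realise the diameter, because the number of sides is even. So every isometry
  of the polygon maps vertices to vertices (\<open>ratio_vert_le\<close>, \<open>isometry_vert\<close>). It is determined
  by its values at the vertices, since a point is determined by its distances to them
  (\<open>ratio_determines\<close>).
\<close>

lemma vert_opposite: "vert (i + p div 2) = - vert i"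
proof -
  have "2 * real (p div 2) = real p" using p_even by (metis dvd_mult_div_cancel of_nat_mult of_nat_numeral)
  then have "(2 * real (i + p div 2) + 1) * q0 = (2 * real i + 1) * q0 + real p * q0"
    by (simp add: algebra_simps)
  then have "- ((2 * real (i + p div 2) + 1) * q0) = - ((2 * real i + 1) * q0) + - pi"
    using q0(3) by simp
  then have "cis (- ((2 * real (i + p div 2) + 1) * q0)) = cis (- ((2 * real i + 1) * q0)) * cis (- pi)"
    by (simp add: cis_mult)
  moreover have "cis (- pi) = - 1" by (metis cis_cnj cis_pi complex_cnj_minus complex_cnj_one)
  ultimately show ?thesis unfolding vert_def by simp
qed

lemma ratio_vert_le:
  assumes "x \<in> P" "y \<in> P" "dist_ratio x y = dist_ratio (vert i) (- vert i)"
  shows "cmod x = rho"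
proof -
  have r: "rho\<^sup>2 < 1" using rho by (simp add: abs_square_less_1)
  have n: "cmod x \<le> rho" "cmod y \<le> rho" using assms polygon_norm by auto
  then have n2: "(cmod x)\<^sup>2 \<le> rho\<^sup>2" "(cmod y)\<^sup>2 \<le> rho\<^sup>2" by (simp_all add: power_mono)
  have e: "dist_ratio (vert i) (- vert i) = (2 * rho)\<^sup>2 / ((1 - rho\<^sup>2) * (1 - rho\<^sup>2))"
  proof -
    have "vert i - - vert i = 2 * vert i" by simp
    then show ?thesis unfolding dist_ratio_def by (simp add: vert_norm norm_mult)
  qed
  have pos: "0 < (1 - rho\<^sup>2) * (1 - rho\<^sup>2)" using r by simp
  have d: "(1 - rho\<^sup>2) * (1 - rho\<^sup>2) \<le> (1 - (cmod x)\<^sup>2) * (1 - (cmod y)\<^sup>2)"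
    using n2 r by (intro mult_mono) auto
  have "(2 * rho)\<^sup>2 / ((1 - rho\<^sup>2) * (1 - rho\<^sup>2)) = dist_ratio x y" using assms e by simp
  also have "\<dots> \<le> (cmod (x - y))\<^sup>2 / ((1 - rho\<^sup>2) * (1 - rho\<^sup>2))"
    unfolding dist_ratio_def using d pos by (intro divide_left_mono) auto
  finally have "(2 * rho)\<^sup>2 \<le> (cmod (x - y))\<^sup>2" using pos by (simp add: divide_le_cancel)
  then have "2 * rho \<le> cmod (x - y)" by (rule power2_le_imp_le) simp
  also have "\<dots> \<le> cmod x + cmod y" by (rule norm_triangle_ineq4)
  finally show ?thesis using n by simp
qed

lemma isometry_vert:
  assumes "polygon_isometry p \<sigma>" "i < p"
  shows "\<sigma> (vert i) \<in> vert ` {..<p}"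
proof -
  have "- vert i \<in> P" using vert_in vert_opposite by metis
  then have "dist_ratio (\<sigma> (vert i)) (\<sigma> (- vert i)) = dist_ratio (vert i) (- vert i)"
    and s: "\<sigma> (vert i) \<in> P" "\<sigma> (- vert i) \<in> P"
    using isometry_ratio[OF assms(1)] vert_in by auto
  then have "cmod (\<sigma> (vert i)) = rho" using ratio_vert_le by blast
  then show ?thesis using polygon_point[OF s(1)] by (metis imageI lessThan_iff)
qed

lemma isometry_verts: "polygon_isometry p \<sigma> \<Longrightarrow> \<sigma> ` vert ` {..<p} = vert ` {..<p}"
proof (rule endo_inj_surj)
  assume s: "polygon_isometry p \<sigma>"
  show "\<sigma> ` vert ` {..<p} \<subseteq> vert ` {..<p}" using isometry_vert[OF s] by auto
  have "vert ` {..<p} \<subseteq> P" using vert_in by auto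
  then show "inj_on \<sigma> (vert ` {..<p})" using isometry_inj[OF s] inj_on_subset by blast
qed simp

lemma ratio_determines:
  assumes X: "x \<in> P" "y \<in> P" and d: "\<And>i. i < p \<Longrightarrow> dist_ratio x (vert i) = dist_ratio y (vert i)"
  shows "x = y"
proof -
  have n: "0 < 1 - (cmod x)\<^sup>2" "0 < 1 - (cmod y)\<^sup>2" using X polygonD(1) disc_pos by auto
  have r: "0 < 1 - rho\<^sup>2" using rho disc_pos[of "of_real rho"] by simp
  have dr: "dist_ratio z (vert i) = ((cmod z)\<^sup>2 + rho\<^sup>2 - 2 * Re (z * cnj (vert i))) / ((1 - (cmod z)\<^sup>2) * (1 - rho\<^sup>2))" for z i
  proof -
    have "(cmod (z - vert i))\<^sup>2 = (cmod z)\<^sup>2 + (cmod (vert i))\<^sup>2 - 2 * Re (z * cnj (vert i))"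
      unfolding cmod_power2 by (simp add: power2_eq_square algebra_simps)
    then show ?thesis by (simp add: dist_ratio_def vert_norm)
  qed
  have eq: "((cmod x)\<^sup>2 + rho\<^sup>2 - 2 * Re (x * cnj (vert i))) * (1 - (cmod y)\<^sup>2)
      = ((cmod y)\<^sup>2 + rho\<^sup>2 - 2 * Re (y * cnj (vert i))) * (1 - (cmod x)\<^sup>2)" if "i < p" for i
    using d[OF that] n r unfolding dr by (simp add: frac_eq_eq)
  have lt: "0 + p div 2 < p" "0 < p" "1 < p" using p_ge by auto
  (* adding the equations for two opposite vertices cancels the linear terms *)
  have "((cmod x)\<^sup>2 + rho\<^sup>2) * (1 - (cmod y)\<^sup>2) = ((cmod y)\<^sup>2 + rho\<^sup>2) * (1 - (cmod x)\<^sup>2)"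
    using eq[OF lt(1)] eq[OF lt(2)] unfolding vert_opposite by (simp add: algebra_simps)
  then have "((cmod x)\<^sup>2 - (cmod y)\<^sup>2) * (1 + rho\<^sup>2) = 0" by (simp add: algebra_simps)
  moreover have "1 + rho\<^sup>2 > 0" by (simp add: add_pos_nonneg)
  ultimately have xy: "(cmod x)\<^sup>2 = (cmod y)\<^sup>2" by simp
  have "Re (x * cnj (vert i)) = Re (y * cnj (vert i))" if "i < p" for i
    using eq[OF that] n unfolding xy by simp
  then have z: "Re ((x - y) * cnj (vert 0)) = 0" "Re ((x - y) * cnj (vert 1)) = 0"
    using lt by (simp_all add: algebra_simps)
  define a b where "a = Re (x - y)" and "b = Im (x - y)"
  have "rho * (a * cos q0 - b * sin q0) = 0" "rho * (a * cos (3 * q0) - b * sin (3 * q0)) = 0"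
    using z by (simp_all add: vert_def a_def b_def algebra_simps)
  then have e: "a * cos q0 = b * sin q0" "a * cos (3 * q0) = b * sin (3 * q0)" using rho(1) by simp_all
  have s: "sin (3 * q0) * cos q0 - cos (3 * q0) * sin q0 = sin (2 * q0)"
    using sin_diff[of "3 * q0" q0] by simp
  have "sin (2 * q0) > 0" using q0 by (intro sin_gt_zero) auto
  moreover have "a * sin (2 * q0) = 0" "b * sin (2 * q0) = 0"
    unfolding s[symmetric] using e by algebra+
  ultimately have "a = 0" "b = 0" by auto
  then show ?thesis by (simp add: a_def b_def complex_eq_iff)
qed

lemma isometry_eqI:
  assumes "polygon_isometry p \<sigma>" "polygon_isometry p \<tau>" "\<And>i. i < p \<Longrightarrow> \<sigma> (vert i) = \<tau> (vert i)" "x \<in> P"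
  shows "\<sigma> x = \<tau> x"
proof (rule ratio_determines)
  fix i assume "i < p"
  then have "vert i \<in> \<sigma> ` vert ` {..<p}" using isometry_verts[OF assms(1)] by auto
  then obtain j where j: "j < p" "vert i = \<sigma> (vert j)" by auto
  show "dist_ratio (\<sigma> x) (vert i) = dist_ratio (\<tau> x) (vert i)"
    using isometry_ratio(2)[OF assms(1,4) vert_in[of j]] isometry_ratio(2)[OF assms(2,4) vert_in[of j]]
      assms(3)[OF j(1)] j(2) by simp
qed (use isometry_ratio assms in auto)

lemma isometry_zero:
  assumes "polygon_isometry p \<sigma>"
  shows "\<sigma> 0 = 0"
proof (rule ratio_determines)
  fix i assume "i < p"
  then have "vert i \<in> \<sigma> ` vert ` {..<p}" using isometry_verts[OF assms(1)] by auto
  then obtain j where j: "j < p" "vert i = \<sigma> (vert j)" by auto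
  show "dist_ratio (\<sigma> 0) (vert i) = dist_ratio 0 (vert i)"
    using isometry_ratio(2)[OF assms zero_in(1) vert_in[of j]] unfolding j(2)[symmetric]
    by (simp add: dist_ratio_def vert_norm)
qed (use isometry_ratio[OF assms zero_in(1) zero_in(1)] zero_in in auto)

lemma finite_isometries: "finite {restrict \<sigma> P | \<sigma>. polygon_isometry p \<sigma>}"
proof -
  let ?V = "vert ` {..<p}"
  have "finite (?V \<rightarrow>\<^sub>E ?V)" by (intro finite_PiE) auto
  moreover have "(\<lambda>\<sigma>. restrict \<sigma> ?V) ` {restrict \<sigma> P | \<sigma>. polygon_isometry p \<sigma>} \<subseteq> ?V \<rightarrow>\<^sub>E ?V"
    using isometry_vert vert_in by fastforce
  moreover have "inj_on (\<lambda>\<sigma>. restrict \<sigma> ?V) {restrict \<sigma> P | \<sigma>. polygon_isometry p \<sigma>}"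
  proof (rule inj_onI, clarify)
    fix \<sigma> \<tau> assume st: "polygon_isometry p \<sigma>" "polygon_isometry p \<tau>"
      "restrict (restrict \<sigma> P) ?V = restrict (restrict \<tau> P) ?V"
    have "\<sigma> (vert i) = \<tau> (vert i)" if "i < p" for i
      using fun_cong[OF st(3), of "vert i"] that vert_in by simp
    then show "restrict \<sigma> P = restrict \<tau> P"
      using isometry_eqI[OF st(1,2)] by (intro restrict_ext) blast
  qed
  ultimately show ?thesis by (metis (no_types, lifting) finite_imageD finite_subset)
qed

text \<open>
  Local groups can only shrink when a point is moved a little; this is what openness and
  closedness of gluing conditions rest on.
\<close>

lemma sides_upper_semicontinuous:
  obtains N where "open N" "x \<in> N" "\<And>y. y \<in> N \<Longrightarrow> sides p y \<subseteq> sides p x"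
proof
  show "open (\<Inter>j\<in>{..<p} - sides p x. {y. side p j y \<noteq> 0})"
    by (intro open_INT ballI open_Collect_neq continuous_on_const side_continuous) auto
qed (auto simp: sides_def)

end

section \<open>Products with a discrete space\<close>

lemma openin_prod_discrete:
  "openin (prod_topology (discrete_topology C) X) V \<longleftrightarrow>
     V \<subseteq> C \<times> topspace X \<and> (\<forall>c\<in>C. openin X {x \<in> topspace X. (c, x) \<in> V})"
proof
  assume V: "openin (prod_topology (discrete_topology C) X) V"
  then have "V \<subseteq> C \<times> topspace X" using openin_subset by fastforce
  moreover have "openin X {x \<in> topspace X. (c, x) \<in> V}" if "c \<in> C" for c
  proof -
    have "continuous_map X (prod_topology (discrete_topology C) X) (\<lambda>x. (c, x))"
      using that by (intro continuous_map_pairedI) auto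
    from openin_continuous_map_preimage[OF this V] show ?thesis .
  qed
  ultimately show "V \<subseteq> C \<times> topspace X \<and> (\<forall>c\<in>C. openin X {x \<in> topspace X. (c, x) \<in> V})" by auto
next
  assume V: "V \<subseteq> C \<times> topspace X \<and> (\<forall>c\<in>C. openin X {x \<in> topspace X. (c, x) \<in> V})"
  show "openin (prod_topology (discrete_topology C) X) V"
    unfolding openin_prod_topology_alt
  proof (intro allI impI)
    fix c x assume cx: "(c, x) \<in> V"
    then show "\<exists>U Va. openin (discrete_topology C) U \<and> openin X Va \<and> c \<in> U \<and> x \<in> Va \<and> U \<times> Va \<subseteq> V"
      using V by (intro exI[of _ "{c}"] exI[of _ "{x \<in> topspace X. (c, x) \<in> V}"]) auto
  qed
qed

section \<open>Data describing a tiled surface\<close>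

text \<open>
  The involution \<open>\<theta> i\<close> is the step across side \<open>i\<close> between the polygons labelled by \<open>B\<close>.
  The group \<open>A\<close> acts on the labels of the sides by \<open>act\<close> and on the disc by \<open>iso\<close>. The function
  \<open>ori\<close> tells the orientation of the polygon with a given label; that it is a homomorphism makes
  the quotient orientable. The last two assumptions make the action of \<open>A\<close> on the glued surface
  free: an element that is equal to \<open>\<theta> i\<close> and preserves side \<open>i\<close> would fix points of this
  side in the surface, and similarly at the vertices. A fixed point in the interior of a polygon
  is impossible, as different labels \<open>b\<close> and \<open>b a\<^sup>-\<^sup>1\<close> belong to different polygons.
\<close>

locale surface_data = even_polygon p + group B for p :: nat and B (structure) +
  fixes \<theta> :: "nat \<Rightarrow> 'a" and A :: "'a set" and act :: "'a \<Rightarrow> nat \<Rightarrow> nat"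
    and iso :: "'a \<Rightarrow> complex \<Rightarrow> complex" and ori :: "'a \<Rightarrow> bool"
  assumes finite_B: "finite (carrier B)"
    and th_closed: "i < p \<Longrightarrow> \<theta> i \<in> carrier B"
    and th_sq: "i < p \<Longrightarrow> \<theta> i \<otimes> \<theta> i = \<one>"
    and th_comm: "adjacent p i j \<Longrightarrow> \<theta> i \<otimes> \<theta> j = \<theta> j \<otimes> \<theta> i"
    and th_ne_one: "i < p \<Longrightarrow> \<theta> i \<noteq> \<one>"
    and th_ne: "adjacent p i j \<Longrightarrow> \<theta> i \<noteq> \<theta> j"
    and A_sub: "subgroup A B"
    and act_lt: "a \<in> A \<Longrightarrow> i < p \<Longrightarrow> act a i < p"
    and act_mult: "a \<in> A \<Longrightarrow> b \<in> A \<Longrightarrow> i < p \<Longrightarrow> act (a \<otimes> b) i = act a (act b i)"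
    and act_one: "i < p \<Longrightarrow> act \<one> i = i"
    and act_adjacent: "a \<in> A \<Longrightarrow> adjacent p i j \<Longrightarrow> adjacent p (act a i) (act a j)"
    and act_th: "a \<in> A \<Longrightarrow> i < p \<Longrightarrow> \<theta> (act a i) = a \<otimes> \<theta> i \<otimes> inv a"
    and iso_mult: "a \<in> A \<Longrightarrow> b \<in> A \<Longrightarrow> iso (a \<otimes> b) z = iso a (iso b z)"
    and iso_one: "iso \<one> z = z"
    and iso_isometry: "a \<in> A \<Longrightarrow> disc_isometry (ori a) (iso a)"
    and side_iso: "a \<in> A \<Longrightarrow> i < p \<Longrightarrow> side p (act a i) (iso a z) = side p i z"
    and iso_mirror: "a \<in> A \<Longrightarrow> i < p \<Longrightarrow> cmod z < 1 \<Longrightarrow> iso a (mirror i z) = mirror (act a i) (iso a z)"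
    and ori_mult: "x \<in> carrier B \<Longrightarrow> y \<in> carrier B \<Longrightarrow> ori (x \<otimes> y) \<longleftrightarrow> ori x = ori y"
    and ori_th: "i < p \<Longrightarrow> \<not> ori (\<theta> i)"
    and th_generate: "b \<in> carrier B \<Longrightarrow> \<exists>u. set u \<subseteq> {..<p} \<and> b = foldr (\<lambda>i x. \<theta> i \<otimes> x) u \<one>"
    and free_side: "a \<in> A \<Longrightarrow> i < p \<Longrightarrow> act a i = i \<Longrightarrow> a \<noteq> \<theta> i"
    and free_vertex: "a \<in> A \<Longrightarrow> i < p \<Longrightarrow> act a ` {i, nxt p i} = {i, nxt p i} \<Longrightarrow> a = \<one>"
begin

definition wprod :: "nat list \<Rightarrow> 'a" where
  "wprod u = foldr (\<lambda>i x. \<theta> i \<otimes> x) u \<one>"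

text \<open>
  The image of the local group at \<open>x\<close> under \<open>\<Theta>\<close> (lemma \<open>Theta_local_group\<close>); it labels
  the polygons that meet at \<open>x\<close>.
\<close>

definition locgrp :: "complex \<Rightarrow> 'a set" where
  "locgrp x = wprod ` {u. set u \<subseteq> sides p x}"

lemma A_closed: "a \<in> A \<Longrightarrow> a \<in> carrier B" "a \<in> A \<Longrightarrow> inv a \<in> A" "\<one> \<in> A"
  "a \<in> A \<Longrightarrow> b \<in> A \<Longrightarrow> a \<otimes> b \<in> A"
  using A_sub by (auto simp: subgroup_def)

lemma wprod_simps [simp]: "wprod [] = \<one>" "wprod (i # u) = \<theta> i \<otimes> wprod u"
  by (simp_all add: wprod_def)

lemma wprod_closed: "set u \<subseteq> {..<p} \<Longrightarrow> wprod u \<in> carrier B"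
  by (induction u) (auto simp: th_closed)

lemma wprod_append: "set u \<subseteq> {..<p} \<Longrightarrow> set v \<subseteq> {..<p} \<Longrightarrow> wprod (u @ v) = wprod u \<otimes> wprod v"
  by (induction u) (auto simp: wprod_closed th_closed m_assoc)

lemma inv_cancel: "a \<in> carrier B \<Longrightarrow> x \<in> carrier B \<Longrightarrow> inv a \<otimes> (a \<otimes> x) = x"
  "a \<in> carrier B \<Longrightarrow> x \<in> carrier B \<Longrightarrow> a \<otimes> (inv a \<otimes> x) = x"
  by (simp_all add: m_assoc[symmetric])

lemma wprod_rev: "set u \<subseteq> {..<p} \<Longrightarrow> wprod (rev u) = inv (wprod u)"
proof (induction u)
  case (Cons i u)
  then have "inv (\<theta> i) = \<theta> i" by (intro inv_equality) (auto simp: th_sq th_closed)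
  then show ?case using Cons by (simp add: wprod_append inv_mult_group th_closed wprod_closed)
qed simp

lemma sides_lt: "sides p x \<subseteq> {..<p}"
  by (auto simp: sides_def)

lemma locgrp_closed: "g \<in> locgrp x \<Longrightarrow> g \<in> carrier B"
  using sides_lt wprod_closed by (fastforce simp: locgrp_def)

lemma locgrp_one: "\<one> \<in> locgrp x"
  unfolding locgrp_def by (rule image_eqI[of _ _ "[]"]) auto

lemma locgrp_mult: "g \<in> locgrp x \<Longrightarrow> h \<in> locgrp x \<Longrightarrow> g \<otimes> h \<in> locgrp x"
proof -
  assume "g \<in> locgrp x" "h \<in> locgrp x"
  then obtain u v where "set u \<subseteq> sides p x" "set v \<subseteq> sides p x" "g = wprod u" "h = wprod v"
    by (auto simp: locgrp_def)
  then show "g \<otimes> h \<in> locgrp x"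
    unfolding locgrp_def using sides_lt[of x] by (intro image_eqI[of _ _ "u @ v"]) (auto simp: wprod_append)
qed

lemma locgrp_inv: "g \<in> locgrp x \<Longrightarrow> inv g \<in> locgrp x"
proof -
  assume "g \<in> locgrp x"
  then obtain u where "set u \<subseteq> sides p x" "g = wprod u" by (auto simp: locgrp_def)
  then show "inv g \<in> locgrp x"
    unfolding locgrp_def using sides_lt[of x] by (intro image_eqI[of _ _ "rev u"]) (auto simp: wprod_rev)
qed

lemma act_inv: "a \<in> A \<Longrightarrow> i < p \<Longrightarrow> act (inv a) (act a i) = i"
  by (metis A_closed(1,2) act_mult act_one l_inv)

lemma act_inv': "a \<in> A \<Longrightarrow> i < p \<Longrightarrow> act a (act (inv a) i) = i"
  by (metis A_closed(1,2) act_mult act_one r_inv)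

lemma iso_inv: "a \<in> A \<Longrightarrow> iso (inv a) (iso a z) = z" "a \<in> A \<Longrightarrow> iso a (iso (inv a) z) = z"
  by (metis A_closed(1,2) iso_mult iso_one l_inv) (metis A_closed(1,2) iso_mult iso_one r_inv)

lemma iso_disc: "a \<in> A \<Longrightarrow> cmod z < 1 \<Longrightarrow> cmod (iso a z) < 1"
  using iso_isometry disc_isometry_norm by blast

lemma iso_polygon: assumes "a \<in> A" "x \<in> P" shows "iso a x \<in> P"
  unfolding polygon_iff
proof (intro conjI allI impI)
  show "cmod (iso a x) < 1" using iso_disc assms polygonD by auto
  fix i assume "i < p"
  then have "side p (act a (act (inv a) i)) (iso a x) = side p (act (inv a) i) x"
    using assms A_closed act_lt by (intro side_iso) auto
  then show "0 \<le> side p i (iso a x)" using act_inv' assms \<open>i < p\<close> polygonD(2) by simp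
qed

lemma sides_iso: assumes "a \<in> A" shows "sides p (iso a x) = act a ` sides p x"
proof
  show "act a ` sides p x \<subseteq> sides p (iso a x)"
    using assms side_iso act_lt by (auto simp: sides_def)
  show "sides p (iso a x) \<subseteq> act a ` sides p x"
  proof
    fix i assume i: "i \<in> sides p (iso a x)"
    then have "i < p" by (auto simp: sides_def)
    define j where "j = act (inv a) i"
    have "j < p" "act a j = i" using act_inv' act_lt A_closed assms \<open>i < p\<close> by (auto simp: j_def)
    then have "j \<in> sides p x" using side_iso[OF assms, of j x] i by (auto simp: sides_def)
    then show "i \<in> act a ` sides p x" using \<open>act a j = i\<close> by blast
  qed
qed

lemma map_act: "a \<in> A \<Longrightarrow> set u \<subseteq> {..<p} \<Longrightarrow> set (map (act a) u) \<subseteq> {..<p}"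
  using act_lt by auto

lemma wprod_map_act:
  assumes "a \<in> A" "set u \<subseteq> {..<p}"
  shows "wprod (map (act a) u) = a \<otimes> wprod u \<otimes> inv a"
  using assms(2)
proof (induction u)
  case (Cons i u)
  have c: "a \<in> carrier B" "\<theta> i \<in> carrier B" "wprod u \<in> carrier B"
    using Cons A_closed assms th_closed wprod_closed by auto
  then show ?case using Cons act_th[OF assms(1)] by (simp add: m_assoc inv_cancel)
qed (use assms A_closed in auto)

subsection \<open>The fundamental group\<close>

abbreviation "W \<equiv> pi1_group p (\<lambda>_. 4)"
abbreviation "cl \<equiv> word_class p (\<lambda>_. 4)"

sublocale W: group W
  by (rule group_pi1_group) simp

lemma W_carrier: "h \<in> carrier W \<longleftrightarrow> (\<exists>u. set u \<subseteq> {..<p} \<and> h = cl u)"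
  by (auto simp: pi1_group_def in_lists_conv_set)

lemma cl_closed: "set u \<subseteq> {..<p} \<Longrightarrow> cl u \<in> carrier W"
  using W_carrier by auto

lemma W_one: "\<one>\<^bsub>W\<^esub> = cl []"
  by (simp add: pi1_group_def)

text \<open>
  The universal property of \<open>W\<close>: elements of order dividing 4 that commute for adjacent sides
  define a homomorphism. The equivalence on the letters is needed for the induction, because the
  relation is closed under symmetry.
\<close>

lemma word_eq_invariant:
  assumes pw: "\<And>i. i < p \<Longrightarrow> f i \<in> carrier N" "monoid N" "\<And>i. i < p \<Longrightarrow> f i \<otimes>\<^bsub>N\<^esub> (f i \<otimes>\<^bsub>N\<^esub> (f i \<otimes>\<^bsub>N\<^esub> f i)) = \<one>\<^bsub>N\<^esub>"
    "\<And>i. i < p \<Longrightarrow> f i \<otimes>\<^bsub>N\<^esub> f (nxt p i) = f (nxt p i) \<otimes>\<^bsub>N\<^esub> f i"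
    and eq: "word_eq p (\<lambda>_. 4) u v"
  shows "(set u \<subseteq> {..<p} \<longleftrightarrow> set v \<subseteq> {..<p}) \<and> (set u \<subseteq> {..<p} \<longrightarrow>
    foldr (\<lambda>i x. f i \<otimes>\<^bsub>N\<^esub> x) u \<one>\<^bsub>N\<^esub> = foldr (\<lambda>i x. f i \<otimes>\<^bsub>N\<^esub> x) v \<one>\<^bsub>N\<^esub>)"
proof -
  interpret N: monoid N by fact
  let ?F = "\<lambda>u. foldr (\<lambda>i x. f i \<otimes>\<^bsub>N\<^esub> x) u \<one>\<^bsub>N\<^esub>"
  have cl: "?F u \<in> carrier N" if "set u \<subseteq> {..<p}" for u using that by (induction u) (auto simp: pw)
  have app: "foldr (\<lambda>i x. f i \<otimes>\<^bsub>N\<^esub> x) (u @ v) \<one>\<^bsub>N\<^esub> = ?F u \<otimes>\<^bsub>N\<^esub> ?F v" if "set u \<subseteq> {..<p}" "set v \<subseteq> {..<p}" for u v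
    using that by (induction u) (auto simp: cl pw N.m_assoc simp del: foldr_append)
  from eq show ?thesis
  proof (induction rule: word_eq.induct)
    case (power i u v)
    define r where "r = replicate 4 i"
    have "r = [i, i, i, i]" by (simp add: r_def numeral_eq_Suc)
    then have "?F r = \<one>\<^bsub>N\<^esub>" "set r \<subseteq> {..<p}" using pw(1,3)[OF power] power by simp_all
    then show ?case unfolding r_def[symmetric]
      by (auto simp: app cl simp del: foldr_append)
  next
    case (comm i u v)
    have l: "Suc i mod p < p" using nxt(1)[OF comm] by (simp add: nxt_def)
    define r r' where "r = [i, Suc i mod p]" and "r' = [Suc i mod p, i]"
    have "?F r = ?F r'" "set r \<subseteq> {..<p}" "set r' \<subseteq> {..<p}"
      using pw(1,4)[OF comm] pw(1)[OF l] comm l by (simp_all add: nxt_def r_def r'_def)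
    then show ?case unfolding r_def[symmetric] r'_def[symmetric]
      by (auto simp: app cl simp del: foldr_append)
  qed auto
qed

lemma word_eq_wprod:
  assumes "word_eq p (\<lambda>_. 4) u v" "set u \<subseteq> {..<p}"
  shows "wprod u = wprod v"
proof -
  have "\<theta> i \<otimes> (\<theta> i \<otimes> (\<theta> i \<otimes> \<theta> i)) = \<one>" if "i < p" for i
    using that by (simp add: th_sq th_closed)
  then show ?thesis
    using word_eq_invariant[of \<theta> B, OF th_closed is_monoid _ th_comm[OF adjacent_nxt] assms(1)] assms(2)
    by (simp add: wprod_def)
qed

lemma cl_mult: "cl u \<otimes>\<^bsub>W\<^esub> cl v = cl (u @ v)"
  by (rule mult_word_class)

lemma cl_eqI: "word_eq p (\<lambda>_. 4) u v \<Longrightarrow> cl u = cl v"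
  by (simp add: word_class_eq_iff)

lemma cl_pow: "i < p \<Longrightarrow> cl [i, i, i, i] = cl []"
  using cl_eqI[OF word_eq.power[of i p "\<lambda>_. 4" "[]" "[]"]] by (simp add: numeral_eq_Suc)

lemma cl_comm: "adjacent p i j \<Longrightarrow> cl ([i, j] @ v) = cl ([j, i] @ v)"
  using cl_eqI[OF word_eq.comm[of _ p "\<lambda>_. 4" "[]" v]] by (fastforce simp: adjacent_def nxt_def)

lemma foldr_cl: "foldr (\<lambda>i x. cl [f i] \<otimes>\<^bsub>W\<^esub> x) u \<one>\<^bsub>W\<^esub> = cl (map f u)"
  by (induction u) (simp_all add: W_one cl_mult)

lemma word_eq_map_act:
  assumes "a \<in> A" "word_eq p (\<lambda>_. 4) u v" "set u \<subseteq> {..<p}"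
  shows "cl (map (act a) u) = cl (map (act a) v)"
proof -
  have "cl [act a i] \<otimes>\<^bsub>W\<^esub> cl [act a (nxt p i)] = cl [act a (nxt p i)] \<otimes>\<^bsub>W\<^esub> cl [act a i]" if "i < p" for i
    using cl_comm[OF act_adjacent[OF assms(1) adjacent_nxt[OF that]], of "[]"] by (simp add: cl_mult)
  moreover have "cl [act a i] \<otimes>\<^bsub>W\<^esub> (cl [act a i] \<otimes>\<^bsub>W\<^esub> (cl [act a i] \<otimes>\<^bsub>W\<^esub> cl [act a i])) = \<one>\<^bsub>W\<^esub>" if "i < p" for i
    using cl_pow[OF act_lt[OF assms(1) that]] by (simp add: cl_mult W_one)
  ultimately show ?thesis
    using word_eq_invariant[of "\<lambda>i. cl [act a i]" W, OF _ W.is_monoid _ _ assms(2)] assms act_lt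
    by (simp add: foldr_cl cl_closed)
qed

definition word_of :: "nat list set \<Rightarrow> nat list" where
  "word_of h = (SOME u. set u \<subseteq> {..<p} \<and> h = cl u)"

text \<open>
  The homomorphisms out of \<open>W\<close> are defined through representing words; \<open>Theta_cl\<close> and
  \<open>relabel_cl\<close> show that the choice does not matter. The automorphism \<open>relabel a\<close> of \<open>W\<close>
  permutes the generators as \<open>a\<close> permutes the sides.
\<close>

definition \<Theta> :: "nat list set \<Rightarrow> 'a" where
  "\<Theta> h = wprod (word_of h)"

definition relabel :: "'a \<Rightarrow> nat list set \<Rightarrow> nat list set" where
  "relabel a h = cl (map (act a) (word_of h))"

lemma word_of: assumes "h \<in> carrier W" shows "set (word_of h) \<subseteq> {..<p}" "cl (word_of h) = h"
  using someI_ex[OF assms[unfolded W_carrier]] by (auto simp: word_of_def)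

lemma Theta_cl: "set u \<subseteq> {..<p} \<Longrightarrow> \<Theta> (cl u) = wprod u"
  using word_of[OF cl_closed[of u]] by (simp add: \<Theta>_def word_class_eq_iff word_eq_wprod)

lemma relabel_cl: "a \<in> A \<Longrightarrow> set u \<subseteq> {..<p} \<Longrightarrow> relabel a (cl u) = cl (map (act a) u)"
  using word_of[OF cl_closed[of u]] by (simp add: relabel_def word_class_eq_iff[of _ _ "word_of (cl u)"] word_eq_map_act)

lemma Theta_closed: "h \<in> carrier W \<Longrightarrow> \<Theta> h \<in> carrier B"
  by (simp add: \<Theta>_def wprod_closed word_of)

lemma Theta_mult: "g \<in> carrier W \<Longrightarrow> h \<in> carrier W \<Longrightarrow> \<Theta> (g \<otimes>\<^bsub>W\<^esub> h) = \<Theta> g \<otimes> \<Theta> h"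
  by (auto simp: W_carrier cl_mult Theta_cl wprod_append)

lemma Theta_one: "\<Theta> \<one>\<^bsub>W\<^esub> = \<one>"
  by (simp add: W_one Theta_cl)

lemma Theta_inv: "g \<in> carrier W \<Longrightarrow> \<Theta> (inv\<^bsub>W\<^esub> g) = inv (\<Theta> g)"
  by (metis Theta_closed Theta_mult Theta_one W.inv_closed W.l_inv inv_equality)

lemma Theta_surj: "b \<in> carrier B \<Longrightarrow> \<exists>w\<in>carrier W. \<Theta> w = b"
  using th_generate Theta_cl cl_closed by (metis wprod_def)

lemma relabel_closed: "a \<in> A \<Longrightarrow> h \<in> carrier W \<Longrightarrow> relabel a h \<in> carrier W"
  unfolding relabel_def by (intro cl_closed map_act word_of)

lemma relabel_mult:
  "a \<in> A \<Longrightarrow> g \<in> carrier W \<Longrightarrow> h \<in> carrier W \<Longrightarrow> relabel a (g \<otimes>\<^bsub>W\<^esub> h) = relabel a g \<otimes>\<^bsub>W\<^esub> relabel a h"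
  by (auto simp: W_carrier cl_mult relabel_cl)

lemma relabel_relabel:
  "a \<in> A \<Longrightarrow> b \<in> A \<Longrightarrow> h \<in> carrier W \<Longrightarrow> relabel a (relabel b h) = relabel (a \<otimes> b) h"
proof -
  assume "a \<in> A" "b \<in> A" "h \<in> carrier W"
  then obtain u where u: "set u \<subseteq> {..<p}" "h = cl u" by (auto simp: W_carrier)
  moreover have "map (act a) (map (act b) u) = map (act (a \<otimes> b)) u"
    using u act_mult[OF \<open>a \<in> A\<close> \<open>b \<in> A\<close>] by auto
  ultimately show ?thesis using \<open>a \<in> A\<close> \<open>b \<in> A\<close>
    by (metis relabel_cl A_closed(4) map_act)
qed

lemma relabel_one: "h \<in> carrier W \<Longrightarrow> relabel \<one> h = h"
proof -
  assume "h \<in> carrier W"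
  then obtain u where u: "set u \<subseteq> {..<p}" "h = cl u" by (auto simp: W_carrier)
  then have "map (act \<one>) u = u" using act_one by (intro map_idI) auto
  then show ?thesis using u relabel_cl[OF A_closed(3)] by simp
qed

lemma Theta_relabel: "a \<in> A \<Longrightarrow> h \<in> carrier W \<Longrightarrow> \<Theta> (relabel a h) = a \<otimes> \<Theta> h \<otimes> inv a"
  using map_act by (auto simp: W_carrier relabel_cl Theta_cl wprod_map_act)

subsection \<open>Local groups and points of the building\<close>

abbreviation "L \<equiv> local_group p (\<lambda>_. 4)"
abbreviation "bp \<equiv> bpoint p (\<lambda>_. 4)"
abbreviation "Bd \<equiv> building p (\<lambda>_. 4)"

lemma local_group_eq:
  assumes "x \<in> P"
  shows "L x = cl ` {u. set u \<subseteq> sides p x}"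
proof
  let ?S = "{cl [i] | i. i < p \<and> x \<in> ra_edge p i}"
  have S: "?S = {cl [i] | i. i \<in> sides p x}" using sides_edge[OF assms] by auto
  show "L x \<subseteq> cl ` {u. set u \<subseteq> sides p x}"
  proof
    fix g assume "g \<in> L x"
    then have "g \<in> generate W ?S" by (simp add: local_group_def)
    then show "g \<in> cl ` {u. set u \<subseteq> sides p x}"
    proof (induction rule: generate.induct)
      case one
      show ?case by (rule image_eqI[of _ _ "[]"]) (auto simp: W_one)
    next
      case (incl h)
      then show ?case unfolding S by (auto intro!: image_eqI[of _ _ "[_]"])
    next
      case (inv h)
      then obtain i where i: "i \<in> sides p x" "h = cl [i]" unfolding S by auto
      then have "i < p" by (auto simp: sides_def)
      then have "inv\<^bsub>W\<^esub> h = cl [i, i, i]"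
        unfolding i by (intro W.inv_equality) (simp_all add: cl_mult cl_closed W_one cl_pow)
      then show ?case using i by (auto intro!: image_eqI[of _ _ "[i, i, i]"])
    next
      case (eng g h)
      then obtain u v where "set u \<subseteq> sides p x" "set v \<subseteq> sides p x" "g = cl u" "h = cl v" by auto
      then show ?case by (intro image_eqI[of _ _ "u @ v"]) (auto simp: cl_mult)
    qed
  qed
  show "cl ` {u. set u \<subseteq> sides p x} \<subseteq> L x"
  proof clarify
    fix u assume "set u \<subseteq> sides p x"
    then show "cl u \<in> L x"
    proof (induction u)
      case Nil
      show ?case unfolding local_group_def W_one[symmetric] by (rule generate.one)
    next
      case (Cons i u)
      then have "cl [i] \<in> ?S" unfolding S by auto
      then have "cl [i] \<in> L x" unfolding local_group_def by (rule generate.incl)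
      moreover have "cl (i # u) = cl [i] \<otimes>\<^bsub>W\<^esub> cl u" by (simp add: cl_mult)
      ultimately show ?case using Cons unfolding local_group_def by (auto intro: generate.eng)
    qed
  qed
qed

lemma local_group_subgroup: "x \<in> P \<Longrightarrow> subgroup (L x) W"
  unfolding local_group_def by (rule W.generate_is_subgroup) (auto intro: cl_closed)

lemma local_group_sub: "x \<in> P \<Longrightarrow> L x \<subseteq> carrier W"
  using local_group_subgroup subgroup.subset by blast

lemma Theta_local_group: "x \<in> P \<Longrightarrow> \<Theta> ` L x = locgrp x"
  using sides_lt[of x] unfolding local_group_eq locgrp_def image_image
  by (intro image_cong HOL.refl Theta_cl) auto

lemma relabel_local_group: "a \<in> A \<Longrightarrow> x \<in> P \<Longrightarrow> relabel a ` L x = L (iso a x)"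
proof -
  assume a: "a \<in> A" and x: "x \<in> P"
  have "relabel a ` L x = (\<lambda>u. cl (map (act a) u)) ` {u. set u \<subseteq> sides p x}"
    using sides_lt[of x] unfolding local_group_eq[OF x] image_image
    by (intro image_cong HOL.refl relabel_cl[OF a]) auto
  also have "\<dots> = cl ` (map (act a) ` {u. set u \<subseteq> sides p x})" by (simp add: image_image)
  also have "map (act a) ` {u. set u \<subseteq> sides p x} = {u. set u \<subseteq> act a ` sides p x}"
    by (metis lists_eq_set lists_image)
  finally show ?thesis using local_group_eq[OF iso_polygon[OF a x]] sides_iso[OF a] by simp
qed

lemma cl_replicate_comm: "adjacent p j k \<Longrightarrow> cl (k # replicate n j @ v) = cl (replicate n j @ k # v)"
proof (induction n)
  case (Suc n)
  have "cl (k # replicate (Suc n) j @ v) = cl ([k, j] @ (replicate n j @ v))" by simp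
  also have "\<dots> = cl ([j, k] @ (replicate n j @ v))" using cl_comm[OF Suc.prems] by (rule HOL.sym)
  also have "\<dots> = cl [j] \<otimes>\<^bsub>W\<^esub> cl (k # replicate n j @ v)" by (simp add: cl_mult)
  also have "\<dots> = cl (replicate (Suc n) j @ k # v)" using Suc by (simp add: cl_mult)
  finally show ?case .
qed simp

text \<open>
  Words in two commuting letters of order 4 can be sorted and reduced; therefore local groups
  are finite.
\<close>

lemma cl_pair_form:
  assumes "adjacent p j k" "set u \<subseteq> {j, k}"
  shows "\<exists>m<4. \<exists>n<4. cl u = cl (replicate m j @ replicate n k)"
  using assms(2)
proof (induction u)
  case Nil
  show ?case by (intro exI[of _ "0::nat"] conjI) simp_all
next
  case (Cons i u)
  have jk: "j < p" "k < p" using assms(1) by (auto simp: adjacent_def)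
  have red: "\<exists>m'<4. cl (replicate (Suc m) l @ v) = cl (replicate m' l @ v)" if "m < 4" "l < p" for m l v
  proof (cases "m = 3")
    case True
    then have "replicate (Suc m) l = [l, l, l, l]" by (simp add: numeral_eq_Suc)
    then have "cl (replicate (Suc m) l @ v) = cl [l, l, l, l] \<otimes>\<^bsub>W\<^esub> cl v" by (simp add: cl_mult)
    then have "cl (replicate (Suc m) l @ v) = cl (replicate 0 l @ v)"
      unfolding cl_pow[OF that(2)] cl_mult by simp
    then show ?thesis by (intro exI[of _ 0]) auto
  qed (use that in \<open>intro exI[of _ "Suc m"], auto\<close>)
  obtain m n where mn: "m < 4" "n < 4" "cl u = cl (replicate m j @ replicate n k)" using Cons by auto
  have "cl (i # u) = cl [i] \<otimes>\<^bsub>W\<^esub> cl u" by (simp add: cl_mult)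
  also have "\<dots> = cl (i # replicate m j @ replicate n k)" unfolding mn by (simp add: cl_mult)
  finally have e: "cl (i # u) = cl (i # replicate m j @ replicate n k)" .
  show ?case
  proof (cases "i = j")
    case True
    then show ?thesis using e red[OF mn(1) jk(1), of "replicate n k"] mn(2) by auto
  next
    case False
    then have "i = k" using Cons by auto
    then have "cl (i # u) = cl (replicate m j @ replicate (Suc n) k)"
      using e cl_replicate_comm[OF assms(1)] by simp
    also have "\<dots> = cl (replicate m j) \<otimes>\<^bsub>W\<^esub> cl (replicate (Suc n) k @ [])" by (simp add: cl_mult)
    finally show ?thesis using red[OF mn(2) jk(2), of "[]"] mn(1) by (metis append_Nil2 cl_mult)
  qed
qed

lemma finite_local_group: assumes "x \<in> P" shows "finite (L x)"
proof -
  obtain i where i: "i < p" "sides p x \<subseteq> {i, nxt p i}" using polygon_point[OF assms] by metis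
  have "L x \<subseteq> (\<lambda>(m, n). cl (replicate m i @ replicate n (nxt p i))) ` ({..<4} \<times> {..<4})"
  proof
    fix g assume "g \<in> L x"
    then obtain u where "set u \<subseteq> sides p x" "g = cl u" unfolding local_group_eq[OF assms] by blast
    then have "set u \<subseteq> {i, nxt p i}" "g = cl u" using i by auto
    then show "g \<in> (\<lambda>(m, n). cl (replicate m i @ replicate n (nxt p i))) ` ({..<4} \<times> {..<4})"
      using cl_pair_form[OF adjacent_nxt[OF i(1)]] by (auto simp: image_iff Bex_def)
  qed
  then show ?thesis by (rule finite_subset) auto
qed

lemma bp_eq_iff:
  assumes "h \<in> carrier W" "h' \<in> carrier W" "x \<in> P"
  shows "bp h x = bp h' x' \<longleftrightarrow> x = x' \<and> (\<exists>l\<in>L x. h' = h \<otimes>\<^bsub>W\<^esub> l)"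
proof -
  note sg = local_group_subgroup[OF assms(3)]
  have "h <#\<^bsub>W\<^esub> L x = h' <#\<^bsub>W\<^esub> L x \<longleftrightarrow> h' \<in> h <#\<^bsub>W\<^esub> L x"
  proof
    assume eq: "h <#\<^bsub>W\<^esub> L x = h' <#\<^bsub>W\<^esub> L x"
    have "h' \<otimes>\<^bsub>W\<^esub> \<one>\<^bsub>W\<^esub> \<in> h' <#\<^bsub>W\<^esub> L x"
      using subgroup.one_closed[OF sg] unfolding l_coset_def by blast
    then show "h' \<in> h <#\<^bsub>W\<^esub> L x" using assms(2) eq by simp
  qed (rule W.l_repr_independence[OF _ assms(1) sg])
  then have "bp h x = bp h' x' \<longleftrightarrow> x = x' \<and> h' \<in> h <#\<^bsub>W\<^esub> L x" by (auto simp: bpoint_def)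
  then show ?thesis by (simp add: l_coset_def)
qed

lemma topspace_building: "topspace Bd = {bp h x | h x. h \<in> carrier W \<and> x \<in> P}"
  unfolding building_def topspace_quotient_topology by (force simp: image_iff)

lemma bp_in: "h \<in> carrier W \<Longrightarrow> x \<in> P \<Longrightarrow> bp h x \<in> topspace Bd"
  unfolding topspace_building by auto

text \<open>
  The building carries the weak topology with respect to its chambers.
\<close>

lemma openin_building:
  "openin Bd U \<longleftrightarrow> U \<subseteq> topspace Bd \<and>
     (\<forall>h\<in>carrier W. openin (top_of_set P) {x \<in> P. bp h x \<in> U})"
proof -
  have "topspace Bd = (\<lambda>(h, x). bp h x) ` (carrier W \<times> P)"
    unfolding building_def topspace_quotient_topology by simp
  then show ?thesis
    unfolding building_def openin_quotient_topology openin_prod_discrete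
    by (auto simp: conj_ac cong: conj_cong)
qed

section \<open>The lattice\<close>

text \<open>
  The polygon symmetry \<open>a\<close> followed by left translation by \<open>h\<close>: an element of the semidirect
  product of \<open>W\<close> and \<open>A\<close> acting on the building. Points are encoded by cosets, so the coset has
  to be relabelled and translated.
\<close>

definition auto_map :: "nat list set \<Rightarrow> 'a \<Rightarrow> building_point \<Rightarrow> building_point" where
  "auto_map h a = restrict (\<lambda>(C, x). (h <#\<^bsub>W\<^esub> (relabel a ` C), iso a x)) (topspace Bd)"

lemma auto_bp:
  assumes "h \<in> carrier W" "a \<in> A" "w \<in> carrier W" "x \<in> P"
  shows "auto_map h a (bp w x) = bp (h \<otimes>\<^bsub>W\<^esub> relabel a w) (iso a x)"
proof -
  have "relabel a ` (w <#\<^bsub>W\<^esub> L x) = (\<lambda>l. relabel a w \<otimes>\<^bsub>W\<^esub> relabel a l) ` L x"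
    unfolding l_coset_def using local_group_sub[OF assms(4)] relabel_mult[OF assms(2,3)]
    by (auto simp: image_iff)
  also have "\<dots> = relabel a w <#\<^bsub>W\<^esub> (relabel a ` L x)"
    by (auto simp: l_coset_def)
  finally have "h <#\<^bsub>W\<^esub> (relabel a ` (w <#\<^bsub>W\<^esub> L x)) = h <#\<^bsub>W\<^esub> (relabel a w <#\<^bsub>W\<^esub> L (iso a x))"
    by (simp add: relabel_local_group[OF assms(2,4)])
  also have "\<dots> = (h \<otimes>\<^bsub>W\<^esub> relabel a w) <#\<^bsub>W\<^esub> L (iso a x)"
    using assms local_group_sub[OF iso_polygon] relabel_closed by (intro W.lcos_m_assoc) auto
  finally show ?thesis
    using bp_in[OF assms(3,4)] by (simp add: auto_map_def bpoint_def)
qed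

lemma auto_auto:
  assumes "h \<in> carrier W" "a \<in> A" "h' \<in> carrier W" "a' \<in> A" "z \<in> topspace Bd"
  shows "auto_map h a (auto_map h' a' z) = auto_map (h \<otimes>\<^bsub>W\<^esub> relabel a h') (a \<otimes> a') z"
proof -
  obtain w x where "w \<in> carrier W" "x \<in> P" "z = bp w x" using assms(5) by (auto simp: topspace_building)
  then show ?thesis using assms
    by (simp add: auto_bp iso_polygon relabel_closed relabel_mult relabel_relabel A_closed W.m_assoc iso_mult)
qed

lemma auto_one: "z \<in> topspace Bd \<Longrightarrow> auto_map \<one>\<^bsub>W\<^esub> \<one> z = z"
  by (auto simp: topspace_building auto_bp A_closed relabel_one iso_one)

lemma auto_in: "h \<in> carrier W \<Longrightarrow> a \<in> A \<Longrightarrow> z \<in> topspace Bd \<Longrightarrow> auto_map h a z \<in> topspace Bd"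
  by (auto simp: topspace_building auto_bp) (metis W.m_closed iso_polygon relabel_closed)

lemma relabel_W_one: "a \<in> A \<Longrightarrow> relabel a \<one>\<^bsub>W\<^esub> = \<one>\<^bsub>W\<^esub>"
  by (simp add: W_one relabel_cl)

lemma auto_inverse:
  assumes "h \<in> carrier W" "a \<in> A" "z \<in> topspace Bd"
  shows "auto_map (relabel (inv a) (inv\<^bsub>W\<^esub> h)) (inv a) (auto_map h a z) = z"
    "auto_map h a (auto_map (relabel (inv a) (inv\<^bsub>W\<^esub> h)) (inv a) z) = z"
  using assms A_closed
  by (simp_all add: auto_auto relabel_closed relabel_relabel relabel_one auto_one flip: relabel_mult)
    (simp_all add: relabel_W_one auto_one)

lemma auto_Bij: assumes "h \<in> carrier W" "a \<in> A" shows "auto_map h a \<in> Bij (topspace Bd)"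
proof -
  let ?k = "relabel (inv a) (inv\<^bsub>W\<^esub> h)"
  have k: "?k \<in> carrier W" "inv a \<in> A" using assms A_closed relabel_closed by auto
  have "bij_betw (auto_map h a) (topspace Bd) (topspace Bd)"
    using auto_in[OF assms] auto_in[OF k] auto_inverse[OF assms]
    by (intro bij_betwI[of _ _ _ "auto_map ?k (inv a)"]) auto
  then show ?thesis by (auto simp: Bij_def auto_map_def)
qed

lemma iso_polygon_isometry: "a \<in> A \<Longrightarrow> polygon_isometry p (iso a)"
proof -
  assume a: "a \<in> A"
  have "iso a ` P = P"
  proof
    show "P \<subseteq> iso a ` P"
    proof
      fix x assume "x \<in> P"
      then show "x \<in> iso a ` P" using iso_inv(2)[OF a, of x] iso_polygon[of "inv a" x] A_closed a by (metis imageI)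
    qed
  qed (use iso_polygon a in auto)
  then show ?thesis
    using hyp_dist_disc_isometry[OF iso_isometry[OF a]] polygonD(1) by (auto simp: polygon_isometry_def)
qed

abbreviation "Auts \<equiv> building_auts p (\<lambda>_. 4)"
abbreviation "AutG \<equiv> Aut_building p (\<lambda>_. 4)"
abbreviation "AutT \<equiv> Aut_topology p (\<lambda>_. 4)"

lemma auto_in_Auts: "h \<in> carrier W \<Longrightarrow> a \<in> A \<Longrightarrow> auto_map h a \<in> Auts"
  unfolding building_auts_def mem_Collect_eq
proof (intro conjI ballI)
  assume h: "h \<in> carrier W" and a: "a \<in> A"
  show "auto_map h a \<in> Bij (topspace Bd)" by (rule auto_Bij[OF h a])
  fix w assume w: "w \<in> carrier W"
  show "\<exists>h'\<in>carrier W. \<exists>\<sigma>. polygon_isometry p \<sigma> \<and> (\<forall>x\<in>P. auto_map h a (bp w x) = bp h' (\<sigma> x))"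
    using h a w relabel_closed auto_bp[OF h a w] iso_polygon_isometry[OF a]
    by (intro bexI[of _ "h \<otimes>\<^bsub>W\<^esub> relabel a w"] exI[of _ "iso a"]) auto
qed

subsection \<open>The automorphism group\<close>

lemma bp_interior_eq:
  assumes "h \<in> carrier W" "h' \<in> carrier W" "x \<in> P" "sides p x = {}"
  shows "bp h x = bp h' x' \<longleftrightarrow> x = x' \<and> h = h'"
proof -
  have "L x = {\<one>\<^bsub>W\<^esub>}" using local_group_eq[OF assms(3)] assms(4) by (simp add: W_one)
  then show ?thesis using bp_eq_iff[OF assms(1-3)] assms by auto
qed

lemma Auts_chamber:
  assumes "\<phi> \<in> Auts" "h \<in> carrier W"
  obtains w \<sigma> where "w \<in> carrier W" "polygon_isometry p \<sigma>" "\<And>x. x \<in> P \<Longrightarrow> \<phi> (bp h x) = bp w (\<sigma> x)"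
  using assms unfolding building_auts_def by blast

lemma Auts_Bij: "\<phi> \<in> Auts \<Longrightarrow> \<phi> \<in> Bij (topspace Bd)"
  by (simp add: building_auts_def)

lemma Auts_bij: "\<phi> \<in> Auts \<Longrightarrow> bij_betw \<phi> (topspace Bd) (topspace Bd)"
  using Auts_Bij by (auto simp: Bij_def)

lemma Auts_ext: "\<phi> \<in> Auts \<Longrightarrow> \<psi> \<in> Auts \<Longrightarrow> (\<And>h x. h \<in> carrier W \<Longrightarrow> x \<in> P \<Longrightarrow> \<phi> (bp h x) = \<psi> (bp h x)) \<Longrightarrow> \<phi> = \<psi>"
  using Auts_Bij Bij_imp_extensional[of _ "topspace Bd"]
  by (intro extensionalityI[of _ "topspace Bd"]) (auto simp: topspace_building)

text \<open>
  The centre of a chamber lies in no other chamber; so every chamber is the image of the chamber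
  that contains the preimage of its centre.
\<close>

lemma Auts_inverse:
  assumes "\<phi> \<in> Auts"
  shows "(\<lambda>x\<in>topspace Bd. inv_into (topspace Bd) \<phi> x) \<in> Auts"
  unfolding building_auts_def mem_Collect_eq
proof (intro conjI ballI)
  let ?S = "topspace Bd"
  show "(\<lambda>x\<in>?S. inv_into ?S \<phi> x) \<in> Bij ?S" by (rule restrict_inv_into_Bij[OF Auts_Bij[OF assms]])
  fix w assume w: "w \<in> carrier W"
  have "bp w 0 \<in> \<phi> ` ?S" using Auts_bij[OF assms] bp_in[OF w zero_in(1)] by (simp add: bij_betw_def)
  then obtain h x where h: "h \<in> carrier W" "x \<in> P" "\<phi> (bp h x) = bp w 0" by (auto simp: topspace_building)
  obtain w' \<sigma> where w': "w' \<in> carrier W" "polygon_isometry p \<sigma>" "\<And>x. x \<in> P \<Longrightarrow> \<phi> (bp h x) = bp w' (\<sigma> x)"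
    using Auts_chamber[OF assms h(1)] by metis
  have "bp w 0 = bp w' (\<sigma> x)" using h w' by simp
  then have "w' = w" using bp_interior_eq[OF w w'(1) zero_in] by simp
  have im: "\<sigma> ` P = P" using w'(2) by (simp add: polygon_isometry_def)
  show "\<exists>h'\<in>carrier W. \<exists>\<sigma>. polygon_isometry p \<sigma> \<and> (\<forall>x\<in>P. (\<lambda>x\<in>?S. inv_into ?S \<phi> x) (bp w x) = bp h' (\<sigma> x))"
  proof (intro bexI[OF _ h(1)] exI[of _ "inv_into P \<sigma>"] conjI ballI)
    show "polygon_isometry p (inv_into P \<sigma>)" by (rule isometry_inverse[OF w'(2)])
    fix y assume y: "y \<in> P"
    let ?z = "inv_into P \<sigma> y"
    have z: "?z \<in> P" "\<sigma> ?z = y" using y im by (simp_all add: inv_into_into f_inv_into_f)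
    have "\<phi> (bp h ?z) = bp w y" using w'(3)[OF z(1)] z(2) \<open>w' = w\<close> by simp
    then have "inv_into ?S \<phi> (bp w y) = bp h ?z"
      using Auts_bij[OF assms] bp_in[OF h(1) z(1)] inv_into_f_eq[of \<phi> ?S] by (simp add: bij_betw_def)
    then show "(\<lambda>x\<in>?S. inv_into ?S \<phi> x) (bp w y) = bp h ?z" using bp_in[OF w y] by simp
  qed
qed

lemma Auts_compose:
  assumes "\<phi> \<in> Auts" "\<psi> \<in> Auts"
  shows "compose (topspace Bd) \<phi> \<psi> \<in> Auts"
  unfolding building_auts_def mem_Collect_eq
proof (intro conjI ballI)
  let ?S = "topspace Bd"
  show "compose ?S \<phi> \<psi> \<in> Bij ?S" using Auts_Bij assms by (intro compose_Bij)
  fix h assume h: "h \<in> carrier W"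
  obtain w \<sigma> where w: "w \<in> carrier W" "polygon_isometry p \<sigma>" "\<And>x. x \<in> P \<Longrightarrow> \<psi> (bp h x) = bp w (\<sigma> x)"
    using Auts_chamber[OF assms(2) h] by metis
  obtain w' \<tau> where w': "w' \<in> carrier W" "polygon_isometry p \<tau>" "\<And>x. x \<in> P \<Longrightarrow> \<phi> (bp w x) = bp w' (\<tau> x)"
    using Auts_chamber[OF assms(1) w(1)] by metis
  show "\<exists>h'\<in>carrier W. \<exists>\<sigma>. polygon_isometry p \<sigma> \<and> (\<forall>x\<in>P. compose ?S \<phi> \<psi> (bp h x) = bp h' (\<sigma> x))"
  proof (intro bexI[OF _ w'(1)] exI[of _ "\<lambda>x. \<tau> (\<sigma> x)"] conjI ballI)
    show "polygon_isometry p (\<lambda>x. \<tau> (\<sigma> x))" by (rule isometry_compose[OF w'(2) w(2)])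
    fix x assume x: "x \<in> P"
    show "compose ?S \<phi> \<psi> (bp h x) = bp w' (\<tau> (\<sigma> x))"
      using bp_in[OF h x] w(3)[OF x] w'(3)[OF isometry_ratio(1)[OF w(2) x x]] by (simp add: compose_eq)
  qed
qed

lemma Auts_subgroup: "subgroup Auts (BijGroup (topspace Bd))"
proof
  let ?S = "topspace Bd"
  show "Auts \<subseteq> carrier (BijGroup ?S)" using Auts_Bij by (auto simp: BijGroup_def)
  show "\<phi> \<otimes>\<^bsub>BijGroup ?S\<^esub> \<psi> \<in> Auts" if "\<phi> \<in> Auts" "\<psi> \<in> Auts" for \<phi> \<psi>
    using that Auts_compose Auts_Bij by (simp add: BijGroup_def)
  have "\<one>\<^bsub>BijGroup ?S\<^esub> = auto_map \<one>\<^bsub>W\<^esub> \<one>"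
    using auto_one by (auto simp: BijGroup_def auto_map_def restrict_def)
  then show "\<one>\<^bsub>BijGroup ?S\<^esub> \<in> Auts" using auto_in_Auts A_closed by simp
  show "inv\<^bsub>BijGroup ?S\<^esub> \<phi> \<in> Auts" if "\<phi> \<in> Auts" for \<phi>
    unfolding inv_BijGroup[OF Auts_Bij[OF that]] by (rule Auts_inverse[OF that])
qed

lemma AutG_group: "group AutG"
  unfolding Aut_building_def by (rule subgroup.subgroup_is_group[OF Auts_subgroup group_BijGroup])

lemma AutG_carrier: "carrier AutG = Auts"
  by (simp add: Aut_building_def)

lemma AutG_mult: "\<phi> \<in> Auts \<Longrightarrow> \<psi> \<in> Auts \<Longrightarrow> z \<in> topspace Bd \<Longrightarrow> (\<phi> \<otimes>\<^bsub>AutG\<^esub> \<psi>) z = \<phi> (\<psi> z)"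
  using Auts_Bij by (simp add: Aut_building_def BijGroup_def compose_eq)

lemma AutG_one: "\<one>\<^bsub>AutG\<^esub> = auto_map \<one>\<^bsub>W\<^esub> \<one>"
  using auto_one by (auto simp: Aut_building_def BijGroup_def auto_map_def restrict_def)

lemma AutG_mult_auto:
  assumes "h \<in> carrier W" "a \<in> A" "h' \<in> carrier W" "a' \<in> A"
  shows "auto_map h a \<otimes>\<^bsub>AutG\<^esub> auto_map h' a' = auto_map (h \<otimes>\<^bsub>W\<^esub> relabel a h') (a \<otimes> a')"
proof (rule Auts_ext)
  have "auto_map h a \<otimes>\<^bsub>AutG\<^esub> auto_map h' a' \<in> carrier AutG"
    using assms auto_in_Auts AutG_group by (intro monoid.m_closed group.is_monoid) (auto simp: AutG_carrier)
  then show "auto_map h a \<otimes>\<^bsub>AutG\<^esub> auto_map h' a' \<in> Auts" by (simp add: AutG_carrier)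
  show "auto_map (h \<otimes>\<^bsub>W\<^esub> relabel a h') (a \<otimes> a') \<in> Auts"
    using assms A_closed relabel_closed by (intro auto_in_Auts) auto
qed (use assms AutG_mult auto_in_Auts auto_auto bp_in in auto)

text \<open>
  The kernel of the homomorphism from the semidirect product of \<open>W\<close> and \<open>A\<close> to \<open>B\<close> that is
  \<open>\<Theta>\<close> on \<open>W\<close> and the inclusion on \<open>A\<close>.
\<close>

definition Gam :: "(building_point \<Rightarrow> building_point) set" where
  "Gam = {auto_map h a | h a. h \<in> carrier W \<and> a \<in> A \<and> \<Theta> h \<otimes> a = \<one>}"

lemma Gam_data:
  "h \<in> carrier W \<Longrightarrow> a \<in> A \<Longrightarrow> \<Theta> h \<otimes> a = \<one> \<longleftrightarrow> \<Theta> h = inv a"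
  using A_closed(1) Theta_closed by (metis inv_equality inv_inv l_inv)

lemma Gam_subgroup: "subgroup Gam AutG"
proof (rule group.subgroupI[OF AutG_group])
  show "Gam \<subseteq> carrier AutG" using auto_in_Auts by (auto simp: Gam_def AutG_carrier)
  have "auto_map \<one>\<^bsub>W\<^esub> \<one> \<in> Gam" unfolding Gam_def using A_closed(3) Theta_one by force
  then show "Gam \<noteq> {}" by blast
  fix \<phi> assume "\<phi> \<in> Gam"
  then obtain h a where ha: "h \<in> carrier W" "a \<in> A" "\<Theta> h = inv a" "\<phi> = auto_map h a"
    by (auto simp: Gam_def Gam_data)
  let ?k = "relabel (inv a) (inv\<^bsub>W\<^esub> h)"
  have k: "?k \<in> carrier W" "inv a \<in> A" using ha A_closed relabel_closed by auto
  have "auto_map ?k (inv a) \<otimes>\<^bsub>AutG\<^esub> \<phi> = \<one>\<^bsub>AutG\<^esub>"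
    unfolding ha(4) AutG_one using ha k A_closed
    by (simp add: AutG_mult_auto flip: relabel_mult) (simp add: relabel_W_one)
  then have "inv\<^bsub>AutG\<^esub> \<phi> = auto_map ?k (inv a)"
    using ha k auto_in_Auts by (intro group.inv_equality[OF AutG_group]) (auto simp: AutG_carrier)
  moreover have "\<Theta> ?k = inv (inv a)"
    using ha k A_closed by (simp add: Theta_relabel Theta_inv)
  then have "\<Theta> ?k \<otimes> inv a = \<one>" using Gam_data[OF k] by simp
  ultimately show "inv\<^bsub>AutG\<^esub> \<phi> \<in> Gam" using k unfolding Gam_def mem_Collect_eq by blast
  fix \<psi> assume "\<psi> \<in> Gam"
  then obtain h' a' where ha': "h' \<in> carrier W" "a' \<in> A" "\<Theta> h' = inv a'" "\<psi> = auto_map h' a'"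
    by (auto simp: Gam_def Gam_data)
  have "\<Theta> (h \<otimes>\<^bsub>W\<^esub> relabel a h') = inv (a \<otimes> a')"
    using ha ha' A_closed by (simp add: Theta_mult Theta_relabel relabel_closed inv_mult_group m_assoc inv_cancel)
  moreover have k: "h \<otimes>\<^bsub>W\<^esub> relabel a h' \<in> carrier W" "a \<otimes> a' \<in> A"
    using ha ha' A_closed(4) relabel_closed by simp_all
  ultimately have "\<Theta> (h \<otimes>\<^bsub>W\<^esub> relabel a h') \<otimes> (a \<otimes> a') = \<one>" using Gam_data[OF k] by simp
  then show "\<phi> \<otimes>\<^bsub>AutG\<^esub> \<psi> \<in> Gam"
    unfolding ha(4) ha'(4) AutG_mult_auto[OF ha(1,2) ha'(1,2)] Gam_def mem_Collect_eq using k by blast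
qed

subsection \<open>The quotient as a glued space\<close>

text \<open>
  Given \<open>a\<close> and a solution of the equation in \<open>B\<close>, the element of \<open>Gam\<close> is found by solving the
  corresponding equation in \<open>W\<close> for \<open>h\<close>; applying \<open>\<Theta>\<close> shows that it has the right image.
\<close>

lemma orbit_eq:
  assumes "w \<in> carrier W" "x \<in> P" "w' \<in> carrier W" "x' \<in> P"
  shows "orbit_of Gam (bp w x) = orbit_of Gam (bp w' x') \<longleftrightarrow>
    (\<exists>a\<in>A. x' = iso a x \<and> (\<exists>g\<in>locgrp x'. \<Theta> w \<otimes> inv a = \<Theta> w' \<otimes> g))"
proof -
  interpret AG: group AutG by (rule AutG_group)
  have Gsub: "\<phi> \<in> Auts" if "\<phi> \<in> Gam" for \<phi> using that auto_in_Auts by (auto simp: Gam_def)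
  have mem: "orbit_of Gam (bp w x) = orbit_of Gam (bp w' x') \<longleftrightarrow> bp w' x' \<in> orbit_of Gam (bp w x)"
  proof
    assume eq: "orbit_of Gam (bp w x) = orbit_of Gam (bp w' x')"
    have "\<one>\<^bsub>AutG\<^esub> (bp w' x') \<in> orbit_of Gam (bp w' x')"
      unfolding orbit_of_def using subgroup.one_closed[OF Gam_subgroup] by blast
    then show "bp w' x' \<in> orbit_of Gam (bp w x)" using eq auto_one[OF bp_in[OF assms(3,4)]] by (simp add: AutG_one)
  next
    assume "bp w' x' \<in> orbit_of Gam (bp w x)"
    then obtain \<gamma> where g: "\<gamma> \<in> Gam" "bp w' x' = \<gamma> (bp w x)" by (auto simp: orbit_of_def)
    note S = bp_in[OF assms(1,2)]
    show "orbit_of Gam (bp w x) = orbit_of Gam (bp w' x')"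
    proof
      show "orbit_of Gam (bp w' x') \<subseteq> orbit_of Gam (bp w x)"
      proof
        fix y assume "y \<in> orbit_of Gam (bp w' x')"
        then obtain d where d: "d \<in> Gam" "y = d (\<gamma> (bp w x))" by (auto simp: orbit_of_def g(2))
        then have "y = (d \<otimes>\<^bsub>AutG\<^esub> \<gamma>) (bp w x)" using AutG_mult[OF Gsub[OF d(1)] Gsub[OF g(1)] S] by simp
        then show "y \<in> orbit_of Gam (bp w x)"
          using subgroup.m_closed[OF Gam_subgroup d(1) g(1)] by (auto simp: orbit_of_def)
      qed
      show "orbit_of Gam (bp w x) \<subseteq> orbit_of Gam (bp w' x')"
      proof
        fix y assume "y \<in> orbit_of Gam (bp w x)"
        then obtain d where d: "d \<in> Gam" "y = d (bp w x)" by (auto simp: orbit_of_def)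
        let ?e = "d \<otimes>\<^bsub>AutG\<^esub> inv\<^bsub>AutG\<^esub> \<gamma>"
        have e: "?e \<in> Gam" using d g Gam_subgroup by (meson subgroup.m_closed subgroup.m_inv_closed)
        have "?e \<otimes>\<^bsub>AutG\<^esub> \<gamma> = d" using Gsub[OF d(1)] Gsub[OF g(1)]
          unfolding AutG_carrier[symmetric] by (simp add: AG.m_assoc)
        then have "y = ?e (bp w' x')" using AutG_mult[OF Gsub[OF e] Gsub[OF g(1)] S] d g by simp
        then show "y \<in> orbit_of Gam (bp w' x')" using e by (auto simp: orbit_of_def)
      qed
    qed
  qed
  also have "\<dots> \<longleftrightarrow> (\<exists>h\<in>carrier W. \<exists>a\<in>A. \<Theta> h = inv a \<and> bp w' x' = bp (h \<otimes>\<^bsub>W\<^esub> relabel a w) (iso a x))"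
  proof -
    have "bp w' x' \<in> orbit_of Gam (bp w x) \<longleftrightarrow>
        (\<exists>h a. h \<in> carrier W \<and> a \<in> A \<and> \<Theta> h \<otimes> a = \<one> \<and> bp w' x' = auto_map h a (bp w x))"
      by (simp only: orbit_of_def Gam_def image_iff Bex_def mem_Collect_eq) metis
    also have "\<dots> \<longleftrightarrow> (\<exists>h a. h \<in> carrier W \<and> a \<in> A \<and> \<Theta> h = inv a \<and>
        bp w' x' = bp (h \<otimes>\<^bsub>W\<^esub> relabel a w) (iso a x))"
      using auto_bp[OF _ _ assms(1,2)] Gam_data by metis
    finally show ?thesis by blast
  qed
  also have "\<dots> \<longleftrightarrow> (\<exists>h\<in>carrier W. \<exists>a\<in>A. \<Theta> h = inv a \<and> x' = iso a x \<and> (\<exists>l\<in>L x'. h \<otimes>\<^bsub>W\<^esub> relabel a w = w' \<otimes>\<^bsub>W\<^esub> l))"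
    using bp_eq_iff[OF assms(3) _ assms(4)] relabel_closed assms(1) by (metis W.m_closed)
  also have "\<dots> \<longleftrightarrow> (\<exists>a\<in>A. x' = iso a x \<and> (\<exists>g\<in>locgrp x'. \<Theta> w \<otimes> inv a = \<Theta> w' \<otimes> g))"
  proof
    assume "\<exists>h\<in>carrier W. \<exists>a\<in>A. \<Theta> h = inv a \<and> x' = iso a x \<and> (\<exists>l\<in>L x'. h \<otimes>\<^bsub>W\<^esub> relabel a w = w' \<otimes>\<^bsub>W\<^esub> l)"
    then obtain h a l where h: "h \<in> carrier W" "a \<in> A" "\<Theta> h = inv a" "x' = iso a x" "l \<in> L x'"
      "h \<otimes>\<^bsub>W\<^esub> relabel a w = w' \<otimes>\<^bsub>W\<^esub> l" by blast
    have l: "l \<in> carrier W" "\<Theta> l \<in> locgrp x'" using local_group_sub assms h Theta_local_group by blast+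
    have "\<Theta> (h \<otimes>\<^bsub>W\<^esub> relabel a w) = \<Theta> w' \<otimes> \<Theta> l" unfolding h(6) using assms l by (simp add: Theta_mult)
    moreover have "\<Theta> (h \<otimes>\<^bsub>W\<^esub> relabel a w) = \<Theta> w \<otimes> inv a"
      using h(1-3) assms(1) A_closed(1)
      by (simp add: Theta_mult Theta_relabel relabel_closed Theta_closed m_assoc inv_cancel)
    ultimately have "\<Theta> w \<otimes> inv a = \<Theta> w' \<otimes> \<Theta> l" by simp
    then show "\<exists>a\<in>A. x' = iso a x \<and> (\<exists>g\<in>locgrp x'. \<Theta> w \<otimes> inv a = \<Theta> w' \<otimes> g)" using h l by blast
  next
    assume "\<exists>a\<in>A. x' = iso a x \<and> (\<exists>g\<in>locgrp x'. \<Theta> w \<otimes> inv a = \<Theta> w' \<otimes> g)"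
    then obtain a g where a: "a \<in> A" "x' = iso a x" "g \<in> locgrp x'" "\<Theta> w \<otimes> inv a = \<Theta> w' \<otimes> g" by blast
    then obtain l where l: "l \<in> L x'" "g = \<Theta> l" using Theta_local_group[OF assms(4)] by blast
    have lW: "l \<in> carrier W" using local_group_sub assms l by blast
    have rW: "relabel a w \<in> carrier W" using relabel_closed a assms by blast
    let ?h = "w' \<otimes>\<^bsub>W\<^esub> l \<otimes>\<^bsub>W\<^esub> inv\<^bsub>W\<^esub> (relabel a w)"
    have h: "?h \<in> carrier W" using lW rW assms by simp
    have c: "a \<in> carrier B" "\<Theta> w \<in> carrier B" using a A_closed Theta_closed assms by auto
    have "\<Theta> ?h = \<Theta> w \<otimes> inv a \<otimes> inv (a \<otimes> \<Theta> w \<otimes> inv a)"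
      using a l lW rW assms by (simp add: Theta_mult Theta_inv Theta_relabel)
    also have "\<dots> = inv a" using c by (simp add: inv_mult_group m_assoc inv_cancel)
    finally have "\<Theta> ?h = inv a" .
    moreover have "?h \<otimes>\<^bsub>W\<^esub> relabel a w = w' \<otimes>\<^bsub>W\<^esub> l" using lW rW assms by (simp add: W.m_assoc)
    ultimately show "\<exists>h\<in>carrier W. \<exists>a\<in>A. \<Theta> h = inv a \<and> x' = iso a x \<and> (\<exists>l\<in>L x'. h \<otimes>\<^bsub>W\<^esub> relabel a w = w' \<otimes>\<^bsub>W\<^esub> l)"
      using h a l by blast
  qed
  finally show ?thesis .
qed

abbreviation "Y \<equiv> building_quotient p (\<lambda>_. 4) Gam"

text \<open>
  The point of the quotient that is represented by the point \<open>x\<close> of the polygon with label \<open>b\<close>.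
  The quotient is now described by \<open>B\<close>, \<open>A\<close> and the polygon alone (\<open>cls_eq\<close>, \<open>openin_Y\<close>).
\<close>

definition cls :: "'a \<Rightarrow> complex \<Rightarrow> building_point set" where
  "cls b x = orbit_of Gam (bp (SOME w. w \<in> carrier W \<and> \<Theta> w = b) x)"

lemma cls_rep:
  assumes "b \<in> carrier B"
  obtains w where "w \<in> carrier W" "\<Theta> w = b" "\<And>x. cls b x = orbit_of Gam (bp w x)"
proof -
  have "\<exists>w. w \<in> carrier W \<and> \<Theta> w = b" using Theta_surj[OF assms] by blast
  from someI_ex[OF this] show ?thesis using that unfolding cls_def by blast
qed

lemma cls_eq:
  assumes "b \<in> carrier B" "x \<in> P" "b' \<in> carrier B" "x' \<in> P"
  shows "cls b x = cls b' x' \<longleftrightarrow> (\<exists>a\<in>A. x' = iso a x \<and> (\<exists>g\<in>locgrp x'. b \<otimes> inv a = b' \<otimes> g))"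
proof -
  obtain w w' where w: "w \<in> carrier W" "\<Theta> w = b" "\<And>x. cls b x = orbit_of Gam (bp w x)"
    and w': "w' \<in> carrier W" "\<Theta> w' = b'" "\<And>x. cls b' x = orbit_of Gam (bp w' x)"
    using cls_rep[OF assms(1)] cls_rep[OF assms(3)] by metis
  show ?thesis
    unfolding w(3) w'(3) orbit_eq[OF w(1) assms(2) w'(1) assms(4)] w(2) w'(2) by (rule HOL.refl)
qed

lemma orbit_cls:
  assumes "w \<in> carrier W" "x \<in> P"
  shows "orbit_of Gam (bp w x) = cls (\<Theta> w) x"
proof -
  obtain v where v: "v \<in> carrier W" "\<Theta> v = \<Theta> w" "\<And>x. cls (\<Theta> w) x = orbit_of Gam (bp v x)"
    using cls_rep[OF Theta_closed[OF assms(1)]] by metis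
  show ?thesis unfolding v(3) orbit_eq[OF assms v(1) assms(2)]
    using A_closed(3) locgrp_one iso_one v(2) by (intro bexI[of _ \<one>] conjI bexI[of _ \<one>]) auto
qed

lemma topspace_Y: "topspace Y = {cls b x | b x. b \<in> carrier B \<and> x \<in> P}"
proof -
  have "topspace Y = {orbit_of Gam (bp w x) | w x. w \<in> carrier W \<and> x \<in> P}"
    unfolding building_quotient_def topspace_quotient_topology topspace_building by blast
  also have "\<dots> = {cls b x | b x. b \<in> carrier B \<and> x \<in> P}"
    using orbit_cls Theta_closed by (auto, metis, metis cls_rep)
  finally show ?thesis .
qed

lemma openin_Y:
  "openin Y U \<longleftrightarrow> U \<subseteq> topspace Y \<and> (\<forall>b\<in>carrier B. openin (top_of_set P) {x \<in> P. cls b x \<in> U})"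
proof -
  have "topspace Y = orbit_of Gam ` topspace Bd"
    unfolding building_quotient_def topspace_quotient_topology ..
  moreover have "openin Bd {z \<in> topspace Bd. orbit_of Gam z \<in> U} \<longleftrightarrow>
     (\<forall>h\<in>carrier W. openin (top_of_set P) {x \<in> P. orbit_of Gam (bp h x) \<in> U})"
    unfolding openin_building using bp_in by (auto cong: conj_cong)
  moreover have "{x \<in> P. orbit_of Gam (bp h x) \<in> U} = {x \<in> P. cls (\<Theta> h) x \<in> U}" if "h \<in> carrier W" for h
    using orbit_cls[OF that] by auto
  ultimately show ?thesis
  proof -
    assume a: "topspace Y = orbit_of Gam ` topspace Bd"
    assume b: "openin Bd {z \<in> topspace Bd. orbit_of Gam z \<in> U} \<longleftrightarrow>
      (\<forall>h\<in>carrier W. openin (top_of_set P) {x \<in> P. orbit_of Gam (bp h x) \<in> U})"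
    assume "\<And>h. h \<in> carrier W \<Longrightarrow> {x \<in> P. orbit_of Gam (bp h x) \<in> U} = {x \<in> P. cls (\<Theta> h) x \<in> U}"
    then have "(\<forall>h\<in>carrier W. openin (top_of_set P) {x \<in> P. orbit_of Gam (bp h x) \<in> U}) \<longleftrightarrow>
        (\<forall>h\<in>carrier W. openin (top_of_set P) {x \<in> P. cls (\<Theta> h) x \<in> U})" by simp
    also have "\<dots> \<longleftrightarrow> (\<forall>b\<in>\<Theta> ` carrier W. openin (top_of_set P) {x \<in> P. cls b x \<in> U})" by blast
    also have "\<Theta> ` carrier W = carrier B" using Theta_surj Theta_closed by blast
    finally have "openin Bd {z \<in> topspace Bd. orbit_of Gam z \<in> U} \<longleftrightarrow>
        (\<forall>b\<in>carrier B. openin (top_of_set P) {x \<in> P. cls b x \<in> U})" using b by simp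
    moreover have "openin Y U \<longleftrightarrow> U \<subseteq> orbit_of Gam ` topspace Bd \<and> openin Bd {z \<in> topspace Bd. orbit_of Gam z \<in> U}"
      unfolding building_quotient_def by (rule openin_quotient_topology)
    ultimately show ?thesis unfolding a by (simp only:)
  qed
qed

subsection \<open>Balls of chambers\<close>

definition near :: "nat list set \<Rightarrow> nat list set set" where
  "near h = {h' \<in> carrier W. \<exists>x\<in>P. bp h x = bp h' x}"

text \<open>
  Chambers that can be reached from \<open>R\<close> by a chain of \<open>n\<close> steps between chambers with a common
  point.
\<close>

primrec chamber_ball :: "nat list set set \<Rightarrow> nat \<Rightarrow> nat list set set" where
  "chamber_ball R 0 = R"
| "chamber_ball R (Suc n) = (\<Union>h\<in>chamber_ball R n. near h)"

lemma near_translate: "h \<in> carrier W \<Longrightarrow> x \<in> P \<Longrightarrow> l \<in> L x \<Longrightarrow> h \<otimes>\<^bsub>W\<^esub> l \<in> near h"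
proof -
  assume h: "h \<in> carrier W" and x: "x \<in> P" and l: "l \<in> L x"
  have "h \<otimes>\<^bsub>W\<^esub> l \<in> carrier W" using local_group_sub[OF x] l h by auto
  moreover from this have "bp h x = bp (h \<otimes>\<^bsub>W\<^esub> l) x" using bp_eq_iff[OF h _ x] l by auto
  ultimately show "h \<otimes>\<^bsub>W\<^esub> l \<in> near h" using x by (auto simp: near_def)
qed

text \<open>
  There are only finitely many cells of the polygon, and the local group of each is finite.
\<close>

lemma finite_near:
  assumes "h \<in> carrier W"
  shows "finite (near h)"
proof -
  have "L ` P \<subseteq> (\<lambda>J. cl ` {u. set u \<subseteq> J}) ` Pow {..<p}"
  proof (rule image_subsetI)
    fix x assume "x \<in> P"
    then show "L x \<in> (\<lambda>J. cl ` {u. set u \<subseteq> J}) ` Pow {..<p}"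
      using local_group_eq sides_lt by (intro image_eqI[of _ _ "sides p x"]) auto
  qed
  then have "finite (L ` P)" by (rule finite_subset) (intro finite_imageI finite_Pow_iff[THEN iffD2] finite_lessThan)
  moreover have "finite M" if "M \<in> L ` P" for M using that finite_local_group by blast
  ultimately have "finite (\<Union>x\<in>P. L x)" by (rule finite_Union)
  moreover have "near h \<subseteq> (\<lambda>l. h \<otimes>\<^bsub>W\<^esub> l) ` (\<Union>x\<in>P. L x)"
  proof
    fix h' assume "h' \<in> near h"
    then obtain x where x: "h' \<in> carrier W" "x \<in> P" "bp h x = bp h' x" by (auto simp: near_def)
    then obtain l where "l \<in> L x" "h' = h \<otimes>\<^bsub>W\<^esub> l" using bp_eq_iff[OF assms x(1,2)] by auto
    then show "h' \<in> (\<lambda>l. h \<otimes>\<^bsub>W\<^esub> l) ` (\<Union>x\<in>P. L x)" using x(2) by (intro image_eqI[of _ _ l]) auto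
  qed
  ultimately show ?thesis using finite_subset finite_imageI by blast
qed

lemma chamber_ball_carrier: "R \<subseteq> carrier W \<Longrightarrow> chamber_ball R n \<subseteq> carrier W"
  by (induction n) (auto simp: near_def)

lemma finite_chamber_ball: "finite R \<Longrightarrow> R \<subseteq> carrier W \<Longrightarrow> finite (chamber_ball R n)"
proof (induction n)
  case (Suc n)
  then show ?case using finite_near chamber_ball_carrier[of R n] by auto
qed simp

lemma near_refl: "h \<in> carrier W \<Longrightarrow> h \<in> near h"
  unfolding near_def using zero_in by auto

lemma chamber_ball_mono:
  assumes "R \<subseteq> carrier W" "m \<le> n"
  shows "chamber_ball R m \<subseteq> chamber_ball R n"
  using assms(2)
proof (induction n rule: dec_induct)
  case (step n)
  then show ?case using near_refl chamber_ball_carrier[OF assms(1), of n] by auto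
qed simp

abbreviation "Ball1 \<equiv> chamber_ball {\<one>\<^bsub>W\<^esub>}"

lemma Ball1_carrier: "Ball1 n \<subseteq> carrier W"
  by (rule chamber_ball_carrier) auto

lemma Ball1_exhaust:
  assumes "h \<in> carrier W"
  obtains n where "h \<in> Ball1 n"
proof -
  obtain u where "set u \<subseteq> {..<p}" "h = cl u" using assms by (auto simp: W_carrier)
  moreover have "set u \<subseteq> {..<p} \<Longrightarrow> \<exists>n. cl u \<in> Ball1 n" for u
  proof (induction u rule: rev_induct)
    case Nil
    then show ?case using W_one by (intro exI[of _ 0]) simp
  next
    case (snoc i u)
    then obtain n where n: "cl u \<in> Ball1 n" by auto
    have i: "i < p" using snoc by auto
    have "cl [i] \<in> L (side_arc i 0)"
      unfolding local_group_eq[OF side_midpoint(1)[OF i]] side_midpoint(2)[OF i] by (auto intro!: image_eqI[of _ _ "[i]"])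
    then have "cl u \<otimes>\<^bsub>W\<^esub> cl [i] \<in> near (cl u)"
      using snoc cl_closed side_midpoint(1)[OF i] by (intro near_translate) auto
    then show ?case using n by (intro exI[of _ "Suc n"]) (auto simp: cl_mult)
  qed
  ultimately show ?thesis using that by blast
qed

subsection \<open>The compact-open topology\<close>

lemma openin_P_I:
  assumes "S \<subseteq> P" "\<And>x. x \<in> S \<Longrightarrow> \<exists>N. open N \<and> x \<in> N \<and> N \<inter> P \<subseteq> S"
  shows "openin (top_of_set P) S"
  unfolding openin_subopen[of _ S]
proof
  fix x assume "x \<in> S"
  then obtain N where "open N" "x \<in> N" "N \<inter> P \<subseteq> S" using assms(2) by blast
  then show "\<exists>T. openin (top_of_set P) T \<and> x \<in> T \<and> T \<subseteq> S"
    using assms(1) \<open>x \<in> S\<close> by (intro exI[of _ "N \<inter> P"]) (auto simp: openin_open Int_commute)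
qed

definition open_chamber :: "nat list set \<Rightarrow> building_point set" where
  "open_chamber w = {bp w y | y. y \<in> P \<and> sides p y = {}}"

lemma bp_open_chamber:
  assumes "h \<in> carrier W" "w \<in> carrier W"
  shows "bp h x \<in> open_chamber w \<longleftrightarrow> x \<in> P \<and> sides p x = {} \<and> h = w"
proof
  assume "bp h x \<in> open_chamber w"
  then obtain y where y: "y \<in> P" "sides p y = {}" "bp w y = bp h x" by (auto simp: open_chamber_def)
  then have "y = x" "w = h" using bp_interior_eq[OF assms(2,1) y(1,2)] by simp_all
  then show "x \<in> P \<and> sides p x = {} \<and> h = w" using y by simp
qed (auto simp: open_chamber_def)

lemma openin_open_chamber:
  assumes "w \<in> carrier W"
  shows "openin Bd (open_chamber w)"
  unfolding openin_building
proof (intro conjI ballI)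
  show "open_chamber w \<subseteq> topspace Bd" using bp_in[OF assms] by (auto simp: open_chamber_def)
  fix h assume h: "h \<in> carrier W"
  have "{x \<in> P. bp h x \<in> open_chamber w} = (if h = w then {x \<in> P. sides p x = {}} else {})"
    using bp_open_chamber[OF h assms] by auto
  moreover have "openin (top_of_set P) {x \<in> P. sides p x = {}}"
    using open_interior_polygon by (intro open_subset) auto
  ultimately show "openin (top_of_set P) {x \<in> P. bp h x \<in> open_chamber w}" by simp
qed

text \<open>
  The automorphism maps chamber \<open>h\<close> to chamber \<open>im_chamber \<phi> h\<close> through the polygon
  isometry \<open>im_iso \<phi> h\<close>. The chamber is unique because it contains the image of the centre.
\<close>

definition im_chamber :: "(building_point \<Rightarrow> building_point) \<Rightarrow> nat list set \<Rightarrow> nat list set" where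
  "im_chamber \<phi> h = (SOME w. w \<in> carrier W \<and> (\<exists>\<sigma>. polygon_isometry p \<sigma> \<and> (\<forall>x\<in>P. \<phi> (bp h x) = bp w (\<sigma> x))))"

definition im_iso :: "(building_point \<Rightarrow> building_point) \<Rightarrow> nat list set \<Rightarrow> complex \<Rightarrow> complex" where
  "im_iso \<phi> h = (SOME \<sigma>. polygon_isometry p \<sigma> \<and> (\<forall>x\<in>P. \<phi> (bp h x) = bp (im_chamber \<phi> h) (\<sigma> x)))"

lemma im_chamber:
  assumes "\<phi> \<in> Auts" "h \<in> carrier W"
  shows "im_chamber \<phi> h \<in> carrier W" "polygon_isometry p (im_iso \<phi> h)"
    "x \<in> P \<Longrightarrow> \<phi> (bp h x) = bp (im_chamber \<phi> h) (im_iso \<phi> h x)"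
proof -
  have "\<exists>w. w \<in> carrier W \<and> (\<exists>\<sigma>. polygon_isometry p \<sigma> \<and> (\<forall>x\<in>P. \<phi> (bp h x) = bp w (\<sigma> x)))"
    using Auts_chamber[OF assms] by metis
  note 1 = someI_ex[OF this, folded im_chamber_def]
  note 2 = someI_ex[OF conjunct2[OF 1], folded im_iso_def]
  show "im_chamber \<phi> h \<in> carrier W" "polygon_isometry p (im_iso \<phi> h)"
    "x \<in> P \<Longrightarrow> \<phi> (bp h x) = bp (im_chamber \<phi> h) (im_iso \<phi> h x)"
    using 1 2 by blast+
qed

lemma im_centre:
  assumes "\<phi> \<in> Auts" "h \<in> carrier W"
  shows "\<phi> (bp h 0) = bp (im_chamber \<phi> h) 0"
  using im_chamber[OF assms] isometry_zero zero_in by metis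

lemma im_chamber_iff:
  assumes "\<phi> \<in> Auts" "h \<in> carrier W" "w \<in> carrier W"
  shows "\<phi> (bp h 0) \<in> open_chamber w \<longleftrightarrow> im_chamber \<phi> h = w"
  using im_centre[OF assms(1,2)] bp_open_chamber[OF im_chamber(1)[OF assms(1,2)] assms(3)] zero_in by simp

lemma topspace_AutT: "topspace AutT = Auts"
proof -
  have "Auts \<in> {{\<phi> \<in> Auts. \<phi> ` K \<subseteq> U} | K U. compactin Bd K \<and> openin Bd U}"
    by (intro CollectI exI[of _ "{}"]) auto
  then show ?thesis unfolding Aut_topology_def compact_open_topology_def topology_generated_by_topspace
    by (intro antisym Sup_least Sup_upper) auto
qed

lemma openin_AutT_I: "compactin Bd K \<Longrightarrow> openin Bd U \<Longrightarrow> openin AutT {\<phi> \<in> Auts. \<phi> ` K \<subseteq> U}"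
  unfolding Aut_topology_def compact_open_topology_def by (rule topology_generated_by_Basis) blast

lemma openin_AutT_point:
  "z \<in> topspace Bd \<Longrightarrow> openin Bd U \<Longrightarrow> openin AutT {\<phi> \<in> Auts. \<phi> z \<in> U}"
  using openin_AutT_I[of "{z}" U] by simp

definition agree :: "nat list set set \<Rightarrow> (building_point \<Rightarrow> building_point) \<Rightarrow> (building_point \<Rightarrow> building_point) set" where
  "agree F \<alpha> = {\<phi> \<in> Auts. \<forall>h\<in>F. \<forall>x\<in>P. \<phi> (bp h x) = \<alpha> (bp h x)}"

text \<open>
  An automorphism close to \<open>\<alpha>\<close> maps the centre of the chamber \<open>h\<close> into the same open
  chamber as \<open>\<alpha>\<close>, and the vertices of the chamber to points that are no vertices other
  than those prescribed by \<open>\<alpha>\<close>. As vertices go to vertices, it agrees with \<open>\<alpha>\<close> on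
  the chamber.
\<close>

lemma openin_agree_single:
  assumes "\<alpha> \<in> Auts" "h \<in> carrier W"
  shows "openin AutT (agree {h} \<alpha>)"
proof -
  define V where "V = vert ` {..<p}"
  define U where "U i = {z \<in> topspace Bd. snd z \<notin> V - {im_iso \<alpha> h (vert i)}}" for i
  have U: "openin Bd (U i)" for i
    unfolding openin_building
  proof (intro conjI ballI)
    fix k assume "k \<in> carrier W"
    then have "{x \<in> P. bp k x \<in> U i} = P \<inter> - (V - {im_iso \<alpha> h (vert i)})"
      using bp_in by (auto simp: U_def bpoint_def)
    moreover have "open (- (V - {im_iso \<alpha> h (vert i)}))"
      by (intro open_Compl finite_imp_closed) (simp add: V_def)
    ultimately show "openin (top_of_set P) {x \<in> P. bp k x \<in> U i}" by (metis openin_open)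
  qed (auto simp: U_def)
  let ?T = "{\<phi> \<in> Auts. \<phi> (bp h 0) \<in> open_chamber (im_chamber \<alpha> h)}"
  let ?R = "\<lambda>i. {\<phi> \<in> Auts. \<phi> (bp h (vert i)) \<in> U i}"
  note ia = im_chamber[OF assms]
  have eq: "agree {h} \<alpha> = ?T \<inter> ((\<Inter>i\<in>{..<p}. ?R i) \<inter> topspace AutT)"
  proof
    show "agree {h} \<alpha> \<subseteq> ?T \<inter> ((\<Inter>i\<in>{..<p}. ?R i) \<inter> topspace AutT)"
    proof
      fix \<phi> assume "\<phi> \<in> agree {h} \<alpha>"
      then have \<phi>: "\<phi> \<in> Auts" "\<And>x. x \<in> P \<Longrightarrow> \<phi> (bp h x) = \<alpha> (bp h x)" by (auto simp: agree_def)
      have "\<phi> (bp h 0) \<in> open_chamber (im_chamber \<alpha> h)"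
        unfolding \<phi>(2)[OF zero_in(1)] using im_chamber_iff[OF assms ia(1)] by simp
      moreover have "\<phi> (bp h (vert i)) \<in> U i" for i
        unfolding \<phi>(2)[OF vert_in] ia(3)[OF vert_in] U_def
        using bp_in[OF ia(1) isometry_ratio(1)[OF ia(2) vert_in vert_in]] by (simp add: bpoint_def)
      ultimately show "\<phi> \<in> ?T \<inter> ((\<Inter>i\<in>{..<p}. ?R i) \<inter> topspace AutT)"
        using \<phi>(1) by (simp add: topspace_AutT)
    qed
    show "?T \<inter> ((\<Inter>i\<in>{..<p}. ?R i) \<inter> topspace AutT) \<subseteq> agree {h} \<alpha>"
    proof
      fix \<phi> assume a: "\<phi> \<in> ?T \<inter> ((\<Inter>i\<in>{..<p}. ?R i) \<inter> topspace AutT)"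
      then have \<phi>: "\<phi> \<in> Auts" by auto
      note ip = im_chamber[OF \<phi> assms(2)]
      have c: "im_chamber \<phi> h = im_chamber \<alpha> h" using a im_chamber_iff[OF \<phi> assms(2) ia(1)] by auto
      have "im_iso \<phi> h (vert i) = im_iso \<alpha> h (vert i)" if "i < p" for i
      proof -
        have "\<phi> (bp h (vert i)) \<in> U i" using a that by auto
        then have "im_iso \<phi> h (vert i) \<notin> V - {im_iso \<alpha> h (vert i)}"
          unfolding ip(3)[OF vert_in] U_def by (simp add: bpoint_def)
        then show ?thesis using isometry_vert[OF ip(2) that] by (simp add: V_def)
      qed
      then have "im_iso \<phi> h x = im_iso \<alpha> h x" if "x \<in> P" for x
        using isometry_eqI[OF ip(2) ia(2)] that by blast
      then have "\<phi> (bp h x) = \<alpha> (bp h x)" if "x \<in> P" for x using ip(3) ia(3) c that by simp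
      then show "\<phi> \<in> agree {h} \<alpha>" using \<phi> by (simp add: agree_def)
    qed
  qed
  show ?thesis
    unfolding eq using U openin_open_chamber[OF ia(1)] bp_in[OF assms(2)] zero_in vert_in
    by (intro openin_Int openin_INT openin_AutT_point) auto
qed

lemma openin_agree:
  assumes "\<alpha> \<in> Auts" "finite F" "F \<subseteq> carrier W"
  shows "openin AutT (agree F \<alpha>)"
proof -
  have "agree F \<alpha> = (\<Inter>h\<in>F. agree {h} \<alpha>) \<inter> topspace AutT"
    unfolding topspace_AutT by (auto simp: agree_def)
  then show ?thesis
    using openin_INT[OF assms(2), of AutT "\<lambda>h. agree {h} \<alpha>"] openin_agree_single[OF assms(1)] assms(3) by auto
qed

lemma agree_coset:
  assumes "\<alpha> \<in> Auts" "F \<subseteq> carrier W"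
  shows "agree F \<alpha> = \<alpha> <#\<^bsub>AutG\<^esub> agree F \<one>\<^bsub>AutG\<^esub>"
proof -
  interpret AG: group AutG by (rule AutG_group)
  have one: "\<one>\<^bsub>AutG\<^esub> z = z" if "z \<in> topspace Bd" for z using auto_one[OF that] by (simp add: AutG_one)
  show ?thesis
  proof
    show "\<alpha> <#\<^bsub>AutG\<^esub> agree F \<one>\<^bsub>AutG\<^esub> \<subseteq> agree F \<alpha>"
    proof
      fix \<phi> assume "\<phi> \<in> \<alpha> <#\<^bsub>AutG\<^esub> agree F \<one>\<^bsub>AutG\<^esub>"
      then obtain \<psi> where p: "\<psi> \<in> agree F \<one>\<^bsub>AutG\<^esub>" "\<phi> = \<alpha> \<otimes>\<^bsub>AutG\<^esub> \<psi>" by (auto simp: l_coset_def)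
      then have a: "\<psi> \<in> Auts" by (simp add: agree_def)
      have "\<phi> \<in> Auts" using AG.m_closed[of \<alpha> \<psi>] assms(1) a p(2) by (simp add: AutG_carrier)
      moreover have "\<phi> (bp h x) = \<alpha> (bp h x)" if "h \<in> F" "x \<in> P" for h x
        using AutG_mult[OF assms(1) a bp_in] that assms(2) p one[OF bp_in] by (auto simp: agree_def)
      ultimately show "\<phi> \<in> agree F \<alpha>" by (simp add: agree_def)
    qed
    show "agree F \<alpha> \<subseteq> \<alpha> <#\<^bsub>AutG\<^esub> agree F \<one>\<^bsub>AutG\<^esub>"
    proof
      fix \<phi> assume f: "\<phi> \<in> agree F \<alpha>"
      then have a: "\<phi> \<in> carrier AutG" "\<alpha> \<in> carrier AutG" using assms by (simp_all add: agree_def AutG_carrier)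
      let ?\<psi> = "inv\<^bsub>AutG\<^esub> \<alpha> \<otimes>\<^bsub>AutG\<^esub> \<phi>"
      have c: "?\<psi> \<in> carrier AutG" "inv\<^bsub>AutG\<^esub> \<alpha> \<in> carrier AutG" using a by simp_all
      have e: "\<phi> = \<alpha> \<otimes>\<^bsub>AutG\<^esub> ?\<psi>" using a by (simp add: AG.m_assoc[symmetric])
      have "?\<psi> (bp h x) = \<one>\<^bsub>AutG\<^esub> (bp h x)" if "h \<in> F" "x \<in> P" for h x
      proof -
        have z: "bp h x \<in> topspace Bd" using that assms bp_in by auto
        have "?\<psi> (bp h x) = (inv\<^bsub>AutG\<^esub> \<alpha>) (\<phi> (bp h x))"
          using AutG_mult[OF _ _ z] c a by (simp add: AutG_carrier)
        also have "\<phi> (bp h x) = \<alpha> (bp h x)" using f that by (simp add: agree_def)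
        also have "(inv\<^bsub>AutG\<^esub> \<alpha>) (\<alpha> (bp h x)) = (inv\<^bsub>AutG\<^esub> \<alpha> \<otimes>\<^bsub>AutG\<^esub> \<alpha>) (bp h x)"
          by (rule AutG_mult[symmetric, OF _ _ z]) (use c a in \<open>simp_all add: AutG_carrier\<close>)
        finally show ?thesis using a by simp
      qed
      then have "?\<psi> \<in> agree F \<one>\<^bsub>AutG\<^esub>" using c by (simp add: agree_def AutG_carrier)
      then show "\<phi> \<in> \<alpha> <#\<^bsub>AutG\<^esub> agree F \<one>\<^bsub>AutG\<^esub>" using e by (auto simp: l_coset_def)
    qed
  qed
qed

subsection \<open>Compact sets meet finitely many chambers\<close>

text \<open>
  The points all of whose chambers belong to a given ball; they form an open set, and these sets
  exhaust the building.
\<close>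

definition ball_region :: "nat \<Rightarrow> building_point set" where
  "ball_region n = {z \<in> topspace Bd. \<forall>h\<in>carrier W. \<forall>x\<in>P. z = bp h x \<longrightarrow> h \<in> Ball1 n}"

lemma ball_region_slice:
  assumes "h \<in> carrier W" "x \<in> P"
  shows "bp h x \<in> ball_region n \<longleftrightarrow> (\<forall>l\<in>L x. h \<otimes>\<^bsub>W\<^esub> l \<in> Ball1 n)"
  unfolding ball_region_def using bp_in[OF assms] bp_eq_iff[OF assms(1) _ assms(2)] local_group_sub[OF assms(2)] assms
  by (auto; blast)

lemma openin_ball_region: "openin Bd (ball_region n)"
  unfolding openin_building
proof (intro conjI ballI)
  show "ball_region n \<subseteq> topspace Bd" by (auto simp: ball_region_def)
  fix h assume h: "h \<in> carrier W"
  show "openin (top_of_set P) {x \<in> P. bp h x \<in> ball_region n}"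
  proof (rule openin_P_I)
    fix x assume "x \<in> {x \<in> P. bp h x \<in> ball_region n}"
    then have x: "x \<in> P" "\<And>l. l \<in> L x \<Longrightarrow> h \<otimes>\<^bsub>W\<^esub> l \<in> Ball1 n" using ball_region_slice[OF h] by auto
    obtain N where N: "open N" "x \<in> N" "\<And>y. y \<in> N \<Longrightarrow> sides p y \<subseteq> sides p x"
      by (rule sides_upper_semicontinuous[of x]) metis
    have LL: "L y \<subseteq> L x" if "y \<in> N" "y \<in> P" for y
      using N(3)[OF that(1)] unfolding local_group_eq[OF that(2)] local_group_eq[OF x(1)]
      by (intro image_mono Collect_mono) auto
    show "\<exists>N. open N \<and> x \<in> N \<and> N \<inter> P \<subseteq> {x \<in> P. bp h x \<in> ball_region n}"
    proof (intro exI[of _ N] conjI N(1,2) subsetI)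
      fix y assume y: "y \<in> N \<inter> P"
      then have "\<forall>l\<in>L y. h \<otimes>\<^bsub>W\<^esub> l \<in> Ball1 n" using x(2) LL[of y] by auto
      then show "y \<in> {x \<in> P. bp h x \<in> ball_region n}" using y ball_region_slice[OF h, of y n] by simp
    qed
  qed auto
qed

lemma ball_region_mono: "m \<le> n \<Longrightarrow> ball_region m \<subseteq> ball_region n"
  using chamber_ball_mono[of "{\<one>\<^bsub>W\<^esub>}" m n] by (auto simp: ball_region_def)

lemma compactin_ball_region:
  assumes "compactin Bd K"
  obtains n where "K \<subseteq> ball_region n"
proof -
  have "K \<subseteq> \<Union>(range ball_region)"
  proof
    fix z assume "z \<in> K"
    then have "z \<in> topspace Bd" using compactin_subset_topspace[OF assms] by auto
    then obtain h x where hx: "h \<in> carrier W" "x \<in> P" "z = bp h x" by (auto simp: topspace_building)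
    obtain n where "h \<in> Ball1 n" using Ball1_exhaust[OF hx(1)] .
    then have "z \<in> ball_region (Suc n)" unfolding hx(3) ball_region_slice[OF hx(1,2)]
      using near_translate[OF hx(1,2)] by auto
    then show "z \<in> \<Union>(range ball_region)" by blast
  qed
  then obtain \<F> where F: "finite \<F>" "\<F> \<subseteq> range ball_region" "K \<subseteq> \<Union>\<F>"
    using assms openin_ball_region unfolding compactin_def by (metis (no_types, lifting) rangeE)
  then obtain I where I: "finite I" "\<F> = ball_region ` I" by (meson finite_subset_image)
  have "K \<subseteq> ball_region (Max (insert 0 I))"
    using F(3) I ball_region_mono[OF Max_ge[of "insert 0 I"]] by (auto; blast)
  then show ?thesis by (rule that)
qed

text \<open>
  A compact set lies in finitely many chambers, so the pointwise stabilisers of balls form a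
  neighbourhood basis of the identity.
\<close>

lemma agree_neighbourhood:
  assumes "openin AutT U" "\<one>\<^bsub>AutG\<^esub> \<in> U"
  shows "\<exists>n. agree (Ball1 n) \<one>\<^bsub>AutG\<^esub> \<subseteq> U"
proof -
  have one: "\<one>\<^bsub>AutG\<^esub> z = z" if "z \<in> topspace Bd" for z using auto_one[OF that] by (simp add: AutG_one)
  have mono: "agree (Ball1 n) \<one>\<^bsub>AutG\<^esub> \<subseteq> agree (Ball1 m) \<one>\<^bsub>AutG\<^esub>" if "m \<le> n" for m n
    using chamber_ball_mono[OF _ that, of "{\<one>\<^bsub>W\<^esub>}"] by (auto simp: agree_def)
  have "generate_topology_on {{\<phi> \<in> Auts. \<phi> ` K \<subseteq> U} | K U. compactin Bd K \<and> openin Bd U} U"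
    using assms(1) unfolding Aut_topology_def compact_open_topology_def openin_topology_generated_by_iff .
  then have "\<one>\<^bsub>AutG\<^esub> \<in> U \<longrightarrow> (\<exists>n. agree (Ball1 n) \<one>\<^bsub>AutG\<^esub> \<subseteq> U)"
  proof (induction rule: generate_topology_on.induct)
    case (Int S T)
    show ?case
    proof
      assume "\<one>\<^bsub>AutG\<^esub> \<in> S \<inter> T"
      then obtain m n where "agree (Ball1 m) \<one>\<^bsub>AutG\<^esub> \<subseteq> S" "agree (Ball1 n) \<one>\<^bsub>AutG\<^esub> \<subseteq> T"
        using Int by auto
      then show "\<exists>n. agree (Ball1 n) \<one>\<^bsub>AutG\<^esub> \<subseteq> S \<inter> T"
        using mono[of m "max m n"] mono[of n "max m n"] by (intro exI[of _ "max m n"]) auto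
    qed
  next
    case (Basis S)
    then obtain K V where S: "S = {\<phi> \<in> Auts. \<phi> ` K \<subseteq> V}" "compactin Bd K" "openin Bd V" by blast
    obtain n where n: "K \<subseteq> ball_region n" using compactin_ball_region[OF S(2)] .
    show ?case
    proof (intro impI exI[of _ n] subsetI)
      fix \<phi> assume o: "\<one>\<^bsub>AutG\<^esub> \<in> S" and f: "\<phi> \<in> agree (Ball1 n) \<one>\<^bsub>AutG\<^esub>"
      have "\<phi> z \<in> V" if z: "z \<in> K" for z
      proof -
        have zr: "z \<in> ball_region n" using n z by auto
        then obtain h x where hx: "h \<in> carrier W" "x \<in> P" "z = bp h x"
          by (auto simp: ball_region_def topspace_building)
        then have "h \<in> Ball1 n" using zr by (auto simp: ball_region_def)
        then have "\<phi> z = z" using f hx one[OF bp_in[OF hx(1,2)]] by (auto simp: agree_def)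
        moreover have "z \<in> V" using o S(1) z one[of z] hx bp_in by auto
        ultimately show ?thesis by simp
      qed
      then show "\<phi> \<in> S" using f S(1) by (auto simp: agree_def)
    qed
  next
    case (UN K)
    show ?case
    proof
      assume "\<one>\<^bsub>AutG\<^esub> \<in> \<Union>K"
      then obtain S where "S \<in> K" "\<one>\<^bsub>AutG\<^esub> \<in> S" by blast
      then obtain n where "agree (Ball1 n) \<one>\<^bsub>AutG\<^esub> \<subseteq> S" using UN.IH by blast
      then show "\<exists>n. agree (Ball1 n) \<one>\<^bsub>AutG\<^esub> \<subseteq> \<Union>K" using \<open>S \<in> K\<close> by blast
    qed
  qed simp
  then show ?thesis using assms(2) by blast
qed

subsection \<open>Finite covolume\<close>

lemma im_chamber_ball:
  assumes "\<phi> \<in> Auts" "im_chamber \<phi> \<one>\<^bsub>W\<^esub> \<in> R" "R \<subseteq> carrier W" "h \<in> Ball1 n"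
  shows "im_chamber \<phi> h \<in> chamber_ball R n"
  using assms(4)
proof (induction n arbitrary: h)
  case 0
  then show ?case using assms by simp
next
  case (Suc n)
  then obtain k where k: "k \<in> Ball1 n" "h \<in> near k" by auto
  have kW: "k \<in> carrier W" using k Ball1_carrier by auto
  obtain x where x: "h \<in> carrier W" "x \<in> P" "bp k x = bp h x" using k(2) by (auto simp: near_def)
  note ik = im_chamber[OF assms(1) kW] and ih = im_chamber[OF assms(1) x(1)]
  have "bp (im_chamber \<phi> k) (im_iso \<phi> k x) = bp (im_chamber \<phi> h) (im_iso \<phi> h x)"
    using ik(3)[OF x(2)] ih(3)[OF x(2)] x(3) by simp
  moreover from this have "im_iso \<phi> k x = im_iso \<phi> h x" by (simp add: bpoint_def)
  ultimately have "im_chamber \<phi> h \<in> near (im_chamber \<phi> k)"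
    using ih(1) isometry_ratio(1)[OF ih(2) x(2) x(2)] by (auto simp: near_def)
  then show ?case using Suc.IH[OF k(1)] by auto
qed

text \<open>
  Once the base chamber goes to a chamber of \<open>R\<close>, the ball of radius \<open>n\<close> about it goes into the
  ball of radius \<open>n\<close> about \<open>R\<close>. So there are only finitely many possibilities for the
  restriction of the automorphism to this ball.
\<close>

lemma finite_agreement_cover:
  assumes "finite R" "R \<subseteq> carrier W"
  defines "D \<equiv> {\<phi> \<in> Auts. im_chamber \<phi> \<one>\<^bsub>W\<^esub> \<in> R}"
  obtains C where "finite C" "C \<subseteq> D" "D \<subseteq> (\<Union>\<alpha>\<in>C. agree (Ball1 n) \<alpha>)"
proof -
  define code where "code \<phi> = restrict (\<lambda>h. (im_chamber \<phi> h, restrict (im_iso \<phi> h) P)) (Ball1 n)" for \<phi>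
  let ?S = "{restrict \<sigma> P | \<sigma>. polygon_isometry p \<sigma>}"
  have "code ` D \<subseteq> Ball1 n \<rightarrow>\<^sub>E (chamber_ball R n \<times> ?S)"
  proof
    fix c assume "c \<in> code ` D"
    then obtain \<phi> where \<phi>: "\<phi> \<in> Auts" "im_chamber \<phi> \<one>\<^bsub>W\<^esub> \<in> R" "c = code \<phi>" by (auto simp: D_def)
    have "(im_chamber \<phi> h, restrict (im_iso \<phi> h) P) \<in> chamber_ball R n \<times> ?S" if "h \<in> Ball1 n" for h
      using im_chamber_ball[OF \<phi>(1,2) assms(2) that] im_chamber(2)[OF \<phi>(1), of h] Ball1_carrier that by auto
    then show "c \<in> Ball1 n \<rightarrow>\<^sub>E (chamber_ball R n \<times> ?S)" unfolding \<phi>(3) code_def by (intro restrict_PiE_iff[THEN iffD2] ballI)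
  qed
  moreover have "finite (Ball1 n \<rightarrow>\<^sub>E (chamber_ball R n \<times> ?S))"
    using finite_isometries finite_chamber_ball[OF assms(1,2)] finite_chamber_ball[of "{\<one>\<^bsub>W\<^esub>}"]
    by (intro finite_PiE finite_cartesian_product) auto
  ultimately have "finite (code ` D)" by (rule finite_subset)
  then obtain C where C: "C \<subseteq> D" "finite C" "code ` D = code ` C"
    using finite_subset_image[of "code ` D" code D] by auto
  have "D \<subseteq> (\<Union>\<alpha>\<in>C. agree (Ball1 n) \<alpha>)"
  proof
    fix \<phi> assume f: "\<phi> \<in> D"
    then obtain \<alpha> where a: "\<alpha> \<in> C" "code \<phi> = code \<alpha>" using C(3) by (metis imageE imageI)
    have A: "\<phi> \<in> Auts" "\<alpha> \<in> Auts" using f a C by (auto simp: D_def)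
    have "\<phi> (bp h x) = \<alpha> (bp h x)" if h: "h \<in> Ball1 n" and x: "x \<in> P" for h x
    proof -
      have hW: "h \<in> carrier W" using h Ball1_carrier by auto
      have "(im_chamber \<phi> h, restrict (im_iso \<phi> h) P) = (im_chamber \<alpha> h, restrict (im_iso \<alpha> h) P)"
        using fun_cong[OF a(2), of h] h by (simp add: code_def)
      then have "im_chamber \<phi> h = im_chamber \<alpha> h" "im_iso \<phi> h x = im_iso \<alpha> h x"
        using x by (auto dest: fun_cong[of _ _ x])
      then show ?thesis using im_chamber(3)[OF A(1) hW x] im_chamber(3)[OF A(2) hW x] by simp
    qed
    then have "\<phi> \<in> agree (Ball1 n) \<alpha>" using A by (simp add: agree_def)
    then show "\<phi> \<in> (\<Union>\<alpha>\<in>C. agree (Ball1 n) \<alpha>)" using a by blast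
  qed
  then show ?thesis using that C by blast
qed

text \<open>
  Some stabiliser of a ball has finite measure, since it lies in a neighbourhood of finite
  measure. Its cosets have the same measure, and finitely many of them cover the set.
\<close>

lemma Haar_measure_finite:
  assumes "left_Haar_measure AutG AutT \<mu>" "finite R" "R \<subseteq> carrier W"
  defines "D \<equiv> {\<phi> \<in> Auts. im_chamber \<phi> \<one>\<^bsub>W\<^esub> \<in> R}"
  shows "D \<in> sets \<mu>" "emeasure \<mu> D < \<infinity>"
proof -
  interpret AG: group AutG by (rule AutG_group)
  have sets: "U \<in> sets \<mu>" if "openin AutT U" for U
    using assms(1) that unfolding left_Haar_measure_def by (auto intro: sigma_sets.Basic)
  have "D = (\<Union>r\<in>R. {\<phi> \<in> Auts. \<phi> (bp \<one>\<^bsub>W\<^esub> 0) \<in> open_chamber r})"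
    unfolding D_def using im_chamber_iff[OF _ W.one_closed] assms(3) by auto
  moreover have "openin AutT (\<Union>r\<in>R. {\<phi> \<in> Auts. \<phi> (bp \<one>\<^bsub>W\<^esub> 0) \<in> open_chamber r})"
    using openin_open_chamber assms(3) bp_in[OF W.one_closed zero_in(1)]
    by (intro openin_Union) (auto intro!: openin_AutT_point)
  ultimately show D: "D \<in> sets \<mu>" using sets by simp
  obtain U where U: "openin AutT U" "\<one>\<^bsub>AutG\<^esub> \<in> U" "emeasure \<mu> U < \<infinity>"
    using assms(1) AG.one_closed unfolding left_Haar_measure_def by blast
  obtain n where n: "agree (Ball1 n) \<one>\<^bsub>AutG\<^esub> \<subseteq> U" using agree_neighbourhood[OF U(1,2)] by blast
  have fin: "finite (Ball1 n)" by (rule finite_chamber_ball) auto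
  have ag: "agree (Ball1 n) \<alpha> \<in> sets \<mu>" if "\<alpha> \<in> Auts" for \<alpha>
    using openin_agree[OF that fin Ball1_carrier] sets by blast
  have one: "\<one>\<^bsub>AutG\<^esub> \<in> Auts" using AG.one_closed by (simp add: AutG_carrier)
  have e1: "emeasure \<mu> (agree (Ball1 n) \<one>\<^bsub>AutG\<^esub>) < \<infinity>"
    using emeasure_mono[OF n sets[OF U(1)]] U(3) by (rule le_less_trans)
  have ea: "emeasure \<mu> (agree (Ball1 n) \<alpha>) < \<infinity>" if "\<alpha> \<in> Auts" for \<alpha>
  proof -
    have "emeasure \<mu> (\<alpha> <#\<^bsub>AutG\<^esub> agree (Ball1 n) \<one>\<^bsub>AutG\<^esub>) = emeasure \<mu> (agree (Ball1 n) \<one>\<^bsub>AutG\<^esub>)"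
      using assms(1) that ag[OF one] unfolding left_Haar_measure_def by (simp add: AutG_carrier)
    then show ?thesis using e1 agree_coset[OF that Ball1_carrier] by simp
  qed
  obtain C where C: "finite C" "C \<subseteq> D" "D \<subseteq> (\<Union>\<alpha>\<in>C. agree (Ball1 n) \<alpha>)"
    by (rule finite_agreement_cover[OF assms(2,3), of n, folded D_def])
  have CA: "C \<subseteq> Auts" using C(2) by (auto simp: D_def)
  have "emeasure \<mu> D \<le> emeasure \<mu> (\<Union>\<alpha>\<in>C. agree (Ball1 n) \<alpha>)"
    using C CA ag by (intro emeasure_mono sets.finite_UN) auto
  also have "\<dots> \<le> (\<Sum>\<alpha>\<in>C. emeasure \<mu> (agree (Ball1 n) \<alpha>))"
    using C(1) CA ag by (intro emeasure_subadditive_finite) auto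
  also have "\<dots> < \<infinity>" using C(1) CA ea by (auto simp: less_top[symmetric])
  finally show "emeasure \<mu> D < \<infinity>" .
qed

lemma GamE:
  assumes "\<gamma> \<in> Gam"
  obtains h a where "h \<in> carrier W" "a \<in> A" "\<Theta> h = inv a" "\<gamma> = auto_map h a"
proof -
  obtain h a where "\<gamma> = auto_map h a" "h \<in> carrier W" "a \<in> A" "\<Theta> h \<otimes> a = \<one>"
    using assms by (auto simp: Gam_def)
  then show ?thesis using that Gam_data by simp
qed

lemma im_chamber_auto:
  assumes "h \<in> carrier W" "a \<in> A" "\<phi> \<in> Auts" "w \<in> carrier W"
  shows "im_chamber (auto_map h a \<otimes>\<^bsub>AutG\<^esub> \<phi>) w = h \<otimes>\<^bsub>W\<^esub> relabel a (im_chamber \<phi> w)"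
proof -
  interpret AG: group AutG by (rule AutG_group)
  note au = auto_in_Auts[OF assms(1,2)] and ip = im_chamber(1)[OF assms(3,4)]
  have c: "auto_map h a \<otimes>\<^bsub>AutG\<^esub> \<phi> \<in> Auts" using AG.m_closed au assms by (simp add: AutG_carrier)
  have k: "h \<otimes>\<^bsub>W\<^esub> relabel a (im_chamber \<phi> w) \<in> carrier W" using assms relabel_closed ip by simp
  have "(auto_map h a \<otimes>\<^bsub>AutG\<^esub> \<phi>) (bp w 0) = bp (h \<otimes>\<^bsub>W\<^esub> relabel a (im_chamber \<phi> w)) (iso a 0)"
    using AutG_mult[OF au assms(3) bp_in[OF assms(4) zero_in(1)]] im_centre[OF assms(3,4)]
      auto_bp[OF assms(1,2) ip zero_in(1)] by simp
  also have "iso a 0 = 0" using isometry_zero iso_polygon_isometry assms by blast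
  finally have "(auto_map h a \<otimes>\<^bsub>AutG\<^esub> \<phi>) (bp w 0) \<in> open_chamber (h \<otimes>\<^bsub>W\<^esub> relabel a (im_chamber \<phi> w))"
    using bp_open_chamber[OF k k] zero_in by simp
  then show ?thesis using im_chamber_iff[OF c assms(4) k] by simp
qed

text \<open>
  The orbits of \<open>Gam\<close> on chambers correspond to the left cosets of \<open>A\<close> in \<open>B\<close>, and the action on
  chambers is free. So the automorphisms that carry the base chamber to one of finitely many
  representatives form a strict fundamental domain.
\<close>

lemma finite_covolume_Gam: "finite_covolume AutG AutT Gam"
  unfolding finite_covolume_def
proof (intro allI impI)
  fix \<mu> assume mu: "left_Haar_measure AutG AutT \<mu>"
  define sel where "sel c = (SOME w. w \<in> carrier W \<and> \<Theta> w \<in> c)" for c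
  define R where "R = sel ` (\<lambda>b. b <# A) ` carrier B"
  have sel: "sel (b <# A) \<in> carrier W" "\<Theta> (sel (b <# A)) \<in> b <# A" if b: "b \<in> carrier B" for b
  proof -
    obtain w where w: "w \<in> carrier W" "\<Theta> w = b" using Theta_surj[OF b] by blast
    have "b \<otimes> \<one> \<in> b <# A" using A_closed(3) unfolding l_coset_def by blast
    then have "\<exists>w. w \<in> carrier W \<and> \<Theta> w \<in> b <# A" using w b by (intro exI[of _ w]) simp
    from someI_ex[OF this] show "sel (b <# A) \<in> carrier W" "\<Theta> (sel (b <# A)) \<in> b <# A" by (simp_all add: sel_def)
  qed
  have R: "finite R" "R \<subseteq> carrier W" using finite_B sel(1) by (auto simp: R_def)
  define D where "D = {\<phi> \<in> Auts. im_chamber \<phi> \<one>\<^bsub>W\<^esub> \<in> R}"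
  have "\<exists>!\<gamma>. \<gamma> \<in> Gam \<and> \<gamma> \<otimes>\<^bsub>AutG\<^esub> \<alpha> \<in> D" if al: "\<alpha> \<in> carrier AutG" for \<alpha>
  proof -
    interpret AG: group AutG by (rule AutG_group)
    have al': "\<alpha> \<in> Auts" using al by (simp add: AutG_carrier)
    define w where "w = im_chamber \<alpha> \<one>\<^bsub>W\<^esub>"
    have w: "w \<in> carrier W" "\<Theta> w \<in> carrier B" using im_chamber(1)[OF al' W.one_closed] Theta_closed by (auto simp: w_def)
    have im: "im_chamber (auto_map h a \<otimes>\<^bsub>AutG\<^esub> \<alpha>) \<one>\<^bsub>W\<^esub> = h \<otimes>\<^bsub>W\<^esub> relabel a w" if "h \<in> carrier W" "a \<in> A" for h a
      using im_chamber_auto[OF that al' W.one_closed] by (simp add: w_def)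
    have inD: "auto_map h a \<otimes>\<^bsub>AutG\<^esub> \<alpha> \<in> D \<longleftrightarrow> h \<otimes>\<^bsub>W\<^esub> relabel a w \<in> R" if "h \<in> carrier W" "a \<in> A" for h a
      using im[OF that] AG.m_closed[of "auto_map h a" \<alpha>] auto_in_Auts[OF that] al' by (simp add: D_def AutG_carrier)
    have Th: "\<Theta> (h \<otimes>\<^bsub>W\<^esub> relabel a w) = \<Theta> w \<otimes> inv a" if "h \<in> carrier W" "a \<in> A" "\<Theta> h = inv a" for h a
      using that w A_closed(1) by (simp add: Theta_mult relabel_closed Theta_relabel m_assoc inv_cancel)
    define r where "r = sel (\<Theta> w <# A)"
    have r: "r \<in> carrier W" "r \<in> R" using sel[OF w(2)] w(2) by (auto simp: r_def R_def)
    obtain a1 where a1: "a1 \<in> A" "\<Theta> r = \<Theta> w \<otimes> a1" using sel(2)[OF w(2)] by (auto simp: r_def l_coset_def)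
    define a where "a = inv a1"
    have a: "a \<in> A" "inv a = a1" "a \<in> carrier B" using a1 A_closed by (auto simp: a_def)
    define h where "h = r \<otimes>\<^bsub>W\<^esub> inv\<^bsub>W\<^esub> (relabel a w)"
    have rw: "relabel a w \<in> carrier W" using relabel_closed a w by simp
    have h: "h \<in> carrier W" "h \<otimes>\<^bsub>W\<^esub> relabel a w = r" using r rw by (simp_all add: h_def W.m_assoc)
    have "\<Theta> h = \<Theta> w \<otimes> inv a \<otimes> inv (a \<otimes> \<Theta> w \<otimes> inv a)"
      unfolding h_def using r rw a a1 w by (simp add: Theta_mult Theta_inv Theta_relabel)
    also have "\<dots> = inv a" using a(3) w(2) by (simp add: inv_mult_group m_assoc inv_cancel)
    finally have hT: "\<Theta> h = inv a" .
    show ?thesis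
    proof (rule ex1I[of _ "auto_map h a"])
      have "auto_map h a \<in> Gam" unfolding Gam_def mem_Collect_eq using h a hT Gam_data by blast
      then show "auto_map h a \<in> Gam \<and> auto_map h a \<otimes>\<^bsub>AutG\<^esub> \<alpha> \<in> D" using inD[OF h(1) a(1)] h r by simp
      fix \<gamma> assume g: "\<gamma> \<in> Gam \<and> \<gamma> \<otimes>\<^bsub>AutG\<^esub> \<alpha> \<in> D"
      then obtain k c where k: "k \<in> carrier W" "c \<in> A" "\<Theta> k = inv c" "\<gamma> = auto_map k c"
        using GamE by metis
      then have "k \<otimes>\<^bsub>W\<^esub> relabel c w \<in> R" using g inD by simp
      then obtain b where b: "b \<in> carrier B" "k \<otimes>\<^bsub>W\<^esub> relabel c w = sel (b <# A)" by (auto simp: R_def)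
      have "\<Theta> w \<otimes> inv c \<in> b <# A" using sel(2)[OF b(1)] Th[OF k(1-3)] b(2) by simp
      moreover have "\<Theta> w \<otimes> inv c \<in> \<Theta> w <# A" using k A_closed(2) by (auto simp: l_coset_def)
      ultimately have "b <# A = \<Theta> w <# A"
        using l_repr_independence[OF _ b(1) A_sub] l_repr_independence[OF _ w(2) A_sub] by metis
      then have e: "k \<otimes>\<^bsub>W\<^esub> relabel c w = r" using b(2) by (simp add: r_def)
      then have "\<Theta> w \<otimes> inv c = \<Theta> w \<otimes> inv a" using Th[OF k(1-3)] Th[OF h(1) a(1) hT] h(2) by simp
      then have "inv c = inv a"
        by (metis inv_cancel(1) inv_closed w(2) A_closed(1)[OF k(2)] a(3))
      then have "c = a" using k a A_closed(1) by (metis inv_inv)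
      then have "k \<otimes>\<^bsub>W\<^esub> relabel a w = h \<otimes>\<^bsub>W\<^esub> relabel a w" using e h(2) by simp
      moreover have "k = k \<otimes>\<^bsub>W\<^esub> relabel a w \<otimes>\<^bsub>W\<^esub> inv\<^bsub>W\<^esub> (relabel a w)"
        "h = h \<otimes>\<^bsub>W\<^esub> relabel a w \<otimes>\<^bsub>W\<^esub> inv\<^bsub>W\<^esub> (relabel a w)"
        using k(1) h(1) rw by (simp_all add: W.m_assoc)
      ultimately have "k = h" by simp
      then show "\<gamma> = auto_map h a" using k \<open>c = a\<close> by simp
    qed
  qed
  then show "\<exists>D\<in>sets \<mu>. emeasure \<mu> D < \<infinity> \<and> (\<forall>a\<in>carrier AutG. \<exists>!\<gamma>. \<gamma> \<in> Gam \<and> \<gamma> \<otimes>\<^bsub>AutG\<^esub> a \<in> D)"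
    using Haar_measure_finite[OF mu R] unfolding D_def by blast
qed

text \<open>
  An element of \<open>Gam\<close> is determined by the image of the base chamber, which is constant near it.
\<close>

lemma discrete_Gam: "subtopology AutT Gam = discrete_topology Gam"
proof -
  have G: "Gam \<subseteq> Auts" using auto_in_Auts by (auto simp: Gam_def)
  have "openin (subtopology AutT Gam) {\<gamma>}" if "\<gamma> \<in> Gam" for \<gamma>
  proof -
    let ?N = "{\<phi> \<in> Auts. \<phi> (bp \<one>\<^bsub>W\<^esub> 0) \<in> open_chamber (im_chamber \<gamma> \<one>\<^bsub>W\<^esub>)}"
    have g: "\<gamma> \<in> Auts" using that G by auto
    note iw = im_chamber(1)[OF g W.one_closed]
    have im: "im_chamber (auto_map h a) \<one>\<^bsub>W\<^esub> = h" if "h \<in> carrier W" "a \<in> A" for h a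
    proof -
      have "auto_map h a (bp \<one>\<^bsub>W\<^esub> 0) = bp h 0"
        using auto_bp[OF that W.one_closed zero_in(1)] relabel_W_one that
          isometry_zero[OF iso_polygon_isometry[OF that(2)]] by simp
      then have "auto_map h a (bp \<one>\<^bsub>W\<^esub> 0) \<in> open_chamber h" using bp_open_chamber[OF that(1) that(1)] zero_in by simp
      then show ?thesis using im_chamber_iff[OF auto_in_Auts[OF that] W.one_closed that(1)] by simp
    qed
    have uniq: "\<phi> = \<gamma>" if "\<phi> \<in> Gam" "im_chamber \<phi> \<one>\<^bsub>W\<^esub> = im_chamber \<gamma> \<one>\<^bsub>W\<^esub>" for \<phi>
    proof -
      obtain h a where h: "h \<in> carrier W" "a \<in> A" "\<Theta> h = inv a" "\<phi> = auto_map h a"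
        using GamE[OF \<open>\<phi> \<in> Gam\<close>] by metis
      obtain k c where k: "k \<in> carrier W" "c \<in> A" "\<Theta> k = inv c" "\<gamma> = auto_map k c"
        using GamE[OF \<open>\<gamma> \<in> Gam\<close>] by metis
      have "h = k" using that(2) im h k by simp
      then have "a = c" using h k A_closed(1) by (metis inv_inv)
      then show ?thesis using h k \<open>h = k\<close> by simp
    qed
    have "{\<gamma>} = ?N \<inter> Gam"
    proof (intro equalityI subsetI)
      fix \<phi> assume "\<phi> \<in> {\<gamma>}"
      then show "\<phi> \<in> ?N \<inter> Gam" using \<open>\<gamma> \<in> Gam\<close> g im_chamber_iff[OF g W.one_closed iw] by simp
    next
      fix \<phi> assume "\<phi> \<in> ?N \<inter> Gam"
      then show "\<phi> \<in> {\<gamma>}" using uniq[of \<phi>] im_chamber_iff[of \<phi>, OF _ W.one_closed iw] by simp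
    qed
    moreover have "openin AutT ?N"
      using openin_open_chamber[OF iw] bp_in[OF W.one_closed zero_in(1)] by (intro openin_AutT_point)
    ultimately show ?thesis unfolding openin_subtopology by blast
  qed
  moreover have "topspace (subtopology AutT Gam) = Gam" using G by (auto simp: topspace_AutT)
  ultimately show ?thesis using discrete_topology_unique[of Gam "subtopology AutT Gam"] by simp
qed

lemma lattice_Gam: "lattice_in AutG AutT Gam"
  unfolding lattice_in_def using Gam_subgroup discrete_Gam finite_covolume_Gam by blast

section \<open>The hyperbolic structure on the quotient\<close>

subsection \<open>Words of reflections\<close>

text \<open>
  Words of reflections are the geometric counterpart of \<open>wprod\<close>: crossing the sides of the word
  leads to the polygon with label \<open>wprod u\<close>, drawn in the disc as the image of \<open>P\<close> under \<open>mir
  u\<close>.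
\<close>

definition mir :: "nat list \<Rightarrow> complex \<Rightarrow> complex" where
  "mir u z = foldr mirror u z"

lemma mir_simps [simp]: "mir [] z = z" "mir (i # u) z = mirror i (mir u z)"
  by (simp_all add: mir_def)

lemma mir_append: "mir (u @ v) z = mir u (mir v z)"
  by (simp add: mir_def)

lemma mir_norm: "cmod z < 1 \<Longrightarrow> cmod (mir u z) < 1"
  by (induction u) (auto simp: mirror_norm)

lemma mir_isometry: "disc_isometry (even (length u)) (mir u)"
proof (induction u)
  case Nil
  then show ?case using disc_isometry_id by (simp add: mir_def[abs_def])
next
  case (Cons i u)
  have e: "mir (i # u) = mirror i \<circ> mir u" by auto
  show ?case unfolding e using disc_isometry_compose[OF mirror_isometry[of i] Cons] by (simp add: o_def)
qed

lemma mir_rev: "cmod z < 1 \<Longrightarrow> mir (rev u) (mir u z) = z"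
  by (induction u arbitrary: z) (auto simp: mir_append mirror_mirror mir_norm)

lemma mir_rev': "cmod z < 1 \<Longrightarrow> mir u (mir (rev u) z) = z"
  using mir_rev[of z "rev u"] by simp

lemma mir_fixed: "cmod x < 1 \<Longrightarrow> set u \<subseteq> sides p x \<Longrightarrow> mir u x = x"
  by (induction u) (auto simp: sides_def mirror_fixed)

lemma iso_mir: "a \<in> A \<Longrightarrow> set u \<subseteq> {..<p} \<Longrightarrow> cmod z < 1 \<Longrightarrow> iso a (mir u z) = mir (map (act a) u) (iso a z)"
  by (induction u) (auto simp: iso_mirror mir_norm)

lemma ori_one: "ori \<one>"
  using ori_mult[of \<one> \<one>] by simp

lemma ori_wprod: "set u \<subseteq> {..<p} \<Longrightarrow> ori (wprod u) \<longleftrightarrow> even (length u)"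
  by (induction u) (auto simp: ori_mult ori_one ori_th th_closed wprod_closed)

lemma ori_inv: "x \<in> carrier B \<Longrightarrow> ori (inv x) = ori x"
  using ori_mult[of x "inv x"] ori_one by auto

lemma tendsto_nhds_disc:
  assumes "disc_isometry s T" "cmod x < 1"
  shows "(T \<longlongrightarrow> T x) (nhds x)"
proof -
  have "isCont T x"
    using disc_isometry_continuous[OF assms(1)] assms(2) by (simp add: continuous_on_eq_continuous_at)
  then show ?thesis by (simp add: isCont_def tendsto_at_iff_tendsto_nhds)
qed

lemma eventually_disc: "cmod x < 1 \<Longrightarrow> eventually (\<lambda>z. cmod z < 1) (nhds x)"
  using eventually_nhds_in_open[of "ball 0 1" x] by simp

lemma eventually_isometry:
  assumes "disc_isometry s T" "cmod x < 1" "eventually Q (nhds (T x))"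
  shows "eventually (\<lambda>z. Q (T z)) (nhds x)"
  using tendsto_nhds_disc[OF assms(1,2)] assms(3) by (rule filterlim_iff[THEN iffD1, rule_format])

lemma eventually_mir:
  "cmod x < 1 \<Longrightarrow> eventually Q (nhds (mir u x)) \<Longrightarrow> eventually (\<lambda>z. Q (mir u z)) (nhds x)"
  by (rule eventually_isometry[OF mir_isometry])

lemma eventually_sides: "eventually (\<lambda>y. sides p y \<subseteq> sides p x) (nhds x)"
proof -
  obtain N where "open N" "x \<in> N" "\<And>y. y \<in> N \<Longrightarrow> sides p y \<subseteq> sides p x"
    by (rule sides_upper_semicontinuous[of x]) metis
  then show ?thesis unfolding eventually_nhds by blast
qed

subsection \<open>Folding a neighbourhood of a corner onto the polygon\<close>

text \<open>
  The reflections in two adjacent sides \<open>j\<close> and \<open>k\<close> commute. They fold the disc onto the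
  quadrant bounded by these sides; the word records which of them have been used.
\<close>

definition fold_word :: "nat \<Rightarrow> nat \<Rightarrow> complex \<Rightarrow> nat list" where
  "fold_word j k z = (if side p j z < 0 then [j] else []) @ (if side p k z < 0 then [k] else [])"

definition fold_point :: "nat \<Rightarrow> nat \<Rightarrow> complex \<Rightarrow> complex" where
  "fold_point j k z = mir (rev (fold_word j k z)) z"

definition corner :: "nat \<Rightarrow> nat \<Rightarrow> complex set" where
  "corner j k = {x \<in> P. sides p x \<subseteq> {j, k}}"

definition corner_star :: "nat \<Rightarrow> nat \<Rightarrow> complex set" where
  "corner_star j k = {z. cmod z < 1 \<and> fold_point j k z \<in> corner j k}"

text \<open>
  The unfolding of the four polygons around the corner at \<open>j\<close> and \<open>k\<close>, starting with the one
  labelled \<open>b\<close>, onto a neighbourhood of this corner in the disc. Local inverses of it are the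
  charts.
\<close>

definition corner_map :: "'a \<Rightarrow> nat \<Rightarrow> nat \<Rightarrow> complex \<Rightarrow> building_point set" where
  "corner_map b j k z = cls (b \<otimes> wprod (fold_word j k z)) (fold_point j k z)"

lemma adjacent_lt: "adjacent p j k \<Longrightarrow> j < p" "adjacent p j k \<Longrightarrow> k < p"
  by (auto simp: adjacent_def)

lemma adjacent_sym: "adjacent p j k \<Longrightarrow> adjacent p k j"
  by (auto simp: adjacent_def)

lemma fold_word_set: "set (fold_word j k z) \<subseteq> {j, k}"
  by (auto simp: fold_word_def)

lemma fold_word_lt: "adjacent p j k \<Longrightarrow> set (fold_word j k z) \<subseteq> {..<p}"
  using fold_word_set[of j k z] adjacent_lt by blast

lemma fold_swap:
  assumes "adjacent p j k" "cmod z < 1"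
  shows "fold_point k j z = fold_point j k z" "wprod (fold_word k j z) = wprod (fold_word j k z)"
  using mirror_commute[OF assms] th_comm[OF assms(1)] th_closed adjacent_lt[OF assms(1)]
  by (auto simp: fold_point_def fold_word_def)

lemma corner_swap:
  assumes "adjacent p j k"
  shows "corner_star k j = corner_star j k" "z \<in> corner_star j k \<Longrightarrow> corner_map b k j z = corner_map b j k z"
  using fold_swap[OF assms] by (auto simp: corner_star_def corner_map_def corner_def insert_commute)

lemma cls_absorb:
  assumes "b \<in> carrier B" "y \<in> P" "g \<in> locgrp y"
  shows "cls (b \<otimes> g) y = cls b y"
proof -
  have g: "g \<in> carrier B" using locgrp_closed assms by blast
  have "\<exists>a\<in>A. y = iso a y \<and> (\<exists>g\<in>locgrp y. b \<otimes> g \<otimes> inv a = b \<otimes> g)" 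
    using A_closed(3) iso_one assms g by (intro bexI[of _ \<one>] conjI bexI[of _ g]) auto
  then show ?thesis
    using cls_eq[of "b \<otimes> g" y b y] assms g A_closed(3) iso_one by (metis inv_one m_closed r_one)
qed

text \<open>
  Reflecting the picture in side \<open>j\<close> amounts to starting with the neighbouring polygon. For
  points on the mirror, \<open>\<theta> j\<close> belongs to the local group and is absorbed.
\<close>

lemma corner_map_mirror_left:
  assumes "adjacent p j k" "z \<in> corner_star j k" "b \<in> carrier B"
  shows "mirror j z \<in> corner_star j k" "corner_map b j k (mirror j z) = corner_map (b \<otimes> \<theta> j) j k z"
proof -
  have z: "cmod z < 1" using assms by (simp add: corner_star_def)
  have jk: "j < p" "k < p" using adjacent_lt[OF assms(1)] by auto
  note c = th_closed[OF jk(1)] th_closed[OF jk(2)] assms(3)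
  obtain K where K: "0 < K" "side p j (mirror j z) = - K * side p j z" "side p k (mirror j z) = K * side p k z"
    using side_mirror[OF z, of j] assms(1) by metis
  define r where "r = (if side p k z < 0 then [k] else [])"
  have r: "wprod r \<in> carrier B" "rev r = r" using c by (auto simp: r_def)
  have rk: "(if side p k (mirror j z) < 0 then [k] else []) = r"
    using K(1,3) by (simp add: r_def mult_less_0_iff)
  have w: "fold_word j k z = (if side p j z < 0 then [j] else []) @ r"
    "fold_word j k (mirror j z) = (if side p j z > 0 then [j] else []) @ r"
    unfolding fold_word_def rk using K(1,2) by (simp_all add: r_def mult_less_0_iff zero_less_mult_iff)
  consider "side p j z > 0" | "side p j z < 0" | "side p j z = 0" by linarith
  then have "fold_point j k (mirror j z) = fold_point j k z \<and>
      corner_map b j k (mirror j z) = corner_map (b \<otimes> \<theta> j) j k z"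
  proof cases
    case 1
    then show ?thesis unfolding corner_map_def fold_point_def w using c r z
      by (simp add: mir_append mirror_mirror m_assoc)
  next
    case 2
    have "b \<otimes> \<theta> j \<otimes> (\<theta> j \<otimes> wprod r) = b \<otimes> (\<theta> j \<otimes> \<theta> j) \<otimes> wprod r"
      using c r by (simp add: m_assoc del: th_sq)
    then have "b \<otimes> \<theta> j \<otimes> (\<theta> j \<otimes> wprod r) = b \<otimes> wprod r" using c r th_sq[OF jk(1)] by simp
    then show ?thesis unfolding corner_map_def fold_point_def w using 2 c r z
      by (simp add: mir_append)
  next
    case 3
    have fx: "mirror j z = z" using 3 mirror_fixed[OF z] by simp
    have fw: "fold_word j k z = r" using w 3 by simp
    define y where "y = fold_point j k z"
    have y: "y \<in> P" "y = mir r z" using assms(2) fw r by (auto simp: y_def corner_star_def corner_def fold_point_def)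
    have "side p j y = 0"
    proof (cases "side p k z < 0")
      case True
      obtain K' where "side p j (mirror k z) = K' * side p j z" using side_mirror[OF z, of k] adjacent_sym[OF assms(1)] by metis
      then show ?thesis using True 3 y(2) by (simp add: r_def)
    qed (use 3 y(2) in \<open>simp add: r_def\<close>)
    then have "\<theta> j \<in> locgrp y" unfolding locgrp_def using jk c
      by (intro image_eqI[of _ _ "[j]"]) (auto simp: sides_def)
    then have "cls (b \<otimes> wprod r \<otimes> \<theta> j) y = cls (b \<otimes> wprod r) y"
      using c r y by (intro cls_absorb) auto
    moreover have "b \<otimes> \<theta> j \<otimes> wprod r = b \<otimes> wprod r \<otimes> \<theta> j"
      using c th_comm[OF assms(1)] by (simp add: r_def m_assoc)
    ultimately show ?thesis unfolding fx corner_map_def fw y_def[symmetric] by simp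
  qed
  then show "mirror j z \<in> corner_star j k" "corner_map b j k (mirror j z) = corner_map (b \<otimes> \<theta> j) j k z"
    using assms(2) mirror_norm[OF z] by (auto simp: corner_star_def)
qed

lemma corner_map_mirror:
  assumes "adjacent p j k" "i \<in> {j, k}" "z \<in> corner_star j k" "b \<in> carrier B"
  shows "mirror i z \<in> corner_star j k" "corner_map b j k (mirror i z) = corner_map (b \<otimes> \<theta> i) j k z"
proof -
  note s = adjacent_sym[OF assms(1)]
  have z: "z \<in> corner_star k j" using corner_swap(1)[OF assms(1)] assms(3) by simp
  have "mirror k z \<in> corner_star j k" "corner_map b j k (mirror k z) = corner_map (b \<otimes> \<theta> k) j k z"
    using corner_map_mirror_left[OF s z assms(4)] corner_swap[OF assms(1)] assms(3) by auto
  then show "mirror i z \<in> corner_star j k" "corner_map b j k (mirror i z) = corner_map (b \<otimes> \<theta> i) j k z"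
    using corner_map_mirror_left[OF assms(1,3,4)] assms(2) by auto
qed

lemma corner_map_mir:
  assumes "adjacent p j k" "set u \<subseteq> {j, k}" "z \<in> corner_star j k" "b \<in> carrier B"
  shows "mir u z \<in> corner_star j k" "corner_map b j k (mir u z) = corner_map (b \<otimes> wprod u) j k z"
proof -
  have "mir u z \<in> corner_star j k \<and> corner_map b j k (mir u z) = corner_map (b \<otimes> wprod u) j k z"
    using assms(2,4)
  proof (induction u arbitrary: b)
    case (Cons i u)
    have i: "i \<in> {j, k}" and u: "set u \<subseteq> {j, k}" using Cons.prems by auto
    have c: "\<theta> i \<in> carrier B" "wprod u \<in> carrier B"
      using i u adjacent_lt[OF assms(1)] by (auto intro!: th_closed wprod_closed)
    have "mir u z \<in> corner_star j k" using Cons.IH[OF u Cons.prems(2)] by simp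
    from corner_map_mirror[OF assms(1) i this Cons.prems(2)] show ?case
      using Cons.IH[OF u, of "b \<otimes> \<theta> i"] c Cons.prems(2) by (simp add: m_assoc)
  qed (use assms in auto)
  then show "mir u z \<in> corner_star j k" "corner_map b j k (mir u z) = corner_map (b \<otimes> wprod u) j k z" by auto
qed

lemma corner_map_corner:
  assumes "x \<in> corner j k" "b \<in> carrier B"
  shows "x \<in> corner_star j k" "corner_map b j k x = cls b x"
proof -
  have "fold_word j k x = []" using assms polygonD(2) by (auto simp: fold_word_def corner_def not_less)
  then show "x \<in> corner_star j k" "corner_map b j k x = cls b x"
    using assms polygonD(1) by (auto simp: corner_star_def corner_map_def fold_point_def corner_def)
qed

lemma fold_unfold: "cmod z < 1 \<Longrightarrow> z = mir (fold_word j k z) (fold_point j k z)"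
  unfolding fold_point_def by (simp add: mir_rev')

lemma fold_nonneg:
  assumes "adjacent p j k" "cmod z < 1"
  shows "0 \<le> side p j (fold_point j k z)" "0 \<le> side p k (fold_point j k z)"
proof -
  note nj = mirror_norm[OF assms(2), of j]
  obtain K where K: "0 < K" "side p j (mirror j z) = - K * side p j z" "side p k (mirror j z) = K * side p k z"
    using side_mirror[OF assms(2), of j] assms(1) by metis
  obtain M where M: "0 < M" "side p k (mirror k z) = - M * side p k z" "side p j (mirror k z) = M * side p j z"
    using side_mirror[OF assms(2), of k] adjacent_sym[OF assms(1)] by metis
  obtain H where H: "0 < H" "side p k (mirror k (mirror j z)) = - H * side p k (mirror j z)"
      "side p j (mirror k (mirror j z)) = H * side p j (mirror j z)"
    using side_mirror[OF nj, of k] adjacent_sym[OF assms(1)] by metis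
  show "0 \<le> side p j (fold_point j k z)" "0 \<le> side p k (fold_point j k z)"
    using K M H by (auto simp: fold_point_def fold_word_def mult_le_0_iff zero_le_mult_iff)
qed

text \<open>
  Only reflections fixing \<open>x\<close> are needed to fold the points close to \<open>x\<close>, because the
  inequalities for all other sides are strict at \<open>x\<close>. These reflections map neighbourhoods of
  \<open>x\<close> to neighbourhoods of \<open>x\<close>.
\<close>

lemma eventually_fold:
  assumes adj: "adjacent p j k" and x: "x \<in> corner j k" and Q: "eventually Q (nhds x)"
  shows "eventually (\<lambda>z. cmod z < 1 \<and> set (fold_word j k z) \<subseteq> sides p x \<and>
    fold_point j k z \<in> corner j k \<and> Q (fold_point j k z)) (nhds x)"
proof -
  have xn: "cmod x < 1" and xP: "x \<in> P" and xs: "sides p x \<subseteq> {j, k}" using x polygonD by (auto simp: corner_def)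
  define R where "R y \<longleftrightarrow> cmod y < 1 \<and> (\<forall>i\<in>{..<p} - sides p x. 0 < side p i y) \<and> Q y" for y
  have pos: "eventually (\<lambda>y. \<forall>i\<in>{..<p} - sides p x. 0 < side p i y) (nhds x)"
  proof (intro eventually_ball_finite ballI side_open[of x P])
    fix i assume "i \<in> {..<p} - sides p x"
    then have "side p i x \<noteq> 0" by (auto simp: sides_def)
    then show "0 < side p i x" using polygonD(2)[OF xP, of i] by linarith
  qed (use xP in auto)
  then have R: "eventually R (nhds x)"
    unfolding R_def[abs_def] using eventually_disc[OF xn] Q by (intro eventually_conj) auto
  have "eventually (\<lambda>z. \<forall>v\<in>{[], [j], [k], [k, j]}. set v \<subseteq> sides p x \<longrightarrow> R (mir v z)) (nhds x)"
  proof (intro eventually_ball_finite ballI)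
    fix v assume "v \<in> {[], [j], [k], [k, j]}"
    show "eventually (\<lambda>z. set v \<subseteq> sides p x \<longrightarrow> R (mir v z)) (nhds x)"
    proof (cases "set v \<subseteq> sides p x")
      case True
      then show ?thesis using eventually_mir[OF xn, of R v] R mir_fixed[OF xn True] by simp
    qed simp
  qed simp
  then show ?thesis
    using pos eventually_disc[OF xn]
  proof eventually_elim
    case (elim z)
    have lt: "j < p" "k < p" using adjacent_lt[OF adj] by auto
    have s: "set (fold_word j k z) \<subseteq> sides p x"
      using elim(2) lt by (force simp: fold_word_def split: if_splits)
    have "rev (fold_word j k z) \<in> {[], [j], [k], [k, j]}" by (auto simp: fold_word_def)
    then have Ry: "R (fold_point j k z)" using elim(1) s unfolding fold_point_def by auto
    have "0 \<le> side p i (fold_point j k z)" if "i < p" for i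
      using that Ry fold_nonneg[OF adj elim(3)] xs by (cases "i \<in> sides p x") (auto simp: R_def less_imp_le)
    then have "fold_point j k z \<in> P" using Ry by (simp add: R_def polygon_iff)
    moreover have "sides p (fold_point j k z) \<subseteq> sides p x"
    proof
      fix i assume i: "i \<in> sides p (fold_point j k z)"
      then have "i < p" "\<not> 0 < side p i (fold_point j k z)" by (auto simp: sides_def)
      then show "i \<in> sides p x" using Ry unfolding R_def by blast
    qed
    ultimately show ?case using s Ry elim xs by (auto simp: corner_def R_def)
  qed
qed

subsection \<open>Transition isometries\<close>

text \<open>
  Equality of the two points in the quotient provides \<open>a\<close> and a word \<open>l\<close> in the sides through
  \<open>x'\<close>. Folding \<open>z\<close> to \<open>x\<close>, applying \<open>a\<close>, and unfolding along \<open>l\<close> and then along \<open>u'\<close> maps \<open>z\<close>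
  to \<open>z'\<close>, and by the same equation in \<open>B\<close> it is compatible with the two unfoldings for all
  points near \<open>z\<close>.
\<close>

lemma corner_map_germ:
  assumes adj: "adjacent p j k" "adjacent p j' k'" and b: "b \<in> carrier B" "b' \<in> carrier B"
    and z: "z \<in> corner_star j k" "z' \<in> corner_star j' k'"
    and eq: "corner_map b j k z = corner_map b' j' k' z'"
  obtains T where "disc_isometry (ori b = ori b') T" "T z = z'"
    "eventually (\<lambda>y. y \<in> corner_star j k \<and> T y \<in> corner_star j' k' \<and>
       corner_map b' j' k' (T y) = corner_map b j k y) (nhds z)"
proof -
  define u x where "u = fold_word j k z" and "x = fold_point j k z"
  define u' x' where "u' = fold_word j' k' z'" and "x' = fold_point j' k' z'"
  have zn: "cmod z < 1" "cmod z' < 1" using z by (auto simp: corner_star_def)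
  have x: "x \<in> corner j k" "x' \<in> corner j' k'" using z by (auto simp: x_def x'_def corner_star_def)
  then have xP: "x \<in> P" "x' \<in> P" "sides p x \<subseteq> {j, k}" "sides p x' \<subseteq> {j', k'}" by (auto simp: corner_def)
  have xn: "cmod x < 1" "cmod x' < 1" using xP polygonD by auto
  have zx: "z = mir u x" "z' = mir u' x'" unfolding u_def x_def u'_def x'_def by (rule fold_unfold[OF zn(1)], rule fold_unfold[OF zn(2)])
  have us: "set u \<subseteq> {j, k}" "set u' \<subseteq> {j', k'}" by (auto simp: u_def u'_def dest: subsetD[OF fold_word_set])
  have ul: "set u \<subseteq> {..<p}" "set u' \<subseteq> {..<p}" using us adjacent_lt[OF adj(1)] adjacent_lt[OF adj(2)] by blast+
  note uc = wprod_closed[OF ul(1)] wprod_closed[OF ul(2)]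
  have "cls (b \<otimes> wprod u) x = cls (b' \<otimes> wprod u') x'"
    using eq by (simp add: corner_map_def u_def x_def u'_def x'_def)
  then obtain a g where a: "a \<in> A" "x' = iso a x" "g \<in> locgrp x'" "b \<otimes> wprod u \<otimes> inv a = b' \<otimes> wprod u' \<otimes> g"
    using cls_eq[of "b \<otimes> wprod u" x "b' \<otimes> wprod u'" x'] b uc xP by auto
  then obtain l where l: "set l \<subseteq> sides p x'" "g = wprod l" by (auto simp: locgrp_def)
  have ll: "set l \<subseteq> {..<p}" "set l \<subseteq> {j', k'}" using l sides_lt xP by blast+
  note lc = wprod_closed[OF ll(1)]
  have aB: "a \<in> carrier B" using a A_closed by auto
  define T where "T = mir (u' @ l) \<circ> (iso a \<circ> mir (rev u))"
  have "ori (b \<otimes> wprod u \<otimes> inv a) = ori (b' \<otimes> wprod u' \<otimes> wprod l)" using a l by simp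
  then have "((ori b = even (length u)) = ori a) = ((ori b' = even (length u')) = even (length l))"
    using b uc lc aB ul ll by (simp add: ori_mult ori_wprod ori_inv)
  then have o: "(even (length (u' @ l)) = (ori a = even (length (rev u)))) = (ori b = ori b')" by auto
  have T: "disc_isometry (ori b = ori b') T"
    unfolding T_def o[symmetric]
    by (intro disc_isometry_compose mir_isometry iso_isometry a)
  have "T z = z'"
    unfolding T_def zx using mir_rev[OF xn(1)] mir_fixed[OF xn(2) l(1)] a(2) by (simp add: mir_append)
  moreover have "eventually (\<lambda>y. y \<in> corner_star j k \<and> T y \<in> corner_star j' k' \<and>
       corner_map b' j' k' (T y) = corner_map b j k y) (nhds z)"
  proof -
    have rz: "mir (rev u) z = x" unfolding zx by (rule mir_rev[OF xn(1)])
    have "eventually (\<lambda>y. cmod y < 1 \<and> set (fold_word j k y) \<subseteq> sides p x \<and>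
      fold_point j k y \<in> corner j k \<and> sides p (fold_point j k y) \<subseteq> sides p x) (nhds x)"
      by (rule eventually_fold[OF adj(1) x(1) eventually_sides])
    then have "eventually (\<lambda>y. cmod (mir (rev u) y) < 1 \<and> set (fold_word j k (mir (rev u) y)) \<subseteq> sides p x \<and>
      fold_point j k (mir (rev u) y) \<in> corner j k \<and> sides p (fold_point j k (mir (rev u) y)) \<subseteq> sides p x) (nhds z)"
      using eventually_mir[OF zn(1), of _ "rev u"] unfolding rz by blast
    then show ?thesis
      using eventually_disc[OF zn(1)]
    proof eventually_elim
      case (elim z1)
      define x1 v y where "x1 = mir (rev u) z1" and "v = fold_word j k x1" and "y = fold_point j k x1"
      have e: "cmod x1 < 1" "set v \<subseteq> sides p x" "y \<in> corner j k" "sides p y \<subseteq> sides p x"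
        using elim by (auto simp: x1_def v_def y_def)
      have yP: "y \<in> P" using e by (auto simp: corner_def)
      then have yn: "cmod y < 1" using polygonD by auto
      have x1: "x1 = mir v y" unfolding v_def y_def by (rule fold_unfold[OF e(1)])
      have z1: "z1 = mir (u @ v) y"
        using mir_rev'[OF elim(2), of u] x1 by (simp add: mir_append x1_def)
      have vl: "set v \<subseteq> {..<p}" "set v \<subseteq> {j, k}" using e(2) sides_lt xP by blast+
      note vc = wprod_closed[OF vl(1)]
      note ys = corner_map_corner(1)[OF e(3) b(1)]
      have c1: "z1 \<in> corner_star j k" "corner_map b j k z1 = corner_map (b \<otimes> wprod (u @ v)) j k y"
        unfolding z1 using corner_map_mir[OF adj(1) _ ys b(1), of "u @ v"] us vl by auto
      have c2: "corner_map b j k z1 = cls (b \<otimes> wprod u \<otimes> wprod v) y"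
        unfolding c1(2) using corner_map_corner(2)[OF e(3), of "b \<otimes> wprod (u @ v)"] b uc vc
        by (simp add: wprod_append[OF ul(1) vl(1)] m_assoc)
      have ay: "iso a y \<in> corner j' k'"
        using iso_polygon[OF a(1) yP] sides_iso[OF a(1)] e(4) xP(4) a(2) unfolding corner_def by blast
      have av: "set (map (act a) v) \<subseteq> {j', k'}" "set (map (act a) v) \<subseteq> {..<p}"
        using e(2) sides_iso[OF a(1), of x] a(2) xP(4) map_act[OF a(1) vl(1)] by auto
      have T1: "T z1 = mir (u' @ l @ map (act a) v) (iso a y)"
        unfolding T_def using iso_mir[OF a(1) vl(1) yn] by (simp add: x1_def[symmetric] x1 mir_append)
      note ays = corner_map_corner(1)[OF ay b(2)]
      have c3: "T z1 \<in> corner_star j' k'"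
        "corner_map b' j' k' (T z1) = corner_map (b' \<otimes> wprod (u' @ l @ map (act a) v)) j' k' (iso a y)"
        unfolding T1 using corner_map_mir[OF adj(2) _ ays b(2), of "u' @ l @ map (act a) v"] us ll av by auto
      have w: "wprod (u' @ l @ map (act a) v) = wprod u' \<otimes> (wprod l \<otimes> (a \<otimes> wprod v \<otimes> inv a))"
        using wprod_append ul ll av wprod_map_act[OF a(1) vl(1)] by simp
      have c4: "corner_map b' j' k' (T z1) = cls (b' \<otimes> wprod u' \<otimes> wprod l \<otimes> (a \<otimes> wprod v \<otimes> inv a)) (iso a y)"
        unfolding c3(2) w using corner_map_corner(2)[OF ay, of "b' \<otimes> (wprod u' \<otimes> (wprod l \<otimes> (a \<otimes> wprod v \<otimes> inv a)))"] b uc lc vc aB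
        by (simp add: m_assoc)
      have "b' \<otimes> wprod u' \<otimes> wprod l \<otimes> (a \<otimes> wprod v \<otimes> inv a) = b \<otimes> wprod u \<otimes> inv a \<otimes> (a \<otimes> wprod v \<otimes> inv a)"
        using a(4) l(2) by simp
      also have "\<dots> = b \<otimes> wprod u \<otimes> wprod v \<otimes> inv a" using b uc vc aB by (simp add: m_assoc inv_cancel)
      finally have g: "b' \<otimes> wprod u' \<otimes> wprod l \<otimes> (a \<otimes> wprod v \<otimes> inv a) = b \<otimes> wprod u \<otimes> wprod v \<otimes> inv a" .
      have "cls (b \<otimes> wprod u \<otimes> wprod v) y = cls (b \<otimes> wprod u \<otimes> wprod v \<otimes> inv a) (iso a y)"
      proof (rule cls_eq[THEN iffD2])
        show "\<exists>a'\<in>A. iso a y = iso a' y \<and> (\<exists>g\<in>locgrp (iso a y).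
            b \<otimes> wprod u \<otimes> wprod v \<otimes> inv a' = b \<otimes> wprod u \<otimes> wprod v \<otimes> inv a \<otimes> g)"
          using b uc vc aB by (intro bexI[OF _ a(1)] conjI bexI[OF _ locgrp_one]) simp_all
      qed (use b uc vc aB yP iso_polygon[OF a(1) yP] in auto)
      then show ?case using c1(1) c3(1) c2 c4 g by simp
    qed
  qed
  ultimately show ?thesis using that T by blast
qed

subsection \<open>Local injectivity\<close>

lemma free_cell:
  assumes "x \<in> P" "a \<in> A" "act a ` sides p x = sides p x" "a \<in> locgrp x"
  shows "a = \<one>"
proof -
  note im = assms(3)
  obtain u where u: "set u \<subseteq> sides p x" "a = wprod u" using assms(4) by (auto simp: locgrp_def)
  from assms(1) show ?thesis
  proof (cases rule: sides_cases)
    case 1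
    then show ?thesis using u by simp
  next
    case (2 j)
    have "set u \<subseteq> {j} \<Longrightarrow> wprod u \<in> {\<one>, \<theta> j}" for u
      using th_sq[OF 2(1)] th_closed[OF 2(1)] by (induction u) auto
    then have "a \<in> {\<one>, \<theta> j}" using u 2 by simp
    then show ?thesis using free_side[OF assms(2) 2(1)] im 2(2) by auto
  next
    case (3 j)
    then show ?thesis using free_vertex[OF assms(2) 3(1)] im by simp
  qed
qed

text \<open>
  The action of \<open>A\<close> on the surface is free: an element that fixes \<open>x\<close> and is absorbed by the
  local group at \<open>x\<close> is trivial.
\<close>

lemma free_action:
  assumes "x \<in> P" "a \<in> A" "iso a x = x" "a \<in> locgrp x"
  shows "a = \<one>"
  using free_cell[OF assms(1,2) _ assms(4)] sides_iso[OF assms(2), of x] assms(3) by simp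

lemma corner_word_form:
  assumes "adjacent p j k" "set u \<subseteq> {j, k}"
  shows "\<exists>v\<in>{[], [j], [k], [j, k]}. wprod u = wprod v \<and> (\<forall>z. cmod z < 1 \<longrightarrow> mir u z = mir v z)"
  using assms(2)
proof (induction u)
  case Nil
  then show ?case by (intro bexI[of _ "[]"]) auto
next
  case (Cons i u)
  note c = th_closed[OF adjacent_lt(1)[OF assms(1)]] th_closed[OF adjacent_lt(2)[OF assms(1)]]
  note sq = th_sq[OF adjacent_lt(1)[OF assms(1)]] th_sq[OF adjacent_lt(2)[OF assms(1)]]
  have sq': "\<theta> j \<otimes> (\<theta> j \<otimes> x) = x" "\<theta> k \<otimes> (\<theta> k \<otimes> x) = x" if "x \<in> carrier B" for x
    using c sq that by (simp_all add: m_assoc[symmetric])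
  have kjk: "\<theta> k \<otimes> (\<theta> j \<otimes> \<theta> k) = \<theta> j"
    using c sq th_comm[OF assms(1)] sq' by simp
  obtain v where v: "v \<in> {[], [j], [k], [j, k]}" "wprod u = wprod v" "\<And>z. cmod z < 1 \<Longrightarrow> mir u z = mir v z"
  proof -
    have "set u \<subseteq> {j, k}" using Cons.prems by auto
    from Cons.IH[OF this] show ?thesis using that by blast
  qed
  have wi: "wprod (i # u) = wprod (i # v)" "\<And>z. cmod z < 1 \<Longrightarrow> mir (i # u) z = mir (i # v) z" using v by simp_all
  have mk: "mirror k (mirror j (mirror k z)) = mirror j z" if "cmod z < 1" for z
    using mirror_commute[OF assms(1), of "mirror k z"] that by (simp add: mirror_mirror mirror_norm)
  consider "i = j" | "i = k" using Cons by auto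
  then have "\<exists>v'\<in>{[], [j], [k], [j, k]}. wprod (i # v) = wprod v' \<and> (\<forall>z. cmod z < 1 \<longrightarrow> mir (i # v) z = mir v' z)"
  proof cases
    case 1
    consider "v = []" | "v = [j]" | "v = [k]" | "v = [j, k]" using v by auto
    then show ?thesis
    proof cases
      case 2 then show ?thesis using 1 sq c by (intro bexI[of _ "[]"]) (auto simp: mirror_mirror)
    next
      case 4 then show ?thesis using 1 sq' c by (intro bexI[of _ "[k]"]) (auto simp: mirror_mirror mirror_norm)
    qed (use 1 in auto)
  next
    case 2
    consider "v = []" | "v = [j]" | "v = [k]" | "v = [j, k]" using v by auto
    then show ?thesis
    proof cases
      case 2
      then show ?thesis using \<open>i = k\<close> c th_comm[OF assms(1)] mirror_commute[OF assms(1)]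
        by (intro bexI[of _ "[j, k]"]) auto
    next
      case 3 then show ?thesis using \<open>i = k\<close> sq c by (intro bexI[of _ "[]"]) (auto simp: mirror_mirror)
    next
      case 4 then show ?thesis using \<open>i = k\<close> kjk mk c by (intro bexI[of _ "[j]"]) auto
    qed (use \<open>i = k\<close> in auto)
  qed
  then show ?case using wi by auto
qed

text \<open>
  The four products of the two commuting involutions are distinct in \<open>B\<close>, so the label of a
  polygon at a corner determines its position in the disc.
\<close>

lemma corner_word_inj:
  assumes "adjacent p j k" "set u \<subseteq> {j, k}" "set v \<subseteq> {j, k}" "wprod u = wprod v" "cmod z < 1"
  shows "mir u z = mir v z"
proof -
  have lt: "j < p" "k < p" using adjacent_lt[OF assms(1)] by auto
  note c = th_closed[OF lt(1)] th_closed[OF lt(2)]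
  have ne: "\<theta> j \<noteq> \<one>" "\<theta> k \<noteq> \<one>" "\<theta> j \<noteq> \<theta> k" using th_ne_one lt th_ne[OF assms(1)] by auto
  have ne2: "\<theta> j \<otimes> \<theta> k \<noteq> \<one>" "\<theta> j \<otimes> \<theta> k \<noteq> \<theta> j" "\<theta> j \<otimes> \<theta> k \<noteq> \<theta> k"
  proof -
    show "\<theta> j \<otimes> \<theta> k \<noteq> \<one>"
    proof
      assume "\<theta> j \<otimes> \<theta> k = \<one>"
      then have "\<theta> j \<otimes> (\<theta> j \<otimes> \<theta> k) = \<theta> j" using c by simp
      then have "\<theta> k = \<theta> j" using c th_sq[OF lt(1)] by (simp add: m_assoc[symmetric])
      then show False using ne by simp
    qed
    show "\<theta> j \<otimes> \<theta> k \<noteq> \<theta> j" using c ne by simp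
    show "\<theta> j \<otimes> \<theta> k \<noteq> \<theta> k" using c ne by simp
  qed
  obtain u' where u': "u' \<in> {[], [j], [k], [j, k]}" "wprod u = wprod u'" "mir u z = mir u' z"
    using corner_word_form[OF assms(1,2)] assms(5) by blast
  obtain v' where v': "v' \<in> {[], [j], [k], [j, k]}" "wprod v = wprod v'" "mir v z = mir v' z"
    using corner_word_form[OF assms(1,3)] assms(5) by blast
  have "wprod u' = wprod v'" using u' v' assms(4) by simp
  then have "u' = v'" using u'(1) v'(1) ne ne2 c ne[symmetric] ne2[symmetric] by auto
  then show ?thesis using u' v' by simp
qed

text \<open>
  The finitely many symmetries that move \<open>x\<close> move it away from a whole neighbourhood.
\<close>

lemma eventually_separated:
  assumes "x \<in> P"
  shows "\<exists>Q. eventually Q (nhds x) \<and> (\<forall>a\<in>A. \<forall>y y'. Q y \<longrightarrow> Q y' \<longrightarrow> y' = iso a y \<longrightarrow> iso a x = x)"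
proof -
  have xn: "cmod x < 1" using assms polygonD by auto
  have "\<forall>a\<in>A. \<exists>Q. eventually Q (nhds x) \<and> (\<forall>y y'. Q y \<longrightarrow> Q y' \<longrightarrow> y' = iso a y \<longrightarrow> iso a x = x)"
  proof
    fix a assume a: "a \<in> A"
    show "\<exists>Q. eventually Q (nhds x) \<and> (\<forall>y y'. Q y \<longrightarrow> Q y' \<longrightarrow> y' = iso a y \<longrightarrow> iso a x = x)"
    proof (cases "iso a x = x")
      case False
      then obtain U V where UV: "open U" "open V" "iso a x \<in> U" "x \<in> V" "U \<inter> V = {}"
        by (meson separation_t2)
      have "eventually (\<lambda>y. iso a y \<in> U \<and> y \<in> V) (nhds x)"
        using eventually_isometry[OF iso_isometry[OF a] xn, of "\<lambda>y. y \<in> U"] UV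
        by (intro eventually_conj eventually_nhds_in_open) (auto intro: eventually_nhds_in_open)
      then show ?thesis using UV(5) by (intro exI[of _ "\<lambda>y. iso a y \<in> U \<and> y \<in> V"]) auto
    qed (auto intro: exI[of _ "\<lambda>_. True"])
  qed
  then obtain Q where Q: "\<And>a. a \<in> A \<Longrightarrow> eventually (Q a) (nhds x)"
    "\<And>a y y'. a \<in> A \<Longrightarrow> Q a y \<Longrightarrow> Q a y' \<Longrightarrow> y' = iso a y \<Longrightarrow> iso a x = x" by metis
  have "finite A" using finite_B A_sub subgroup.subset finite_subset by metis
  then have "eventually (\<lambda>y. \<forall>a\<in>A. Q a y) (nhds x)" using Q(1) by (intro eventually_ball_finite) auto
  then show ?thesis using Q(2) by (intro exI[of _ "\<lambda>y. \<forall>a\<in>A. Q a y"]) blast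
qed

text \<open>
  Two points near \<open>x\<close> with the same image are related by some \<open>a\<close>. By separation \<open>a\<close> fixes \<open>x\<close>,
  and the equation of labels puts it into the local group of \<open>x\<close>; so it is trivial, and then the
  labels force the two points to have been unfolded in the same way.
\<close>

lemma corner_map_locally_inj:
  assumes adj: "adjacent p j k" and z: "z \<in> corner_star j k" and b: "b \<in> carrier B"
  obtains M where "open M" "z \<in> M" "M \<subseteq> corner_star j k" "inj_on (corner_map b j k) M"
proof -
  define u x where "u = fold_word j k z" and "x = fold_point j k z"
  have zn: "cmod z < 1" using z by (auto simp: corner_star_def)
  have x: "x \<in> corner j k" using z by (auto simp: x_def corner_star_def)
  then have xP: "x \<in> P" "sides p x \<subseteq> {j, k}" by (auto simp: corner_def)
  have xn: "cmod x < 1" using xP polygonD by auto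
  have zx: "z = mir u x" unfolding u_def x_def by (rule fold_unfold[OF zn])
  have us: "set u \<subseteq> {j, k}" by (auto simp: u_def dest: subsetD[OF fold_word_set])
  have ul: "set u \<subseteq> {..<p}" using us adjacent_lt[OF adj] by blast
  note uc = wprod_closed[OF ul]
  define c where "c = b \<otimes> wprod u"
  have c: "c \<in> carrier B" using b uc by (simp add: c_def)
  obtain Q where Q: "eventually Q (nhds x)" "\<And>a y y'. a \<in> A \<Longrightarrow> Q y \<Longrightarrow> Q y' \<Longrightarrow> y' = iso a y \<Longrightarrow> iso a x = x"
    using eventually_separated[OF xP(1)] by metis
  define G where "G y \<longleftrightarrow> cmod y < 1 \<and> set (fold_word j k y) \<subseteq> sides p x \<and>
      fold_point j k y \<in> corner j k \<and> (sides p (fold_point j k y) \<subseteq> sides p x \<and> Q (fold_point j k y))" for y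
  have Gx: "eventually G (nhds x)"
    unfolding G_def[abs_def] by (intro eventually_fold[OF adj x] eventually_conj eventually_sides Q(1))
  have inj: "y1 = y2" if G: "G y1" "G y2" and e: "corner_map c j k y1 = corner_map c j k y2" for y1 y2
  proof -
    define v1 v2 w1 w2 where "v1 = fold_word j k y1" and "v2 = fold_word j k y2"
      and "w1 = fold_point j k y1" and "w2 = fold_point j k y2"
    have v: "set v1 \<subseteq> sides p x" "set v2 \<subseteq> sides p x" and w: "w1 \<in> P" "w2 \<in> P" "Q w1" "Q w2"
      "sides p w2 \<subseteq> sides p x" and yn: "cmod y1 < 1" "cmod y2 < 1"
      using G by (auto simp: G_def v1_def v2_def w1_def w2_def corner_def)
    have vl: "set v1 \<subseteq> {..<p}" "set v2 \<subseteq> {..<p}" using v sides_lt by blast+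
    note vc = wprod_closed[OF vl(1)] wprod_closed[OF vl(2)]
    have "cls (c \<otimes> wprod v1) w1 = cls (c \<otimes> wprod v2) w2"
      using e by (simp add: corner_map_def v1_def v2_def w1_def w2_def)
    then obtain a g where a: "a \<in> A" "w2 = iso a w1" "g \<in> locgrp w2" "c \<otimes> wprod v1 \<otimes> inv a = c \<otimes> wprod v2 \<otimes> g"
      using cls_eq[of "c \<otimes> wprod v1" w1 "c \<otimes> wprod v2" w2] c vc w by auto
    have aB: "a \<in> carrier B" using a A_closed by auto
    have gB: "g \<in> carrier B" using a locgrp_closed by auto
    have ax: "iso a x = x" using Q(2)[OF a(1) w(3,4) a(2)] .
    have lx: "wprod v1 \<in> locgrp x" "wprod v2 \<in> locgrp x" "g \<in> locgrp x"
      using v a(3) w(5) by (auto simp: locgrp_def)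
    have "wprod v1 \<otimes> inv a = wprod v2 \<otimes> g"
    proof -
      have "inv c \<otimes> (c \<otimes> (wprod v1 \<otimes> inv a)) = inv c \<otimes> (c \<otimes> (wprod v2 \<otimes> g))"
        using a(4) c vc gB aB by (simp add: m_assoc)
      then show ?thesis using c vc gB aB by (simp add: inv_cancel)
    qed
    then have e2: "wprod v1 = wprod v2 \<otimes> g \<otimes> a" using vc gB aB by (metis inv_solve_right inv_closed m_closed inv_inv)
    then have "a = inv (wprod v2 \<otimes> g) \<otimes> wprod v1" using vc gB aB by (simp add: inv_cancel)
    then have "a \<in> locgrp x" using locgrp_mult locgrp_inv lx by simp
    then have "a = \<one>" by (rule free_action[OF xP(1) a(1) ax])
    then have ww: "w2 = w1" and e3: "wprod v1 = wprod v2 \<otimes> g" using a(2) iso_one e2 vc gB by auto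
    obtain l where l: "set l \<subseteq> sides p w2" "g = wprod l" using a(3) by (auto simp: locgrp_def)
    have ll: "set l \<subseteq> {..<p}" using l sides_lt by blast
    have "mir v1 w2 = mir (v2 @ l) w2"
      using v l(1) w(5) xP(2) e3 l(2) wprod_append[OF vl(2) ll] polygonD(1)[OF w(2)]
      by (intro corner_word_inj[OF adj]) auto
    also have "\<dots> = mir v2 w2" using mir_fixed[OF polygonD(1)[OF w(2)] l(1)] by (simp add: mir_append)
    finally have "mir v1 w1 = mir v2 w2" using ww by simp
    moreover have "mir v1 w1 = y1" "mir v2 w2 = y2"
      unfolding v1_def v2_def w1_def w2_def by (rule fold_unfold[symmetric], rule yn)+
    ultimately show ?thesis by simp
  qed
  have rz: "mir (rev u) z = x" unfolding zx by (rule mir_rev[OF xn(1)])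
  have "eventually (\<lambda>y. G (mir (rev u) y) \<and> cmod y < 1) (nhds z)"
    using eventually_mir[OF zn, of G "rev u"] Gx eventually_disc[OF zn] unfolding rz by (intro eventually_conj) auto
  then obtain M where M: "open M" "z \<in> M" "\<And>y. y \<in> M \<Longrightarrow> G (mir (rev u) y) \<and> cmod y < 1"
    unfolding eventually_nhds by blast
  have *: "y \<in> corner_star j k \<and> corner_map b j k y = corner_map c j k (mir (rev u) y)" if "y \<in> M" for y
  proof -
    have "G (mir (rev u) y)" "cmod y < 1" using M(3)[OF that] by auto
    then have "mir (rev u) y \<in> corner_star j k" by (simp add: G_def corner_star_def)
    from corner_map_mir[OF adj us this b] show ?thesis
      using mir_rev'[OF \<open>cmod y < 1\<close>, of u] by (simp add: c_def)
  qed
  have "inj_on (corner_map b j k) M"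
  proof (rule inj_onI)
    fix y1 y2 assume y: "y1 \<in> M" "y2 \<in> M" "corner_map b j k y1 = corner_map b j k y2"
    then have "mir (rev u) y1 = mir (rev u) y2" using inj M(3) * by metis
    then show "y1 = y2" using mir_rev' M(3) y by metis
  qed
  then show ?thesis using that M * by blast
qed

subsection \<open>The quotient is a compact connected Hausdorff space\<close>

lemma cls_in: "b \<in> carrier B \<Longrightarrow> x \<in> P \<Longrightarrow> cls b x \<in> topspace Y"
  by (auto simp: topspace_Y)

lemma cls_continuous: "b \<in> carrier B \<Longrightarrow> continuous_map (top_of_set P) Y (cls b)"
  unfolding continuous_map_def using cls_in openin_Y by auto

lemma compact_Y: "compact_space Y"
proof -
  have "compactin Y (cls b ` P)" if "b \<in> carrier B" for b
    by (rule image_compactin[OF _ cls_continuous[OF that]])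
      (simp add: compactin_subtopology compact_polygon)
  then have "compactin Y (\<Union>b\<in>carrier B. cls b ` P)"
    using finite_B by (intro compactin_Union) auto
  moreover have "(\<Union>b\<in>carrier B. cls b ` P) = topspace Y" by (auto simp: topspace_Y)
  ultimately show ?thesis by (simp add: compact_space_def)
qed

text \<open>
  Neighbouring polygons share the midpoint of a side, and the involutions \<open>\<theta> i\<close> generate
  \<open>B\<close>.
\<close>

lemma connected_Y: "connected_space Y"
proof -
  have con: "connected_component_of Y (cls b x) (cls b y)" if "b \<in> carrier B" "x \<in> P" "y \<in> P" for b x y
  proof -
    have "connectedin Y (cls b ` P)"
      by (rule connectedin_continuous_map_image[OF cls_continuous[OF that(1)]])
        (simp add: connectedin_subtopology connected_polygon)
    then show ?thesis using that unfolding connected_component_of_def by blast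
  qed
  have "set u \<subseteq> {..<p} \<Longrightarrow> connected_component_of Y (cls \<one> 0) (cls (wprod u) 0)" for u
  proof (induction u rule: rev_induct)
    case Nil
    then show ?case using con[of \<one> 0 0] zero_in by simp
  next
    case (snoc i u)
    have i: "i < p" and u: "set u \<subseteq> {..<p}" using snoc.prems by auto
    note c = wprod_closed[OF u] th_closed[OF i]
    let ?m = "side_arc i 0"
    have m: "?m \<in> P" by (rule side_midpoint(1)[OF i])
    have "\<theta> i \<in> locgrp ?m" unfolding locgrp_def side_midpoint(2)[OF i] using c
      by (intro image_eqI[of _ _ "[i]"]) auto
    then have e: "cls (wprod u \<otimes> \<theta> i) ?m = cls (wprod u) ?m" by (rule cls_absorb[OF c(1) m])
    have w: "wprod (u @ [i]) = wprod u \<otimes> \<theta> i" using u i c by (simp add: wprod_append)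
    have "connected_component_of Y (cls \<one> 0) (cls (wprod u) ?m)"
      using connected_component_of_trans[OF snoc.IH[OF u] con[OF c(1) zero_in(1) m]] .
    moreover have "connected_component_of Y (cls (wprod u \<otimes> \<theta> i) ?m) (cls (wprod u \<otimes> \<theta> i) 0)"
      using c m zero_in by (intro con) auto
    ultimately show ?case unfolding w e using connected_component_of_trans by fast
  qed
  then have base: "connected_component_of Y (cls \<one> 0) (cls b x)" if "b \<in> carrier B" "x \<in> P" for b x
    using th_generate[OF that(1)] connected_component_of_trans[OF _ con[OF that(1) zero_in(1) that(2)]]
    by (metis wprod_def)
  show ?thesis
    unfolding connected_space_iff_connected_component
  proof (intro ballI)
    fix s t assume "s \<in> topspace Y" "t \<in> topspace Y"
    then have "connected_component_of Y (cls \<one> 0) s" "connected_component_of Y (cls \<one> 0) t"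
      unfolding topspace_Y using base by auto
    then show "connected_component_of Y s t"
      by (metis connected_component_of_sym connected_component_of_trans)
  qed
qed

lemma closed_slice:
  assumes "g \<in> carrier B"
  shows "closedin (top_of_set P) {x \<in> P. g \<in> locgrp x}"
proof -
  have "openin (top_of_set P) {x \<in> P. g \<notin> locgrp x}"
  proof (rule openin_P_I)
    fix x assume x: "x \<in> {x \<in> P. g \<notin> locgrp x}"
    obtain N where N: "open N" "x \<in> N" "\<And>y. y \<in> N \<Longrightarrow> sides p y \<subseteq> sides p x"
      by (rule sides_upper_semicontinuous[of x]) metis
    have "locgrp y \<subseteq> locgrp x" if "y \<in> N" for y using N(3)[OF that] by (auto simp: locgrp_def)
    then show "\<exists>N. open N \<and> x \<in> N \<and> N \<inter> P \<subseteq> {x \<in> P. g \<notin> locgrp x}" using N x by blast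
  qed auto
  moreover have "{x \<in> P. g \<notin> locgrp x} = topspace (top_of_set P) - {x \<in> P. g \<in> locgrp x}" by auto
  ultimately show ?thesis unfolding closedin_def by auto
qed

text \<open>
  The quotient is the image of finitely many compact polygons under a map that is closed,
  because the gluing is by finitely many homeomorphisms between closed sets. Closed continuous
  images of normal Hausdorff spaces are Hausdorff.
\<close>

lemma Hausdorff_Y: "Hausdorff_space Y"
proof -
  let ?X = "prod_topology (discrete_topology (carrier B)) (top_of_set P)"
  let ?f = "\<lambda>(b, x). cls b x"
  have fX: "?f ` topspace ?X = topspace Y" by (auto simp: topspace_Y)
  have X: "normal_space ?X" "Hausdorff_space ?X"
  proof -
    have "metrizable_space ?X"
      unfolding metrizable_space_prod_topology
      by (simp add: metrizable_space_discrete_topology metrizable_space_subtopology metrizable_space_euclidean)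
    then show "normal_space ?X" "Hausdorff_space ?X"
      by (simp_all add: metrizable_imp_normal_space metrizable_imp_Hausdorff_space)
  qed
  have sl: "openin ?X {z \<in> topspace ?X. ?f z \<in> U} \<longleftrightarrow> (\<forall>b\<in>carrier B. openin (top_of_set P) {x \<in> P. cls b x \<in> U})" for U
    unfolding openin_prod_discrete by (auto cong: conj_cong)
  have cont: "continuous_map ?X Y ?f"
    unfolding continuous_map_def
  proof (intro conjI allI impI)
    show "?f \<in> topspace ?X \<rightarrow> topspace Y" using cls_in by auto
    fix U assume "openin Y U"
    then show "openin ?X {z \<in> topspace ?X. ?f z \<in> U}" unfolding sl openin_Y by simp
  qed
  have closed: "closed_map ?X Y ?f"
    unfolding closed_map_def
  proof (intro allI impI)
    fix C assume C: "closedin ?X C"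
    have Cs: "closedin (top_of_set P) {x \<in> P. (b, x) \<in> C}" if "b \<in> carrier B" for b
    proof -
      have "continuous_map (top_of_set P) ?X (\<lambda>x. (b, x))"
        using that by (intro continuous_map_pairedI) auto
      from closedin_continuous_map_preimage[OF this C] show ?thesis by simp
    qed
    have Csub: "C \<subseteq> carrier B \<times> P" using closedin_subset[OF C] by simp
    have slice: "closedin (top_of_set P) {x \<in> P. cls b' x \<in> ?f ` C}" if b': "b' \<in> carrier B" for b'
    proof -
      let ?I = "{(b, a). b \<in> carrier B \<and> a \<in> A}"
      let ?S = "\<lambda>(b, a). {x \<in> P. iso (inv a) x \<in> {x \<in> P. (b, x) \<in> C}} \<inter> {x \<in> P. inv b' \<otimes> (b \<otimes> inv a) \<in> locgrp x}"
      have eq: "{x \<in> P. cls b' x \<in> ?f ` C} = (\<Union>i\<in>?I. ?S i)"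
      proof
        show "{x \<in> P. cls b' x \<in> ?f ` C} \<subseteq> (\<Union>i\<in>?I. ?S i)"
        proof
          fix x' assume "x' \<in> {x \<in> P. cls b' x \<in> ?f ` C}"
          then obtain b x where bx: "x' \<in> P" "(b, x) \<in> C" "cls b' x' = cls b x" by auto
          then have c: "b \<in> carrier B" "x \<in> P" using Csub by auto
          obtain a g where a: "a \<in> A" "x' = iso a x" "g \<in> locgrp x'" "b \<otimes> inv a = b' \<otimes> g"
            using cls_eq[OF c b' bx(1)] bx(3) by auto
          have "inv b' \<otimes> (b \<otimes> inv a) = g" using a b' locgrp_closed[OF a(3)] by (simp add: inv_cancel)
          then have "x' \<in> ?S (b, a)" using a bx c iso_inv(1)[OF a(1)] by simp
          then show "x' \<in> (\<Union>i\<in>?I. ?S i)" using c a by blast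
        qed
        show "(\<Union>i\<in>?I. ?S i) \<subseteq> {x \<in> P. cls b' x \<in> ?f ` C}"
        proof
          fix x' assume "x' \<in> (\<Union>i\<in>?I. ?S i)"
          then obtain b a where a: "b \<in> carrier B" "a \<in> A" "x' \<in> P" "iso (inv a) x' \<in> P" "(b, iso (inv a) x') \<in> C"
            "inv b' \<otimes> (b \<otimes> inv a) \<in> locgrp x'" by auto
          have "b' \<otimes> (inv b' \<otimes> (b \<otimes> inv a)) = b \<otimes> inv a" using a b' A_closed by (simp add: inv_cancel)
          then have "\<exists>g\<in>locgrp x'. b \<otimes> inv a = b' \<otimes> g" using a(6) by metis
          then have "cls b (iso (inv a) x') = cls b' x'"
            using cls_eq[OF a(1,4) b' a(3)] a(2) iso_inv(2)[OF a(2), of x'] by metis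
          then have "cls b' x' = ?f (b, iso (inv a) x')" by simp
          then show "x' \<in> {x \<in> P. cls b' x \<in> ?f ` C}" using a(3,5) by blast
        qed
      qed
      have cl: "closedin (top_of_set P) (?S i)" if iI: "i \<in> ?I" for i
      proof -
        obtain b a where i: "i = (b, a)" "b \<in> carrier B" "a \<in> A" using iI by auto
        have ia: "inv a \<in> A" "inv a \<in> carrier B" using i A_closed by auto
        have "continuous_on P (iso (inv a))"
          using disc_isometry_continuous[OF iso_isometry[OF ia(1)]] polygonD(1)
          by (auto intro: continuous_on_subset)
        then have "continuous_map (top_of_set P) (top_of_set P) (iso (inv a))"
          using iso_polygon[OF ia(1)] by auto
        from closedin_continuous_map_preimage[OF this Cs[OF i(2)]]
        have "closedin (top_of_set P) {x \<in> P. iso (inv a) x \<in> {x \<in> P. (b, x) \<in> C}}" by simp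
        moreover have "closedin (top_of_set P) {x \<in> P. inv b' \<otimes> (b \<otimes> inv a) \<in> locgrp x}"
          using i ia b' by (intro closed_slice) auto
        ultimately show ?thesis unfolding i(1) prod.case by (rule closedin_Int)
      qed
      have "finite ?I"
      proof -
        have "finite A" using finite_B A_sub subgroup.subset finite_subset by metis
        then show ?thesis using finite_B finite_subset[of ?I "carrier B \<times> A"] by auto
      qed
      then show ?thesis unfolding eq using cl by (intro closedin_Union finite_imageI) auto
    qed
    have "openin Y (topspace Y - ?f ` C)"
      unfolding openin_Y
    proof (intro conjI ballI)
      fix b assume b: "b \<in> carrier B"
      have "{x \<in> P. cls b x \<in> topspace Y - ?f ` C} = topspace (top_of_set P) - {x \<in> P. cls b x \<in> ?f ` C}"
        using cls_in[OF b] by auto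
      then show "openin (top_of_set P) {x \<in> P. cls b x \<in> topspace Y - ?f ` C}"
        using slice[OF b] unfolding closedin_def by simp
    qed auto
    moreover have "?f ` C \<subseteq> topspace Y" using Csub cls_in by auto
    ultimately show "closedin Y (?f ` C)" by (simp add: closedin_def)
  qed
  show ?thesis
    using normal_Hausdorff_space_closed_continuous_map_image[OF X closed cont fX] by blast
qed

subsection \<open>The atlas\<close>

lemma corner_exists:
  assumes "x \<in> P"
  obtains j k where "adjacent p j k" "x \<in> corner j k"
proof -
  obtain i where "i < p" "sides p x \<subseteq> {i, nxt p i}" using polygon_point[OF assms] by metis
  then show ?thesis using that[of i "nxt p i"] adjacent_nxt assms by (auto simp: corner_def)
qed

lemma corner_map_in:
  assumes "adjacent p j k" "z \<in> corner_star j k" "b \<in> carrier B"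
  shows "corner_map b j k z \<in> topspace Y"
  unfolding corner_map_def using assms fold_word_lt[OF assms(1)] wprod_closed
  by (intro cls_in) (auto simp: corner_star_def corner_def)

lemma eventually_openin:
  assumes "openin (top_of_set P) S" "x \<in> S"
  shows "eventually (\<lambda>y. y \<in> P \<longrightarrow> y \<in> S) (nhds x)"
  using assms unfolding openin_open eventually_nhds by blast

text \<open>
  All polygons around the corner that contain the point have to be taken into account: each of
  them contributes one of the finitely many conditions \<open>Q\<close>.
\<close>

lemma corner_map_eventually:
  assumes adj: "adjacent p j k" and z: "z \<in> corner_star j k" and b: "b \<in> carrier B"
    and U: "openin Y U" "corner_map b j k z \<in> U"
  shows "eventually (\<lambda>y. y \<in> corner_star j k \<and> corner_map b j k y \<in> U) (nhds z)"
proof -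
  define u x where "u = fold_word j k z" and "x = fold_point j k z"
  have zn: "cmod z < 1" using z by (auto simp: corner_star_def)
  have x: "x \<in> corner j k" using z by (auto simp: x_def corner_star_def)
  then have xP: "x \<in> P" "sides p x \<subseteq> {j, k}" by (auto simp: corner_def)
  have xn: "cmod x < 1" using xP polygonD by auto
  have zx: "z = mir u x" unfolding u_def x_def by (rule fold_unfold[OF zn])
  have us: "set u \<subseteq> {j, k}" by (auto simp: u_def dest: subsetD[OF fold_word_set])
  have ul: "set u \<subseteq> {..<p}" using us adjacent_lt[OF adj] by blast
  define c where "c = b \<otimes> wprod u"
  have c: "c \<in> carrier B" using b wprod_closed[OF ul] by (simp add: c_def)
  have cU: "cls c x \<in> U" using U(2) by (simp add: corner_map_def c_def u_def x_def)
  define Q where "Q y \<longleftrightarrow> (\<forall>d\<in>carrier B. cls d x \<in> U \<longrightarrow> y \<in> P \<longrightarrow> cls d y \<in> U)" for y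
  have Q: "eventually Q (nhds x)"
    unfolding Q_def[abs_def]
  proof (intro eventually_ball_finite finite_B ballI)
    fix d assume d: "d \<in> carrier B"
    show "eventually (\<lambda>y. cls d x \<in> U \<longrightarrow> y \<in> P \<longrightarrow> cls d y \<in> U) (nhds x)"
    proof (cases "cls d x \<in> U")
      case True
      have "openin (top_of_set P) {x \<in> P. cls d x \<in> U}" using U(1) d by (simp add: openin_Y)
      from eventually_openin[OF this, of x] show ?thesis using True xP(1) by (auto elim: eventually_mono)
    qed simp
  qed
  have rz: "mir (rev u) z = x" unfolding zx by (rule mir_rev[OF xn])
  have "eventually (\<lambda>y. cmod (mir (rev u) y) < 1 \<and> set (fold_word j k (mir (rev u) y)) \<subseteq> sides p x \<and>
      fold_point j k (mir (rev u) y) \<in> corner j k \<and> Q (fold_point j k (mir (rev u) y))) (nhds z)"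
    using eventually_mir[OF zn, of _ "rev u"] eventually_fold[OF adj x Q] unfolding rz by blast
  then show ?thesis
    using eventually_disc[OF zn]
  proof eventually_elim
    case (elim z1)
    define x1 v where "x1 = mir (rev u) z1" and "v = fold_word j k x1"
    have e: "cmod x1 < 1" "set v \<subseteq> sides p x" "fold_point j k x1 \<in> corner j k" "Q (fold_point j k x1)"
      using elim by (auto simp: x1_def v_def)
    have vl: "set v \<subseteq> {..<p}" using e(2) sides_lt by blast
    have s: "x1 \<in> corner_star j k" using e by (simp add: corner_star_def)
    have z1: "mir u x1 = z1" unfolding x1_def by (rule mir_rev'[OF elim(2)])
    have r: "z1 \<in> corner_star j k" "corner_map b j k z1 = corner_map c j k x1"
      using corner_map_mir[OF adj us s b] unfolding z1 c_def by auto
    have "wprod v \<in> locgrp x" using e(2) by (auto simp: locgrp_def)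
    then have "cls (c \<otimes> wprod v) x \<in> U" using cls_absorb[OF c xP(1)] cU by simp
    then have "cls (c \<otimes> wprod v) (fold_point j k x1) \<in> U"
      using e(3,4) c wprod_closed[OF vl] by (auto simp: Q_def corner_def)
    then show ?case using r by (simp add: corner_map_def v_def)
  qed
qed

text \<open>
  Near a point in the image, a polygon is mapped into the disc by one of the transition
  isometries, which is continuous.
\<close>

lemma corner_map_open:
  assumes adj: "adjacent p j k" and b: "b \<in> carrier B" and M: "open M" "M \<subseteq> corner_star j k"
  shows "openin Y (corner_map b j k ` M)"
  unfolding openin_Y
proof (intro conjI ballI)
  show "corner_map b j k ` M \<subseteq> topspace Y" using corner_map_in[OF adj _ b] M by auto
  fix b' assume b': "b' \<in> carrier B"
  show "openin (top_of_set P) {x \<in> P. cls b' x \<in> corner_map b j k ` M}"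
  proof (rule openin_P_I)
    fix x assume "x \<in> {x \<in> P. cls b' x \<in> corner_map b j k ` M}"
    then obtain z where x: "x \<in> P" "z \<in> M" "cls b' x = corner_map b j k z" by auto
    obtain j' k' where adj': "adjacent p j' k'" and xc: "x \<in> corner j' k'" using corner_exists[OF x(1)] .
    have "corner_map b' j' k' x = corner_map b j k z" using corner_map_corner(2)[OF xc b'] x(3) by simp
    from corner_map_germ[OF adj' adj b' b corner_map_corner(1)[OF xc b'] _ this] x(2) M(2)
    obtain T where T: "disc_isometry (ori b' = ori b) T" "T x = z"
      "eventually (\<lambda>y. y \<in> corner_star j' k' \<and> T y \<in> corner_star j k \<and>
         corner_map b j k (T y) = corner_map b' j' k' y) (nhds x)" by blast
    have "eventually (\<lambda>y. T y \<in> M) (nhds x)"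
      using eventually_isometry[OF T(1) polygonD(1)[OF x(1)], of "\<lambda>y. y \<in> M"] T(2) x(2) M(1)
      by (simp add: eventually_nhds_in_open)
    then have "eventually (\<lambda>y. y \<in> P \<longrightarrow> cls b' y \<in> corner_map b j k ` M) (nhds x)"
      using T(3) eventually_sides[of x]
    proof eventually_elim
      case (elim y)
      show ?case
      proof
        assume "y \<in> P"
        then have "y \<in> corner j' k'" using elim(3) xc by (auto simp: corner_def)
        then have "cls b' y = corner_map b j k (T y)" using corner_map_corner(2)[OF _ b'] elim(2) by simp
        then show "cls b' y \<in> corner_map b j k ` M" using elim(1) by simp
      qed
    qed
    then show "\<exists>N. open N \<and> x \<in> N \<and> N \<inter> P \<subseteq> {x \<in> P. cls b' x \<in> corner_map b j k ` M}"
      unfolding eventually_nhds by blast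
  qed auto
qed

definition orient :: "bool \<Rightarrow> complex \<Rightarrow> complex" where
  "orient s z = (if s then z else cnj z)"

lemma orient_orient [simp]: "orient s (orient s z) = z"
  by (simp add: orient_def)

lemma orient_isometry: "disc_isometry s (orient s)"
  using disc_isometry_id disc_isometry_cnj by (cases s) (simp_all add: orient_def[abs_def])

text \<open>
  Polygons whose label has the wrong orientation are drawn in the mirror image of the disc, so
  that transition maps preserve the orientation.
\<close>

definition chart :: "'a \<Rightarrow> nat \<Rightarrow> nat \<Rightarrow> complex set \<Rightarrow> building_point set \<Rightarrow> complex" where
  "chart b j k M s = orient (ori b) (inv_into M (corner_map b j k) s)"

definition atlas :: "(building_point set set \<times> (building_point set \<Rightarrow> complex)) set" where
  "atlas = {(corner_map b j k ` M, chart b j k M) | b j k M. b \<in> carrier B \<and> adjacent p j k \<and>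
     open M \<and> M \<subseteq> corner_star j k \<and> inj_on (corner_map b j k) M}"

lemma chart_eval: "inj_on (corner_map b j k) M \<Longrightarrow> z \<in> M \<Longrightarrow> chart b j k M (corner_map b j k z) = orient (ori b) z"
  by (simp add: chart_def)

lemma chart_homeomorphic:
  assumes b: "b \<in> carrier B" and adj: "adjacent p j k" and M: "open M" "M \<subseteq> corner_star j k"
    and inj: "inj_on (corner_map b j k) M"
  shows "homeomorphic_map (subtopology Y (corner_map b j k ` M)) (top_of_set (chart b j k M ` corner_map b j k ` M)) (chart b j k M)"
    "open (chart b j k M ` corner_map b j k ` M)" "chart b j k M ` corner_map b j k ` M \<subseteq> ball 0 1"
proof -
  let ?f = "corner_map b j k" and ?o = "orient (ori b)"
  let ?U = "?f ` M"
  have UY: "?U \<subseteq> topspace Y" using corner_map_in[OF adj _ b] M by auto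
  have im: "chart b j k M ` ?U = ?o ` M" using chart_eval[OF inj] by (auto simp: image_image)
  have co: "continuous_on S ?o" for S
    by (cases "ori b") (simp_all add: orient_def[abs_def] continuous_on_cnj)
  have "?o ` M = ?o -` M" by (auto simp: image_iff) (metis orient_orient)+
  then have oM: "open (?o ` M)" using open_vimage[OF M(1) co] by simp
  show "open (chart b j k M ` ?U)" unfolding im by (rule oM)
  show "chart b j k M ` ?U \<subseteq> ball 0 1" unfolding im using M(2) by (auto simp: corner_star_def orient_def)
  have "continuous_map (top_of_set M) Y ?f"
    unfolding continuous_map_def
  proof (intro conjI allI impI)
    show "?f \<in> topspace (top_of_set M) \<rightarrow> topspace Y" using UY by auto
  next
    fix V assume V: "openin Y V"
    have "open {z \<in> M. ?f z \<in> V}"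
    proof (subst open_subopen, rule ballI)
      fix z assume z: "z \<in> {z \<in> M. ?f z \<in> V}"
      then obtain N where N: "open N" "z \<in> N" "\<And>y. y \<in> N \<Longrightarrow> ?f y \<in> V"
        using corner_map_eventually[OF adj _ b V, of z] M(2) unfolding eventually_nhds by blast
      then show "\<exists>T. open T \<and> z \<in> T \<and> T \<subseteq> {z \<in> M. ?f z \<in> V}"
        using z M(1) by (intro exI[of _ "N \<inter> M"]) auto
    qed
    then have "openin (top_of_set M) {z \<in> M. ?f z \<in> V}" by (intro open_subset) auto
    then show "openin (top_of_set M) {z \<in> topspace (top_of_set M). ?f z \<in> V}" by simp
  qed
  then have cont: "continuous_map (top_of_set M) (subtopology Y ?U) ?f"
    by (auto simp: continuous_map_in_subtopology)
  have opn: "open_map (top_of_set M) (subtopology Y ?U) ?f"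
    unfolding open_map_def
  proof (intro allI impI)
    fix V assume "openin (top_of_set M) V"
    then have "open V" "V \<subseteq> M" using M(1) openin_open_eq by auto
    then have "openin Y (?f ` V)" using corner_map_open[OF adj b] M(2) by auto
    then show "openin (subtopology Y ?U) (?f ` V)" using \<open>V \<subseteq> M\<close> by (auto simp: openin_subtopology)
  qed
  have "homeomorphic_map (top_of_set M) (subtopology Y ?U) ?f"
    using cont opn inj UY by (intro bijective_open_imp_homeomorphic_map) auto
  then obtain g where g: "homeomorphic_maps (top_of_set M) (subtopology Y ?U) ?f g"
    using homeomorphic_map_maps by blast
  then have hg: "homeomorphic_map (subtopology Y ?U) (top_of_set M) g" using homeomorphic_maps_map by blast
  have gf: "g (?f z) = z" if "z \<in> M" for z using g that by (auto simp: homeomorphic_maps_def)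
  have ho: "homeomorphic_map (top_of_set M) (top_of_set (?o ` M)) ?o"
    using co by (intro homeomorphic_maps_imp_map[of _ _ _ ?o]) (auto simp: homeomorphic_maps_def)
  have "homeomorphic_map (subtopology Y ?U) (top_of_set (?o ` M)) (?o \<circ> g)"
    by (rule homeomorphic_map_compose[OF hg ho])
  then show "homeomorphic_map (subtopology Y ?U) (top_of_set (chart b j k M ` ?U)) (chart b j k M)"
    unfolding im using chart_eval[OF inj] gf
    by (elim homeomorphic_map_eq) auto
qed

lemma atlas_transition:
  assumes 1: "b \<in> carrier B" "adjacent p j k" "open M" "M \<subseteq> corner_star j k" "inj_on (corner_map b j k) M"
    and 2: "b' \<in> carrier B" "adjacent p j' k'" "open M'" "M' \<subseteq> corner_star j' k'" "inj_on (corner_map b' j' k') M'"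
    and s: "s \<in> corner_map b j k ` M \<inter> corner_map b' j' k' ` M'"
  shows "\<exists>V t w. openin Y V \<and> s \<in> V \<and> V \<subseteq> corner_map b j k ` M \<inter> corner_map b' j' k' ` M' \<and> cmod w < 1 \<and>
        (\<forall>y\<in>V. chart b' j' k' M' y = Moebius_function t w (chart b j k M y))"
proof -
  obtain z z' where z: "z \<in> M" "s = corner_map b j k z" "z' \<in> M'" "s = corner_map b' j' k' z'" using s by auto
  have zc: "z \<in> corner_star j k" "z' \<in> corner_star j' k'" using z 1(4) 2(4) by auto
  have eq: "corner_map b j k z = corner_map b' j' k' z'" using z by simp
  obtain T where T: "disc_isometry (ori b = ori b') T" "T z = z'"
    "eventually (\<lambda>y. y \<in> corner_star j k \<and> T y \<in> corner_star j' k' \<and>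
       corner_map b' j' k' (T y) = corner_map b j k y) (nhds z)"
    by (rule corner_map_germ[OF 1(2) 2(2) 1(1) 2(1) zc eq])
  have zn: "cmod z < 1" using z 1(4) by (auto simp: corner_star_def)
  have "eventually (\<lambda>y. T y \<in> M') (nhds z)"
    using eventually_isometry[OF T(1) zn, of "\<lambda>y. y \<in> M'"] T(2) z(3) 2(3) by (simp add: eventually_nhds_in_open)
  then have "eventually (\<lambda>y. y \<in> M \<and> T y \<in> M' \<and> corner_map b' j' k' (T y) = corner_map b j k y) (nhds z)"
    using T(3) eventually_nhds_in_open[OF 1(3) z(1)] by eventually_elim auto
  then obtain N where N: "open N" "z \<in> N"
    "\<And>y. y \<in> N \<Longrightarrow> y \<in> M \<and> T y \<in> M' \<and> corner_map b' j' k' (T y) = corner_map b j k y"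
    unfolding eventually_nhds by blast
  define S where "S = orient (ori b') \<circ> (T \<circ> orient (ori b))"
  have "disc_isometry (ori b' = ((ori b = ori b') = ori b)) S"
    unfolding S_def by (intro disc_isometry_compose orient_isometry T)
  then have "disc_isometry True S" by (cases "ori b"; cases "ori b'"; simp)
  then obtain t w where tw: "cmod w < 1" "\<And>z. cmod z < 1 \<Longrightarrow> S z = Moebius_function t w z"
    by (rule disc_isometry_Moebius) metis
  have "chart b' j' k' M' y = Moebius_function t w (chart b j k M y)" if y: "y \<in> corner_map b j k ` N" for y
  proof -
    obtain v where v: "v \<in> N" "y = corner_map b j k v" using y by auto
    have c: "chart b j k M y = orient (ori b) v" using v N(3) chart_eval[OF 1(5)] by simp
    have y': "y = corner_map b' j' k' (T v)" and Tv: "T v \<in> M'" using v N(3) by auto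
    have "chart b' j' k' M' y = orient (ori b') (T v)" unfolding y' by (rule chart_eval[OF 2(5) Tv])
    also have "\<dots> = S (chart b j k M y)" unfolding c by (simp add: S_def)
    finally show ?thesis
      using tw(2)[of "chart b j k M y"] c N(3)[OF v(1)] 1(4) by (auto simp: corner_star_def orient_def)
  qed
  moreover have "openin Y (corner_map b j k ` N)" using N 1 by (intro corner_map_open) auto
  moreover have "corner_map b j k ` N \<subseteq> corner_map b j k ` M \<inter> corner_map b' j' k' ` M'"
  proof
    fix y assume "y \<in> corner_map b j k ` N"
    then obtain v where v: "v \<in> N" "y = corner_map b j k v" by auto
    then have "y = corner_map b' j' k' (T v)" "T v \<in> M'" "v \<in> M" using N(3) by auto
    then show "y \<in> corner_map b j k ` M \<inter> corner_map b' j' k' ` M'" using v by blast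
  qed
  ultimately show ?thesis using tw(1) N(2) z(2) by blast
qed

lemma atlas_oriented_hyperbolic: "oriented_hyperbolic_atlas Y atlas"
  unfolding oriented_hyperbolic_atlas_def
proof (intro conjI)
  have "topspace Y \<subseteq> \<Union>(fst ` atlas)"
  proof
    fix s assume "s \<in> topspace Y"
    then obtain b x where bx: "b \<in> carrier B" "x \<in> P" "s = cls b x" by (auto simp: topspace_Y)
    obtain j k where adj: "adjacent p j k" and xc: "x \<in> corner j k" using corner_exists[OF bx(2)] .
    obtain M where M: "open M" "x \<in> M" "M \<subseteq> corner_star j k" "inj_on (corner_map b j k) M"
      using corner_map_locally_inj[OF adj corner_map_corner(1)[OF xc bx(1)] bx(1)] .
    have "(corner_map b j k ` M, chart b j k M) \<in> atlas" using M bx adj unfolding atlas_def by blast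
    moreover have "s \<in> corner_map b j k ` M" using M(2) bx(3) corner_map_corner(2)[OF xc bx(1)] by auto
    ultimately show "s \<in> \<Union>(fst ` atlas)" by force
  qed
  moreover have "\<Union>(fst ` atlas) \<subseteq> topspace Y"
  proof
    fix s assume "s \<in> \<Union>(fst ` atlas)"
    then obtain b j k M where "b \<in> carrier B" "adjacent p j k" "M \<subseteq> corner_star j k" "s \<in> corner_map b j k ` M"
      by (auto simp: atlas_def)
    then show "s \<in> topspace Y" using corner_map_in[of j k _ b] by blast
  qed
  ultimately show "\<Union>(fst ` atlas) = topspace Y" by auto
  show "\<forall>(U, \<phi>)\<in>atlas. openin Y U \<and> open (\<phi> ` U) \<and> \<phi> ` U \<subseteq> ball 0 1 \<and>
        homeomorphic_map (subtopology Y U) (top_of_set (\<phi> ` U)) \<phi>"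
  proof clarify
    fix U \<phi> assume "(U, \<phi>) \<in> atlas"
    then obtain b j k M where 1: "U = corner_map b j k ` M" "\<phi> = chart b j k M"
      "b \<in> carrier B" "adjacent p j k" "open M" "M \<subseteq> corner_star j k" "inj_on (corner_map b j k) M"
      unfolding atlas_def by blast
    show "openin Y U \<and> open (\<phi> ` U) \<and> \<phi> ` U \<subseteq> ball 0 1 \<and>
        homeomorphic_map (subtopology Y U) (top_of_set (\<phi> ` U)) \<phi>"
      unfolding 1(1,2) using chart_homeomorphic[OF 1(3-7)] corner_map_open[OF 1(4,3,5,6)] by blast
  qed
  show "\<forall>(U, \<phi>)\<in>atlas. \<forall>(V, \<psi>)\<in>atlas. \<forall>x\<in>U \<inter> V. \<exists>W t w. openin Y W \<and> x \<in> W \<and> W \<subseteq> U \<inter> V \<and> cmod w < 1 \<and>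
        (\<forall>y\<in>W. \<psi> y = Moebius_function t w (\<phi> y))"
  proof (clarify)
    fix U \<phi> V \<psi> x assume a: "(U, \<phi>) \<in> atlas" "(V, \<psi>) \<in> atlas" "x \<in> U" "x \<in> V"
    obtain b j k M where 1: "U = corner_map b j k ` M" "\<phi> = chart b j k M"
      "b \<in> carrier B" "adjacent p j k" "open M" "M \<subseteq> corner_star j k" "inj_on (corner_map b j k) M"
      using a(1) unfolding atlas_def by blast
    obtain b' j' k' M' where 2: "V = corner_map b' j' k' ` M'" "\<psi> = chart b' j' k' M'"
      "b' \<in> carrier B" "adjacent p j' k'" "open M'" "M' \<subseteq> corner_star j' k'" "inj_on (corner_map b' j' k') M'"
      using a(2) unfolding atlas_def by blast
    show "\<exists>W t w. openin Y W \<and> x \<in> W \<and> W \<subseteq> U \<inter> V \<and> cmod w < 1 \<and> (\<forall>y\<in>W. \<psi> y = Moebius_function t w (\<phi> y))"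
      unfolding 1(1,2) 2(1,2) using a(3,4) 1 2 by (intro atlas_transition) auto
  qed
qed

lemma surface_Y: "compact_oriented_hyperbolic_surface Y atlas"
  unfolding compact_oriented_hyperbolic_surface_def
  using compact_Y connected_Y Hausdorff_Y atlas_oriented_hyperbolic by blast

lemma chambers_isometric: "chambers_locally_isometric p (\<lambda>_. 4) Gam atlas"
  unfolding chambers_locally_isometric_def locally_isometric_def
proof (clarify)
  fix h U \<phi> x assume h: "h \<in> carrier W" and a: "(U, \<phi>) \<in> atlas" and x: "x \<in> P" "orbit_of Gam (bp h x) \<in> U"
  obtain b j k M where 1: "U = corner_map b j k ` M" "\<phi> = chart b j k M"
    "b \<in> carrier B" "adjacent p j k" "open M" "M \<subseteq> corner_star j k" "inj_on (corner_map b j k) M"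
    using a unfolding atlas_def by blast
  define c where "c = \<Theta> h"
  have c: "c \<in> carrier B" using Theta_closed[OF h] by (simp add: c_def)
  have oc: "orbit_of Gam (bp h y) = cls c y" if "y \<in> P" for y using orbit_cls[OF h that] by (simp add: c_def)
  obtain z where z: "z \<in> M" "cls c x = corner_map b j k z" using x(2) 1(1) oc[OF x(1)] by auto
  obtain j' k' where adj: "adjacent p j' k'" and xc: "x \<in> corner j' k'" using corner_exists[OF x(1)] .
  have "corner_map c j' k' x = corner_map b j k z" using corner_map_corner(2)[OF xc c] z(2) by simp
  then obtain T where T: "disc_isometry (ori c = ori b) T" "T x = z"
    "eventually (\<lambda>y. y \<in> corner_star j' k' \<and> T y \<in> corner_star j k \<and>
       corner_map b j k (T y) = corner_map c j' k' y) (nhds x)"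
    using corner_map_germ[OF adj 1(4) c 1(3) corner_map_corner(1)[OF xc c], of z] z(1) 1(6) by blast
  have "eventually (\<lambda>y. T y \<in> M) (nhds x)"
    using eventually_isometry[OF T(1) polygonD(1)[OF x(1)], of "\<lambda>y. y \<in> M"] T(2) z(1) 1(5)
    by (simp add: eventually_nhds_in_open)
  then have "eventually (\<lambda>y. y \<in> P \<longrightarrow> T y \<in> M \<and> cls c y = corner_map b j k (T y)) (nhds x)"
    using T(3) eventually_sides[of x]
  proof eventually_elim
    case (elim y)
    then show ?case using corner_map_corner(2)[OF _ c, of y j' k'] xc by (auto simp: corner_def)
  qed
  then obtain N where N: "open N" "x \<in> N" "\<And>y. y \<in> N \<Longrightarrow> y \<in> P \<Longrightarrow> T y \<in> M \<and> cls c y = corner_map b j k (T y)"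
    unfolding eventually_nhds by blast
  show "\<exists>N. openin (top_of_set P) N \<and> x \<in> N \<and> (\<lambda>x. orbit_of Gam (bp h x)) ` N \<subseteq> U \<and>
     (\<forall>y\<in>N. \<forall>z\<in>N. hyp_dist (\<phi> (orbit_of Gam (bp h y))) (\<phi> (orbit_of Gam (bp h z))) = hyp_dist y z)"
  proof (intro exI[of _ "P \<inter> N"] conjI ballI)
    show "openin (top_of_set P) (P \<inter> N)" using N(1) by (auto simp: openin_open)
    show "x \<in> P \<inter> N" using x N by auto
    show "(\<lambda>x. orbit_of Gam (bp h x)) ` (P \<inter> N) \<subseteq> U" using oc N(3) 1(1) by auto
    fix y v assume yv: "y \<in> P \<inter> N" "v \<in> P \<inter> N"
    have e: "\<phi> (orbit_of Gam (bp h y)) = (orient (ori b) \<circ> T) y" if "y \<in> P \<inter> N" for y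
      using that oc[of y] N(3)[of y] chart_eval[OF 1(7)] by (simp add: 1(2))
    have "disc_isometry (ori b = (ori c = ori b)) (orient (ori b) \<circ> T)"
      by (intro disc_isometry_compose orient_isometry T)
    then show "hyp_dist (\<phi> (orbit_of Gam (bp h y))) (\<phi> (orbit_of Gam (bp h v))) = hyp_dist y v"
      unfolding e[OF yv(1)] e[OF yv(2)] by (rule hyp_dist_disc_isometry) (use yv polygonD(1) in auto)
  qed
qed

section \<open>Cells and the Euler characteristic\<close>

text \<open>
  A cell of the polygon is given by the set \<open>J\<close> of sides on which it lies; it has codimension
  \<open>card J\<close>.
\<close>

definition strata :: "nat \<Rightarrow> nat set set" where
  "strata k = {J. card J = k \<and> (\<exists>x\<in>P. sides p x = J)}"

definition cell :: "'a \<Rightarrow> nat set \<Rightarrow> building_point set set" where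
  "cell b J = cls b ` {x \<in> P. sides p x = J}"

definition cells :: "nat \<Rightarrow> building_point set set set" where
  "cells k = (\<lambda>(b, J). cell b J) ` (carrier B \<times> strata k)"

lemma strata_cases:
  "strata 0 = {{}}" "strata 1 = (\<lambda>j. {j}) ` {..<p}" "strata 2 = (\<lambda>j. {j, nxt p j}) ` {..<p}"
proof -
  have c: "card {j, nxt p j} = 2" if "j < p" for j using nxt(2)[OF that] by (metis card_2_iff)
  have ex: "\<exists>x\<in>P. sides p x = {}" "j < p \<Longrightarrow> \<exists>x\<in>P. sides p x = {j}"
    "j < p \<Longrightarrow> \<exists>x\<in>P. sides p x = {j, nxt p j}" for j
    using zero_in side_midpoint vert_in sides_vert by blast+
  have cs: "J = {} \<or> card J = 1 \<and> (\<exists>j<p. J = {j}) \<or> card J = 2 \<and> (\<exists>j<p. J = {j, nxt p j})"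
    if ex_x: "\<exists>x\<in>P. sides p x = J" for J
  proof -
    obtain x where "x \<in> P" "sides p x = J" using ex_x by blast
    from this(1) show ?thesis
    proof (cases rule: sides_cases)
      case (3 j)
      then show ?thesis using \<open>sides p x = J\<close> c[OF 3(1)] by auto
    qed (use \<open>sides p x = J\<close> in auto)
  qed
  show "strata 0 = {{}}"
  proof (intro equalityI subsetI)
    fix J assume "J \<in> strata 0"
    then show "J \<in> {{}}" using cs[of J] by (auto simp: strata_def)
  qed (use ex(1) in \<open>simp add: strata_def\<close>)
  show "strata 1 = (\<lambda>j. {j}) ` {..<p}"
  proof (intro equalityI subsetI)
    fix J assume "J \<in> strata 1"
    then show "J \<in> (\<lambda>j. {j}) ` {..<p}" using cs[of J] by (auto simp: strata_def)
  qed (use ex(2) in \<open>auto simp: strata_def\<close>)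
  show "strata 2 = (\<lambda>j. {j, nxt p j}) ` {..<p}"
  proof (intro equalityI subsetI)
    fix J assume "J \<in> strata 2"
    then show "J \<in> (\<lambda>j. {j, nxt p j}) ` {..<p}" using cs[of J] by (auto simp: strata_def)
  qed (use ex(3) c in \<open>auto simp: strata_def\<close>)
qed

lemma card_strata: "card (strata 0) = 1" "card (strata 1) = p" "card (strata 2) = p"
  unfolding strata_cases using nxt_pair_inj by (simp_all add: card_image inj_on_def)

lemma strata_le: "x \<in> P \<Longrightarrow> sides p x \<in> strata 0 \<union> strata 1 \<union> strata 2"
  using sides_cases[of x] unfolding strata_cases by blast

lemma strata_finite: "k \<le> 2 \<Longrightarrow> finite (strata k)"
  using strata_cases by (cases "k = 0"; cases "k = 1"; cases "k = 2") auto

lemma act_sides: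
  assumes "a \<in> A" "J = sides p x" "x \<in> P"
  shows "act (inv a) ` act a ` J = J" "act a ` act (inv a) ` J = J" "card (act a ` J) = card J"
proof -
  have J: "i \<in> J \<Longrightarrow> i < p" for i using assms by (auto simp: sides_def)
  show 1: "act (inv a) ` act a ` J = J" using act_inv[OF assms(1)] J by (force simp: image_iff)
  show "act a ` act (inv a) ` J = J" using act_inv'[OF assms(1)] J by (force simp: image_iff)
  have "inj_on (act a) J" using act_inv[OF assms(1)] J by (metis inj_onI)
  then show "card (act a ` J) = card J" by (rule card_image)
qed

text \<open>
  Points of two cells can only be identified through the labels of the cells and their sides; by
  \<open>cell_eqI\<close> such an identification then applies to the whole cells. So the cells are disjoint
  or equal.
\<close>

lemma cls_meet:
  assumes "b \<in> carrier B" "b' \<in> carrier B" "cell b J \<inter> cell b' J' \<noteq> {}"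
  shows "\<exists>a\<in>A. J' = act a ` J \<and> (\<exists>u. set u \<subseteq> J' \<and> b \<otimes> inv a = b' \<otimes> wprod u)"
proof -
  obtain x x' where x: "x \<in> P" "sides p x = J" "x' \<in> P" "sides p x' = J'" "cls b x = cls b' x'"
    using assms(3) unfolding cell_def by blast
  then obtain a g where a: "a \<in> A" "x' = iso a x" "g \<in> locgrp x'" "b \<otimes> inv a = b' \<otimes> g"
    using cls_eq[OF assms(1) x(1) assms(2) x(3)] by auto
  then obtain u where "set u \<subseteq> J'" "g = wprod u" using x by (auto simp: locgrp_def)
  then show ?thesis using a x sides_iso[OF a(1), of x] by metis
qed

lemma cell_eqI:
  assumes "b \<in> carrier B" "b' \<in> carrier B" "a \<in> A" "J' = act a ` J" "set u \<subseteq> J'"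
    "b \<otimes> inv a = b' \<otimes> wprod u" "J = sides p x0" "x0 \<in> P"
  shows "cell b J = cell b' J'"
proof -
  have e: "cls b x = cls b' (iso a x)" "sides p (iso a x) = J'" "iso a x \<in> P" if "x \<in> P" "sides p x = J" for x
  proof -
    show i: "iso a x \<in> P" by (rule iso_polygon[OF assms(3) that(1)])
    show s: "sides p (iso a x) = J'" using sides_iso[OF assms(3), of x] that assms(4) by simp
    have "wprod u \<in> locgrp (iso a x)" using assms(5) s by (auto simp: locgrp_def)
    then show "cls b x = cls b' (iso a x)"
      using cls_eq[OF assms(1) that(1) assms(2) i] assms(3,6) by blast
  qed
  show ?thesis
  proof
    show "cell b J \<subseteq> cell b' J'"
    proof
      fix s assume "s \<in> cell b J"
      then obtain x where x: "x \<in> P" "sides p x = J" "s = cls b x" by (auto simp: cell_def)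
      then show "s \<in> cell b' J'" using e[OF x(1,2)] unfolding cell_def by blast
    qed
    show "cell b' J' \<subseteq> cell b J"
    proof
      fix s assume "s \<in> cell b' J'"
      then obtain x' where x': "x' \<in> P" "sides p x' = J'" "s = cls b' x'" by (auto simp: cell_def)
      let ?x = "iso (inv a) x'"
      have ia: "inv a \<in> A" using A_closed assms(3) by simp
      have x: "?x \<in> P" "sides p ?x = J"
        using iso_polygon[OF ia x'(1)] sides_iso[OF ia, of x'] x'(2) assms(4) act_sides(1)[OF assms(3,7,8)] by auto
      then have "s = cls b ?x" using e(1)[OF x] x'(3) iso_inv(2)[OF assms(3)] by simp
      then show "s \<in> cell b J" using x unfolding cell_def by blast
    qed
  qed
qed

lemma strataE:
  assumes "J \<in> strata k"
  obtains x where "x \<in> P" "sides p x = J" "card J = k"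
  using assms by (auto simp: strata_def)

lemma cell_nonempty: "J \<in> strata k \<Longrightarrow> cell b J \<noteq> {}"
  by (auto simp: strata_def cell_def)

lemma cell_eq_iff:
  assumes "b \<in> carrier B" "b' \<in> carrier B" "J \<in> strata k" "J' \<in> strata l"
  shows "cell b J = cell b' J' \<longleftrightarrow> (\<exists>a\<in>A. J' = act a ` J \<and> (\<exists>u. set u \<subseteq> J' \<and> b \<otimes> inv a = b' \<otimes> wprod u))"
proof
  assume "cell b J = cell b' J'"
  then show "\<exists>a\<in>A. J' = act a ` J \<and> (\<exists>u. set u \<subseteq> J' \<and> b \<otimes> inv a = b' \<otimes> wprod u)"
    using cls_meet[OF assms(1,2), of J J'] cell_nonempty[OF assms(4), of b'] by simp
next
  obtain x where "x \<in> P" "sides p x = J" using strataE[OF assms(3)] by metis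
  moreover assume "\<exists>a\<in>A. J' = act a ` J \<and> (\<exists>u. set u \<subseteq> J' \<and> b \<otimes> inv a = b' \<otimes> wprod u)"
  ultimately show "cell b J = cell b' J'" using cell_eqI[OF assms(1,2)] by metis
qed

lemma cells_disjoint:
  assumes "c \<in> cells k" "d \<in> cells l" "c \<inter> d \<noteq> {}"
  shows "c = d" "k = l"
proof -
  obtain b J where c: "b \<in> carrier B" "J \<in> strata k" "c = cell b J" using assms(1) by (auto simp: cells_def)
  obtain b' J' where d: "b' \<in> carrier B" "J' \<in> strata l" "d = cell b' J'" using assms(2) by (auto simp: cells_def)
  have ex: "\<exists>a\<in>A. J' = act a ` J \<and> (\<exists>u. set u \<subseteq> J' \<and> b \<otimes> inv a = b' \<otimes> wprod u)"
    using cls_meet[OF c(1) d(1)] assms(3) c d by simp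
  then show "c = d" using cell_eq_iff[OF c(1) d(1) c(2) d(2)] c d by simp
  obtain x where x: "x \<in> P" "sides p x = J" "card J = k" using strataE[OF c(2)] .
  obtain a where a: "a \<in> A" "J' = act a ` J" using ex by blast
  have "card J' = card J" using act_sides(3)[OF a(1) x(2)[symmetric] x(1)] a(2) by simp
  then show "k = l" using x(3) strataE[OF d(2)] by metis
qed

lemma card_local:
  assumes "J \<in> strata k" "k \<le> 2"
  shows "card (wprod ` {u. set u \<subseteq> J}) = 2 ^ k"
proof -
  consider "k = 0" | "k = 1" | "k = 2" using assms(2) by linarith
  then show ?thesis
  proof cases
    case 1
    then have "J = {}" using assms(1) strata_cases(1) by simp
    then have "wprod ` {u. set u \<subseteq> J} = {\<one>}" by (auto simp: image_iff)
    then show ?thesis using 1 by simp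
  next
    case 2
    then obtain j where j: "j < p" "J = {j}" using assms(1) strata_cases(2) by auto
    have "set u \<subseteq> {j} \<Longrightarrow> wprod u \<in> {\<one>, \<theta> j}" for u
      using th_sq[OF j(1)] th_closed[OF j(1)] by (induction u) auto
    moreover have "wprod [] = \<one>" "wprod [j] = \<theta> j" using th_closed[OF j(1)] by auto
    ultimately have "wprod ` {u. set u \<subseteq> J} = {\<one>, \<theta> j}"
      unfolding j(2) by (auto intro: image_eqI[of _ _ "[]"] image_eqI[of _ _ "[j]"])
    then show ?thesis using 2 th_ne_one[OF j(1)] by simp
  next
    case 3
    then obtain j where j: "j < p" "J = {j, nxt p j}" using assms(1) strata_cases(3) by auto
    define k where "k = nxt p j"
    have adj: "adjacent p j k" using adjacent_nxt[OF j(1)] by (simp add: k_def)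
    have kp: "k < p" using nxt(1)[OF j(1)] by (simp add: k_def)
    note c = th_closed[OF j(1)] th_closed[OF kp]
    have ne: "\<theta> j \<noteq> \<one>" "\<theta> k \<noteq> \<one>" "\<theta> j \<noteq> \<theta> k" using th_ne_one j kp th_ne[OF adj] by auto
    have ne2: "\<theta> j \<otimes> \<theta> k \<noteq> \<one>"
    proof
      assume "\<theta> j \<otimes> \<theta> k = \<one>"
      then have "\<theta> j \<otimes> (\<theta> j \<otimes> \<theta> k) = \<theta> j" using c by simp
      then have "\<theta> k = \<theta> j" using c th_sq[OF j(1)] by (simp add: m_assoc[symmetric])
      then show False using ne by simp
    qed
    have "wprod ` {u. set u \<subseteq> J} = wprod ` {[], [j], [k], [j, k]}"
    proof
      show "wprod ` {u. set u \<subseteq> J} \<subseteq> wprod ` {[], [j], [k], [j, k]}"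
        using corner_word_form[OF adj] unfolding j(2) k_def[symmetric] by blast
      show "wprod ` {[], [j], [k], [j, k]} \<subseteq> wprod ` {u. set u \<subseteq> J}"
        unfolding j(2) k_def[symmetric] by (intro image_mono) auto
    qed
    also have "\<dots> = {\<one>, \<theta> j, \<theta> k, \<theta> j \<otimes> \<theta> k}" using c by simp
    also have "card \<dots> = 4"
      using ne ne2 c ne[symmetric] ne2[symmetric] by (simp add: card_insert_if)
    finally show ?thesis using 3 by simp
  qed
qed

text \<open>
  A pair \<open>(g, a)\<close> of an element of the local group of the cell and an element of \<open>A\<close> carries the
  representative \<open>(b', J')\<close> to another representative of the same cell. Every representative
  arises in this way, and by \<open>free_cell\<close> no two pairs have the same effect.
\<close>

lemma card_fibre:
  assumes "b' \<in> carrier B" "J' \<in> strata k" "k \<le> 2"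
  shows "card {x \<in> carrier B \<times> strata k. (\<lambda>(b, J). cell b J) x = cell b' J'} = card A * 2 ^ k"
proof -
  obtain x where x: "x \<in> P" "sides p x = J'" "card J' = k" using strataE[OF assms(2)] .
  define H where "H = wprod ` {u. set u \<subseteq> J'}"
  have H: "H = locgrp x" using x by (simp add: H_def locgrp_def)
  have Hc: "g \<in> carrier B" if "g \<in> H" for g using that H locgrp_closed by simp
  define f where "f = (\<lambda>(g, a). (b' \<otimes> g \<otimes> a, act (inv a) ` J'))"
  have "{x \<in> carrier B \<times> strata k. (\<lambda>(b, J). cell b J) x = cell b' J'} = f ` (H \<times> A)"
  proof
    show "{x \<in> carrier B \<times> strata k. (\<lambda>(b, J). cell b J) x = cell b' J'} \<subseteq> f ` (H \<times> A)"
    proof clarify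
      fix b J assume b: "b \<in> carrier B" "J \<in> strata k" "cell b J = cell b' J'"
      then obtain a u where a: "a \<in> A" "J' = act a ` J" "set u \<subseteq> J'" "b \<otimes> inv a = b' \<otimes> wprod u"
        using cell_eq_iff[OF b(1) assms(1) b(2) assms(2)] by auto
      obtain y where y: "y \<in> P" "sides p y = J" using strataE[OF b(2)] by metis
      have u: "wprod u \<in> H" using a(3) by (simp add: H_def)
      have "b' \<otimes> wprod u \<otimes> a = b \<otimes> inv a \<otimes> a" using a(4) by simp
      also have "\<dots> = b" using b(1) A_closed(1)[OF a(1)] by (simp add: m_assoc)
      finally have "f (wprod u, a) = (b, J)"
        using a(2) act_sides(1)[OF a(1) y(2)[symmetric] y(1)] by (simp add: f_def)
      then show "(b, J) \<in> f ` (H \<times> A)" using u a(1) by (metis SigmaI imageI)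
    qed
    show "f ` (H \<times> A) \<subseteq> {x \<in> carrier B \<times> strata k. (\<lambda>(b, J). cell b J) x = cell b' J'}"
    proof (rule image_subsetI)
      fix y assume "y \<in> H \<times> A"
      then obtain g a where y: "y = (g, a)" and g: "g \<in> H" and a: "a \<in> A" by auto
      note gc = Hc[OF g] and aA = A_closed(1,2)[OF a]
      let ?b = "b' \<otimes> g \<otimes> a" and ?J = "act (inv a) ` J'"
      have J: "J' = act a ` ?J" using act_sides(2)[OF a x(2)[symmetric] x(1)] by simp
      obtain u where u: "set u \<subseteq> J'" "g = wprod u" using g by (auto simp: H_def)
      have "?J = sides p (iso (inv a) x)" using sides_iso[OF aA(2)] x(2) by simp
      then have st: "?J \<in> strata k"
        using iso_polygon[OF aA(2) x(1)] act_sides(3)[OF aA(2) x(2)[symmetric] x(1)] x(3)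
        unfolding strata_def by auto
      have bc: "?b \<in> carrier B" using gc aA assms(1) by simp
      have "?b \<otimes> inv a = b' \<otimes> wprod u" using gc aA assms(1) u(2) by (simp add: m_assoc)
      then have "cell ?b ?J = cell b' J'"
        using cell_eq_iff[OF bc assms(1) st assms(2)] a J u(1) by metis
      then show "f y \<in> {x \<in> carrier B \<times> strata k. (\<lambda>(b, J). cell b J) x = cell b' J'}"
        using bc st by (simp add: f_def y)
    qed
  qed
  moreover have "inj_on f (H \<times> A)"
  proof (rule inj_onI)
    fix y1 y2 assume y: "y1 \<in> H \<times> A" "y2 \<in> H \<times> A" "f y1 = f y2"
    obtain g1 a1 g2 a2 where ya: "y1 = (g1, a1)" "y2 = (g2, a2)" by (cases y1, cases y2) auto
    have g: "g1 \<in> H" "g2 \<in> H" and a: "a1 \<in> A" "a2 \<in> A" and e: "f (g1, a1) = f (g2, a2)"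
      using y by (auto simp: ya)
    note c = Hc[OF g(1)] Hc[OF g(2)] A_closed(1)[OF a(1)] A_closed(1)[OF a(2)] assms(1)
    have e1: "b' \<otimes> g1 \<otimes> a1 = b' \<otimes> g2 \<otimes> a2" and e2: "act (inv a1) ` J' = act (inv a2) ` J'"
      using e by (auto simp: f_def)
    have "inv b' \<otimes> (b' \<otimes> (g1 \<otimes> a1)) = inv b' \<otimes> (b' \<otimes> (g2 \<otimes> a2))" using e1 c by (simp add: m_assoc)
    then have e3: "g1 \<otimes> a1 = g2 \<otimes> a2" using c by (simp add: inv_cancel)
    define d where "d = a2 \<otimes> inv a1"
    have dA: "d \<in> A" using a A_closed by (simp add: d_def)
    have "inv g2 \<otimes> g1 = inv g2 \<otimes> (g1 \<otimes> a1) \<otimes> inv a1" using c by (simp add: m_assoc)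
    also have "\<dots> = d" unfolding e3 d_def using c by (simp add: inv_cancel)
    finally have d: "d = inv g2 \<otimes> g1" by simp
    then have dH: "d \<in> locgrp x" using g locgrp_mult locgrp_inv H by simp
    have "act d ` J' = act a2 ` act (inv a1) ` J'"
      unfolding d_def image_image using a A_closed(2) x(2)
      by (intro image_cong HOL.refl act_mult) (auto simp: sides_def)
    also have "\<dots> = J'" unfolding e2 using act_sides(2)[OF a(2) x(2)[symmetric] x(1)] .
    finally have "d = \<one>" using free_cell[OF x(1) dA _ dH] x(2) by simp
    then have "a2 \<otimes> inv a1 \<otimes> a1 = a1" using c by (simp add: d_def)
    then have aa: "a2 = a1" using c by (simp add: m_assoc)
    have "g1 \<otimes> a1 \<otimes> inv a1 = g2 \<otimes> a1 \<otimes> inv a1" using e3 aa by simp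
    then show "y1 = y2" using c aa by (simp add: m_assoc ya)
  qed
  ultimately have "card {x \<in> carrier B \<times> strata k. (\<lambda>(b, J). cell b J) x = cell b' J'} = card (H \<times> A)"
    by (simp add: card_image)
  also have "\<dots> = card A * 2 ^ k" using card_local[OF assms(2,3)] by (simp add: H_def card_cartesian_product)
  finally show ?thesis .
qed

lemma card_cells:
  assumes "k \<le> 2"
  shows "finite (cells k)" "card (cells k) * (card A * 2 ^ k) = card (carrier B) * card (strata k)"
proof -
  let ?S = "carrier B \<times> strata k" and ?f = "\<lambda>(b, J). cell b J"
  have fin: "finite ?S" using finite_B strata_finite[OF assms] by simp
  then show "finite (cells k)" by (simp add: cells_def)
  have "card ?S = (\<Sum>x\<in>?S. 1)" by simp
  also have "\<dots> = (\<Sum>c\<in>cells k. \<Sum>x\<in>{x \<in> ?S. ?f x = c}. 1)"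
    unfolding cells_def by (rule sum.image_gen[OF fin])
  also have "\<dots> = (\<Sum>c\<in>cells k. card A * 2 ^ k)"
  proof (rule sum.cong[OF HOL.refl])
    fix c assume "c \<in> cells k"
    then obtain b' J' where "b' \<in> carrier B" "J' \<in> strata k" "c = cell b' J'" by (auto simp: cells_def)
    then show "(\<Sum>x\<in>{x \<in> ?S. ?f x = c}. 1) = card A * 2 ^ k" using card_fibre[of b' J' k] assms by simp
  qed
  finally show "card (cells k) * (card A * 2 ^ k) = card (carrier B) * card (strata k)"
    by (simp add: card_cartesian_product)
qed

lemma cls_inj_cell:
  assumes "b \<in> carrier B"
  shows "inj_on (cls b) {x \<in> P. sides p x = J}"
proof (rule inj_onI, clarify)
  fix x y assume x: "x \<in> P" and y: "y \<in> P" "sides p y = sides p x" and e: "cls b x = cls b y"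
  obtain a g where a: "a \<in> A" "y = iso a x" "g \<in> locgrp y" "b \<otimes> inv a = b \<otimes> g"
    using cls_eq[OF assms x assms y(1)] e by auto
  note c = A_closed(1)[OF a(1)] locgrp_closed[OF a(3)] assms
  have "inv b \<otimes> (b \<otimes> inv a) = inv b \<otimes> (b \<otimes> g)" using a(4) by simp
  then have "inv a = g" using c by (simp add: inv_cancel)
  then have "a = inv g" using c by (metis inv_inv)
  then have aL: "a \<in> locgrp x" using a(3) locgrp_inv y(2) by (simp add: locgrp_def)
  have "act a ` sides p x = sides p x" using sides_iso[OF a(1), of x] a(2) y(2) by simp
  then have "a = \<one>" using free_cell[OF x a(1) _ aL] by simp
  then show "x = y" using a(2) iso_one by simp
qed

lemma vertex_cell:
  assumes "J \<in> strata 2"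
  obtains v where "v \<in> P" "sides p v = J" "\<And>b. cell b J = {cls b v}"
proof -
  obtain j where j: "j < p" "J = {j, nxt p j}" using assms strata_cases(3) by auto
  have "{x \<in> P. sides p x = J} = {vert j}" using sides_eq_pair[OF _ j(1)] vert_in sides_vert[OF j(1)] j(2) by auto
  then show ?thesis using that[of "vert j"] vert_in sides_vert[OF j(1)] j(2) by (auto simp: cell_def)
qed

lemma CW_structure:
  obtains V where "finite_CW_2 Y V (cells 1) (cells 0)" "card V = card (cells 2)"
proof -
  define V where "V = {cls b x | b x. b \<in> carrier B \<and> x \<in> P \<and> sides p x \<in> strata 2}"
  have V: "(\<lambda>v. {v}) ` V = cells 2"
  proof
    show "(\<lambda>v. {v}) ` V \<subseteq> cells 2"
    proof clarify
      fix v assume "v \<in> V"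
      then obtain b x where x: "b \<in> carrier B" "x \<in> P" "sides p x \<in> strata 2" "v = cls b x" by (auto simp: V_def)
      obtain w where "\<And>b. cell b (sides p x) = {cls b w}" using vertex_cell[OF x(3)] by metis
      moreover have "v \<in> cell b (sides p x)" using x by (auto simp: cell_def)
      ultimately have "{v} = cell b (sides p x)" by auto
      then show "{v} \<in> cells 2" using x unfolding cells_def by force
    qed
    show "cells 2 \<subseteq> (\<lambda>v. {v}) ` V"
    proof
      fix c assume "c \<in> cells 2"
      then obtain b J where c: "b \<in> carrier B" "J \<in> strata 2" "c = cell b J" by (auto simp: cells_def)
      obtain w where "w \<in> P" "sides p w = J" "\<And>b. cell b J = {cls b w}" using vertex_cell[OF c(2)] by metis
      then show "c \<in> (\<lambda>v. {v}) ` V" using c unfolding V_def by blast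
    qed
  qed
  have injV: "inj_on (\<lambda>v. {v}) V" by (simp add: inj_on_def)
  have cV: "card V = card (cells 2)" using card_image[OF injV] V by simp
  have fV: "finite V" using finite_imageD[OF _ injV] V card_cells(1)[of 2] by simp
  have mem: "cls b x \<in> V \<union> \<Union>(cells 1)" if bx: "b \<in> carrier B" "x \<in> P" "sides p x \<noteq> {}" for b x
  proof -
    consider "sides p x \<in> strata 1" | "sides p x \<in> strata 2"
      using strata_le[OF bx(2)] bx(3) strata_cases(1) by auto
    then show ?thesis
    proof cases
      case 1
      then have "cell b (sides p x) \<in> cells 1" "cls b x \<in> cell b (sides p x)"
        using bx by (auto simp: cells_def cell_def)
      then show ?thesis by blast
    qed (use bx in \<open>auto simp: V_def\<close>)
  qed
  have allc: "(\<lambda>v. {v}) ` V \<union> cells 1 \<union> cells 0 = cells 2 \<union> cells 1 \<union> cells 0" using V by simp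
  have part: "partition_on (topspace Y) ((\<lambda>v. {v}) ` V \<union> cells 1 \<union> cells 0)"
    unfolding allc partition_on_def
  proof (intro conjI)
    show "\<Union>(cells 2 \<union> cells 1 \<union> cells 0) = topspace Y"
    proof
      show "\<Union>(cells 2 \<union> cells 1 \<union> cells 0) \<subseteq> topspace Y"
        using cls_in by (auto simp: cells_def cell_def)
      show "topspace Y \<subseteq> \<Union>(cells 2 \<union> cells 1 \<union> cells 0)"
      proof
        fix s assume "s \<in> topspace Y"
        then obtain b x where bx: "b \<in> carrier B" "x \<in> P" "s = cls b x" by (auto simp: topspace_Y)
        then have "s \<in> cell b (sides p x)" by (auto simp: cell_def)
        moreover have "cell b (sides p x) \<in> cells 2 \<union> cells 1 \<union> cells 0"
          using strata_le[OF bx(2)] bx(1) by (auto simp: cells_def)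
        ultimately show "s \<in> \<Union>(cells 2 \<union> cells 1 \<union> cells 0)" by blast
      qed
    qed
    show "disjoint (cells 2 \<union> cells 1 \<union> cells 0)"
      unfolding disjoint_def using cells_disjoint(1) by blast
    show "{} \<notin> cells 2 \<union> cells 1 \<union> cells 0"
      using cell_nonempty by (auto simp: cells_def)
  qed
  have EF: "cells 1 \<inter> cells 0 = {}"
  proof (rule ccontr)
    assume "cells 1 \<inter> cells 0 \<noteq> {}"
    then obtain c where c: "c \<in> cells 1" "c \<in> cells 0" by blast
    then obtain b J where "J \<in> strata 0" "c = cell b J" by (auto simp: cells_def)
    then have "c \<inter> c \<noteq> {}" using cell_nonempty by simp
    then show False using cells_disjoint(2)[OF c] by simp
  qed
  have edge: "\<exists>\<Phi>. continuous_map (top_of_set {0..1::real}) Y \<Phi> \<and> inj_on \<Phi> {0<..<1} \<and>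
        \<Phi> ` {0<..<1} = e \<and> \<Phi> ` {0, 1} \<subseteq> V" if eC: "e \<in> cells 1" for e
  proof -
    obtain b j where e: "b \<in> carrier B" "j < p" "e = cell b {j}"
      using eC unfolding cells_def strata_cases(2) by auto
    define r where "r t = q0 * (2 * t - 1)" for t :: real
    define \<gamma> where "\<gamma> t = side_arc j (r t)" for t
    have r01: "\<bar>r t\<bar> \<le> q0" if "t \<in> {0..1}" for t
    proof -
      have "\<bar>2 * t - 1\<bar> \<le> 1" using that by auto
      then show ?thesis using q0(1) by (simp add: r_def abs_mult)
    qed
    have rl: "\<bar>r t\<bar> < q0" if "t \<in> {0<..<1}" for t
    proof -
      have "\<bar>2 * t - 1\<bar> < 1" using that by auto
      then show ?thesis using q0(1) by (simp add: r_def abs_mult)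
    qed
    have rc: "continuous_on {0..1} r" unfolding r_def[abs_def] by (intro continuous_intros)
    have gc: "continuous_on {0..1} \<gamma>"
      unfolding \<gamma>_def[abs_def]
      by (rule continuous_on_compose2[OF side_arc_continuous rc]) (use r01 in \<open>force simp: abs_le_iff\<close>)
    have gP: "\<gamma> t \<in> P" if "t \<in> {0..1}" for t using side_arc_in(1)[OF r01[OF that]] by (simp add: \<gamma>_def)
    have gim: "\<gamma> ` {0<..<1} = {x \<in> P. sides p x = {j}}"
    proof
      show "\<gamma> ` {0<..<1} \<subseteq> {x \<in> P. sides p x = {j}}"
        using gP sides_side_arc[OF rl e(2)] by (auto simp: \<gamma>_def)
      show "{x \<in> P. sides p x = {j}} \<subseteq> \<gamma> ` {0<..<1}"
      proof
        fix x assume "x \<in> {x \<in> P. sides p x = {j}}"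
        then obtain s where s: "\<bar>s\<bar> < q0" "x = side_arc j s" using side_arc_surj e(2) by blast
        have "2 * ((s / q0 + 1) / 2) - 1 = s / q0" using q0(1) by (simp add: field_simps)
        then have "r ((s / q0 + 1) / 2) = s" unfolding r_def using q0(1) by simp
        moreover have "(s / q0 + 1) / 2 \<in> {0<..<1}" using s(1) q0(1) by (auto simp: field_simps abs_less_iff)
        ultimately show "x \<in> \<gamma> ` {0<..<1}" using s(2) unfolding \<gamma>_def by (metis image_eqI)
      qed
    qed
    have ginj: "inj_on \<gamma> {0<..<1}"
    proof (rule inj_onI)
      fix s t assume st: "s \<in> {0<..<1}" "t \<in> {0<..<1}" "\<gamma> s = \<gamma> t"
      have "r s = r t" using inj_onD[OF side_arc_inj[of j], of "r s" "r t"] st rl[OF st(1)] rl[OF st(2)]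
        by (auto simp: \<gamma>_def abs_less_iff)
      then show "s = t" using q0(1) by (simp add: r_def)
    qed
    have "continuous_map (top_of_set {0..1}) (top_of_set P) \<gamma>" using gc gP by auto
    then have "continuous_map (top_of_set {0..1}) Y (cls b \<circ> \<gamma>)"
      using cls_continuous[OF e(1)] by (rule continuous_map_compose)
    moreover have "inj_on (cls b \<circ> \<gamma>) {0<..<1}"
      by (rule comp_inj_on[OF ginj]) (simp add: gim cls_inj_cell[OF e(1)])
    moreover have "(cls b \<circ> \<gamma>) ` {0<..<1} = e"
      unfolding image_comp[symmetric] gim e(3) cell_def ..
    moreover have "(cls b \<circ> \<gamma>) ` {0, 1} \<subseteq> V"
    proof -
      have "cls b (\<gamma> t) \<in> V" if "t \<in> {0, 1}" for t
      proof -
        have "\<bar>r t\<bar> = q0" using that q0(1) by (auto simp: r_def)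
        then obtain i where i: "i < p" "\<gamma> t = vert i" unfolding \<gamma>_def by (rule side_arc_end)
        have "sides p (vert i) \<in> strata 2" unfolding strata_cases(3) sides_vert[OF i(1)] using i(1) by simp
        then show ?thesis unfolding V_def mem_Collect_eq i(2) using e(1) vert_in by blast
      qed
      then show ?thesis by auto
    qed
    ultimately show ?thesis by blast
  qed
  have face: "\<exists>\<Phi>. continuous_map (top_of_set (cball (0::complex) 1)) Y \<Phi> \<and> inj_on \<Phi> (ball 0 1) \<and>
        \<Phi> ` ball 0 1 = f \<and> \<Phi> ` sphere 0 1 \<subseteq> V \<union> \<Union>(cells 1)" if fC: "f \<in> cells 0" for f
  proof -
    obtain b where f: "b \<in> carrier B" "f = cell b {}" using fC strata_cases(1) by (auto simp: cells_def)
    obtain h where h: "continuous_on (cball 0 1) h" "inj_on h (cball 0 1)" "h ` cball (0::complex) 1 = P"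
      "h ` ball 0 1 = {z \<in> P. sides p z = {}}" "h ` sphere 0 1 \<subseteq> {z \<in> P. sides p z \<noteq> {}}"
      by (rule polygon_disc)
    have "continuous_map (top_of_set (cball 0 1)) (top_of_set P) h" using h(1,3) by auto
    then have "continuous_map (top_of_set (cball 0 1)) Y (cls b \<circ> h)"
      using cls_continuous[OF f(1)] by (rule continuous_map_compose)
    moreover have "inj_on (cls b \<circ> h) (ball 0 1)"
      using inj_on_subset[OF h(2)] by (intro comp_inj_on) (auto simp: h(4) cls_inj_cell[OF f(1)])
    moreover have "(cls b \<circ> h) ` ball 0 1 = f" unfolding image_comp[symmetric] h(4) f(2) cell_def ..
    moreover have "(cls b \<circ> h) ` sphere 0 1 \<subseteq> V \<union> \<Union>(cells 1)"
      using h(5) mem[OF f(1)] by (auto simp: image_subset_iff)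
    ultimately show ?thesis by blast
  qed
  have "finite_CW_2 Y V (cells 1) (cells 0)"
    unfolding finite_CW_2_def
    using Hausdorff_Y fV card_cells(1) EF part edge face by simp
  then show ?thesis using that cV by blast
qed

lemma Euler_characteristic:
  assumes "card (carrier B) = n * card A"
  shows "\<exists>e. has_Euler_characteristic Y e \<and> 4 * e = int n * (4 - int p)"
proof -
  obtain V where V: "finite_CW_2 Y V (cells 1) (cells 0)" "card V = card (cells 2)" by (rule CW_structure)
  have "finite A" using finite_B A_sub subgroup.subset finite_subset by metis
  then have A: "card A > 0" using A_closed(3) by (auto simp: card_gt_0_iff)
  have "card (cells 0) * card A = n * card A"
    using card_cells(2)[of 0] card_strata assms by simp
  then have 0: "card (cells 0) = n" using A by simp
  have "(card (cells 1) * 2) * card A = (n * p) * card A"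
    using card_cells(2)[of 1] card_strata assms by (simp add: mult_ac)
  then have 1: "card (cells 1) * 2 = n * p" using A by simp
  have "(card (cells 2) * 4) * card A = (n * p) * card A"
    using card_cells(2)[of 2] card_strata assms by (simp add: mult_ac)
  then have 2: "card (cells 2) * 4 = n * p" using A by simp
  let ?e = "int (card V) - int (card (cells 1)) + int (card (cells 0))"
  have "4 * ?e = int (card (cells 2) * 4) - 2 * int (card (cells 1) * 2) + 4 * int n"
    using V(2) 0 by simp
  also have "\<dots> = int n * (4 - int p)" unfolding 1 2 by (simp add: algebra_simps)
  finally show ?thesis using V(1) unfolding has_Euler_characteristic_def by blast
qed

lemma genus:
  assumes "card (carrier B) = n * card A" "n * (p - 4) = 8 * (g - 1)" "1 \<le> g"
  shows "has_genus Y g"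
proof -
  obtain e where e: "has_Euler_characteristic Y e" "4 * e = int n * (4 - int p)"
    using Euler_characteristic[OF assms(1)] by blast
  have "int n * (int p - 4) = 8 * (int g - 1)"
    using arg_cong[OF assms(2), of int] p_ge assms(3) by (simp add: of_nat_diff)
  then have "e = 2 - 2 * int g" using e(2) by (simp add: algebra_simps)
  then show ?thesis using e(1) by (simp add: has_genus_def)
qed

end

section \<open>The finite groups\<close>

text \<open>
  The product of the dihedral group of order \<open>2 * m\<close> and a group of order 2. A triple
  \<open>(n, e, c)\<close> stands for the map \<open>x \<mapsto> n + x\<close> or \<open>x \<mapsto> n - x\<close> of the integers modulo \<open>m\<close>,
  according to \<open>e\<close>, and multiplies like these maps, together with the element \<open>c\<close> of the group of order 2.
\<close>

definition flip :: "bool \<Rightarrow> int \<Rightarrow> int" where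
  "flip e n = (if e then - n else n)"

definition dihedral2 :: "int \<Rightarrow> (int \<times> bool \<times> bool) monoid" where
  "dihedral2 m = \<lparr>carrier = {0..<m} \<times> UNIV,
     mult = (\<lambda>(n, e, c) (n', e', c'). ((n + flip e n') mod m, e \<noteq> e', c \<noteq> c')),
     one = (0, False, False)\<rparr>"

lemma dihedral2_mult:
  "(n, e, c) \<otimes>\<^bsub>dihedral2 m\<^esub> (n', e', c') = ((n + flip e n') mod m, e \<noteq> e', c \<noteq> c')"
  by (simp add: dihedral2_def)

lemma dihedral2_one: "\<one>\<^bsub>dihedral2 m\<^esub> = (0, False, False)"
  by (simp add: dihedral2_def)

lemma dihedral2_carrier: "(n, e, c) \<in> carrier (dihedral2 m) \<longleftrightarrow> 0 \<le> n \<and> n < m"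
  by (simp add: dihedral2_def)

lemma flip_mod: "(n + flip e (k mod m)) mod m = (n + flip e k) mod m"
  by (cases e) (simp_all add: flip_def mod_diff_right_eq mod_add_right_eq)

lemma dihedral2_group:
  assumes "0 < m"
  shows "group (dihedral2 m)"
proof (rule groupI)
  fix x y z assume "x \<in> carrier (dihedral2 m)" "y \<in> carrier (dihedral2 m)" "z \<in> carrier (dihedral2 m)"
  obtain a e c a' e' c' a'' e'' c'' where [simp]: "x = (a, e, c)" "y = (a', e', c')" "z = (a'', e'', c'')"
    by (metis prod.exhaust)
  have "((a + flip e a') mod m + flip (e \<noteq> e') a'') mod m = (a + flip e a' + flip (e \<noteq> e') a'') mod m"
    by (simp add: mod_add_left_eq)
  also have "a + flip e a' + flip (e \<noteq> e') a'' = a + flip e (a' + flip e' a'')" by (auto simp: flip_def)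
  finally show "x \<otimes>\<^bsub>dihedral2 m\<^esub> y \<otimes>\<^bsub>dihedral2 m\<^esub> z = x \<otimes>\<^bsub>dihedral2 m\<^esub> (y \<otimes>\<^bsub>dihedral2 m\<^esub> z)"
    by (auto simp: dihedral2_mult flip_mod)
next
  fix x assume x: "x \<in> carrier (dihedral2 m)"
  obtain a e c where xe: "x = (a, e, c)" by (metis prod.exhaust)
  show "\<exists>y\<in>carrier (dihedral2 m). y \<otimes>\<^bsub>dihedral2 m\<^esub> x = \<one>\<^bsub>dihedral2 m\<^esub>"
    using assms by (intro bexI[of _ "((if e then a else - a) mod m, e, c)"])
      (auto simp: xe dihedral2_mult dihedral2_one dihedral2_carrier flip_def mod_add_left_eq mod_diff_left_eq)
qed (use assms in \<open>auto simp: dihedral2_def flip_def\<close>)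

lemma finite_dihedral2: "finite (carrier (dihedral2 m))" and card_dihedral2: "card (carrier (dihedral2 m)) = 4 * nat m"
  by (simp_all add: dihedral2_def card_cartesian_product flip: UNIV_Times_UNIV)

text \<open>
  Even sides get reflections \<open>x \<mapsto> f i - x\<close>, odd sides the central involution. Adjacent
  sides have different parity, whence their generators commute and are distinct.
\<close>

definition side_gen :: "int \<Rightarrow> (nat \<Rightarrow> int) \<Rightarrow> nat \<Rightarrow> int \<times> bool \<times> bool" where
  "side_gen m f i = (if even i then (f i mod m, True, False) else (0, False, True))"

definition face_group :: "(bool \<times> bool) set \<Rightarrow> (int \<times> bool \<times> bool) set" where
  "face_group D = {0} \<times> D"

text \<open>
  Modulo \<open>p\<close>, these are the reflections \<open>i \<mapsto> 2 - i\<close> and \<open>i \<mapsto> p / 2 + 2 - i\<close> in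
  two perpendicular axes, of which the first passes through the midpoint of side 1, and their
  product \<open>i \<mapsto> p / 2 + i\<close>. The case distinctions only serve to keep the labels below
  \<open>p\<close>.
\<close>

fun face_act :: "nat \<Rightarrow> int \<times> bool \<times> bool \<Rightarrow> nat \<Rightarrow> nat" where
  "face_act p (n, e, c) i =
     (if e \<and> c then (if i < p div 2 then i + p div 2 else i - p div 2)
      else if e then (if i \<le> 2 then 2 - i else p + 2 - i)
      else if c then (if i \<le> p div 2 + 2 then p div 2 + 2 - i else p + p div 2 + 2 - i)
      else i)"

fun face_iso :: "nat \<Rightarrow> int \<times> bool \<times> bool \<Rightarrow> complex \<Rightarrow> complex" where
  "face_iso p (n, e, c) z =
     (if c then - 1 else 1) * (if e = c then 1 else cis (- (4 * pi / p))) * (if e = c then z else cnj z)"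

text \<open>
  Both the dihedral reflections and the central involution reverse the orientation.
\<close>

fun face_ori :: "int \<times> bool \<times> bool \<Rightarrow> bool" where
  "face_ori (n, e, c) \<longleftrightarrow> e = c"

context even_polygon begin

text \<open>
  An orthogonal map that carries the centre of the circle of side \<open>i\<close> to the centre of the circle of
  side \<open>j\<close> carries everything attached to side \<open>i\<close> to what is attached to side \<open>j\<close>.
\<close>

lemma orthogonal_side:
  assumes s: "cmod s = 1" and c: "side_centre p j = s * (if t then side_centre p i else cnj (side_centre p i))"
  shows "side p j (s * (if t then z else cnj z)) = side p i z"
    "cmod z < 1 \<Longrightarrow> s * (if t then mirror i z else cnj (mirror i z)) = mirror j (s * (if t then z else cnj z))"
proof -
  have ss: "s * cnj s = 1" "cnj s * s = 1" using complex_norm_square[of s] s by (simp_all add: mult.commute)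
  define k v where "k = (if t then side_centre p i else cnj (side_centre p i))" and "v = (if t then z else cnj z)"
  have cj: "side_centre p j = s * k" using c by (simp add: k_def)
  have "s * v * cnj (s * k) = v * cnj k" using ss by (simp add: mult_ac)
  moreover have "Re (v * cnj k) = Re (z * cnj (side_centre p i))" by (simp add: v_def k_def)
  moreover have "cmod (s * v) = cmod z" by (simp add: norm_mult s v_def)
  ultimately show "side p j (s * (if t then z else cnj z)) = side p i z"
    unfolding side_def cj v_def[symmetric] by (simp only:)
  assume z: "cmod z < 1"
  have nv: "cmod v < 1" using z by (simp add: v_def)
  have s0: "cnj s \<noteq> 0" using s by auto
  have "mirror j (s * v) = (s * k * (cnj s * cnj v) - 1) / (cnj s * cnj v - cnj s * cnj k)"
    by (simp add: mirror_def cj)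
  also have "s * k * (cnj s * cnj v) - 1 = (s * cnj s) * (k * cnj v) - 1" by (simp add: mult_ac)
  also have "cnj s * cnj v - cnj s * cnj k = cnj s * (cnj v - cnj k)" by (simp add: algebra_simps)
  finally have "mirror j (s * v) = (k * cnj v - 1) / (cnj s * (cnj v - cnj k))" by (simp add: ss)
  also have "\<dots> = (s * cnj s) * ((k * cnj v - 1) / (cnj s * (cnj v - cnj k)))" by (simp add: ss)
  also have "\<dots> = s * ((k * cnj v - 1) / (cnj v - cnj k))" using s0 by simp
  also have "(k * cnj v - 1) / (cnj v - cnj k) = (if t then mirror i z else cnj (mirror i z))"
    by (simp add: mirror_def k_def v_def)
  finally show "s * (if t then mirror i z else cnj (mirror i z)) = mirror j (s * (if t then z else cnj z))"
    by (simp add: v_def)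
qed

lemma half: "p = 2 * (p div 2)"
  using p_even by simp

lemma centre_int:
  assumes "int j = d + int p * l"
  shows "side_centre p j = of_real kap * cis (- (2 * of_int d * q0))"
proof -
  have "real j = of_int d + real p * of_int l" using assms by (metis of_int_add of_int_mult of_int_of_nat_eq)
  then have "2 * real j * q0 = 2 * of_int d * q0 + 2 * (real p * q0) * of_int l" by (simp add: algebra_simps)
  then have "- (2 * real j * q0) = - (2 * of_int d * q0) + 2 * pi * of_int (- l)" using q0(3) by simp
  then have "cis (- (2 * real j * q0)) = cis (- (2 * of_int d * q0)) * cis (2 * pi * of_int (- l))"
    by (metis cis_mult)
  also have "cis (2 * pi * of_int (- l)) = 1" by (rule cis_multiple_2pi) auto
  finally show ?thesis by (simp add: centre)
qed

lemma centre_face_act: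
  assumes "i < p"
  shows "side_centre p (face_act p (n, e, c) i) = ((if c then - 1 else 1) * (if e = c then 1 else cis (- (4 * pi / p)))) *
    (if e = c then side_centre p i else cnj (side_centre p i))"
proof -
  define h where "h = p div 2"
  have p: "p = 2 * h" "6 \<le> p" using half p_ge by (auto simp: h_def)
  have hq: "2 * real h * q0 = pi" using q0(3) p(1) by simp
  have w: "cis (- (4 * pi / p)) = cis (- (4 * q0))" by (simp add: q0_def)
  have cc: "of_real kap * cis (- (4 * q0) + 2 * real i * q0) = cis (- (4 * q0)) * cnj (side_centre p i)"
  proof -
    have "cis (- (4 * q0) + 2 * real i * q0) = cis (- (4 * q0)) * cis (2 * real i * q0)" by (simp only: cis_mult)
    then show ?thesis by (simp add: centre cis_cnj)
  qed
  have hp: "cis (- (x + pi)) = - cis (- x)" for x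
  proof -
    have "cis (- (x + pi)) = cis (- x) * cis (- pi)" by (simp add: cis_mult)
    moreover have "cis (- pi) = - 1" by (metis cis_cnj cis_pi complex_cnj_minus complex_cnj_one)
    ultimately show ?thesis by simp
  qed
  consider "e" "c" | "e" "\<not> c" | "\<not> e" "c" | "\<not> e" "\<not> c" by blast
  then show ?thesis
  proof cases
    case 1
    have "\<exists>l. int (face_act p (n, e, c) i) = (int i + int h) + int p * l"
      using 1 assms p by (cases "i < h") (auto simp: h_def[symmetric] intro: exI[of _ 0] exI[of _ "-1"])
    then obtain l where "int (face_act p (n, e, c) i) = (int i + int h) + int p * l" by blast
    from centre_int[OF this]
    have "side_centre p (face_act p (n, e, c) i) = of_real kap * cis (- (2 * real i * q0 + 2 * real h * q0))"
      by (simp add: algebra_simps)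
    also have "\<dots> = - side_centre p i" unfolding hq hp centre by simp
    finally show ?thesis using 1 by (simp del: face_act.simps)
  next
    case 2
    have "\<exists>l. int (face_act p (n, e, c) i) = (2 - int i) + int p * l"
      using 2 assms p by (cases "i \<le> 2") (auto intro: exI[of _ 0] exI[of _ "1"])
    then obtain l where "int (face_act p (n, e, c) i) = (2 - int i) + int p * l" by blast
    from centre_int[OF this]
    have "side_centre p (face_act p (n, e, c) i) = of_real kap * cis (- (4 * q0) + 2 * real i * q0)"
      by (simp add: algebra_simps)
    also have "\<dots> = cis (- (4 * q0)) * cnj (side_centre p i)" by (rule cc)
    finally show ?thesis using 2 w by (simp del: face_act.simps)
  next
    case 3
    have "\<exists>l. int (face_act p (n, e, c) i) = (int h + 2 - int i) + int p * l"
      using 3 assms p by (cases "i \<le> h + 2") (auto simp: h_def[symmetric] intro: exI[of _ 0] exI[of _ "1"])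
    then obtain l where "int (face_act p (n, e, c) i) = (int h + 2 - int i) + int p * l" by blast
    from centre_int[OF this]
    have "side_centre p (face_act p (n, e, c) i) = of_real kap * cis (- ((4 * q0 - 2 * real i * q0) + 2 * real h * q0))"
      by (simp add: algebra_simps)
    also have "\<dots> = - (of_real kap * cis (- (4 * q0) + 2 * real i * q0))" unfolding hq hp by simp
    also have "\<dots> = - (cis (- (4 * q0)) * cnj (side_centre p i))" unfolding cc ..
    finally show ?thesis using 3 w by (simp del: face_act.simps)
  next
    case 4
    then show ?thesis by simp
  qed
qed

lemma face_iso_side:
  assumes "i < p"
  shows "side p (face_act p a i) (face_iso p a z) = side p i z"
    "cmod z < 1 \<Longrightarrow> face_iso p a (mirror i z) = mirror (face_act p a i) (face_iso p a z)"
proof -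
  obtain n e c where a: "a = (n, e, c)" by (metis prod.exhaust)
  let ?s = "(if c then - 1 else 1) * (if e = c then 1 else cis (- (4 * pi / p))) :: complex"
  have s: "cmod ?s = 1" by (simp add: norm_mult)
  note o = orthogonal_side[OF s centre_face_act[OF assms, of n e c]]
  show "side p (face_act p a i) (face_iso p a z) = side p i z" using o(1)[of z] by (simp add: a del: face_act.simps)
  show "cmod z < 1 \<Longrightarrow> face_iso p a (mirror i z) = mirror (face_act p a i) (face_iso p a z)"
    using o(2)[of z] by (simp add: a del: face_act.simps split: if_splits)
qed

lemma face_iso_isometry: "disc_isometry (face_ori a) (face_iso p a)"
proof -
  obtain n e c where a: "a = (n, e, c)" by (metis prod.exhaust)
  let ?s = "(if c then - 1 else 1) * (if e = c then 1 else cis (- (4 * pi / p))) :: complex"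
  have s: "cmod ?s = 1" by (simp add: norm_mult)
  have "face_iso p a = (if e = c then (\<lambda>z. ?s * z) else (\<lambda>z. ?s * cnj z))" by (auto simp: a)
  then show ?thesis using disc_isometry_scale[OF s] by (simp add: a split: if_splits)
qed

lemma face_iso_mult: "face_iso p ((0, e, c) \<otimes>\<^bsub>dihedral2 m\<^esub> (0, e', c')) z = face_iso p (0, e, c) (face_iso p (0, e', c') z)"
proof -
  have "cis (- x) * cis x = 1" "cis x * cis (- x) = 1" for x by (simp_all add: cis_mult)
  then show ?thesis
    by (cases e; cases c; cases e'; cases c') (simp_all add: dihedral2_mult cis_cnj mult.assoc[symmetric])
qed

lemma face_act_lt: "i < p \<Longrightarrow> face_act p a i < p"
  using p_ge half by (cases a) auto

lemma face_act_mult: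
  assumes "i < p"
  shows "face_act p ((0, e, c) \<otimes>\<^bsub>dihedral2 m\<^esub> (0, e', c')) i = face_act p (0, e, c) (face_act p (0, e', c') i)"
proof -
  obtain h where p: "p = 2 * h" "p div 2 = h" using half by blast
  have "3 \<le> h" using p p_ge by simp
  then show ?thesis
    unfolding dihedral2_mult using assms p
    by (cases e; cases c; cases e'; cases c') (auto split: if_splits)
qed

lemma nxt_simp: "i < p \<Longrightarrow> nxt p i = (if Suc i = p then 0 else Suc i)"
  by (simp add: nxt_def)

lemma face_act_adjacent:
  assumes "adjacent p i j"
  shows "adjacent p (face_act p a i) (face_act p a j)"
proof -
  obtain h where p: "p = 2 * h" "p div 2 = h" using half by blast
  have h: "3 \<le> h" using p p_ge by simp
  obtain n e c where a: "a = (n, e, c)" by (metis prod.exhaust)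
  have ns: "nxt (2 * h) k = (if Suc k = 2 * h then 0 else Suc k)" if "k < 2 * h" for k
    using nxt_simp[of k] that unfolding p(1) .
  have *: "nxt p (face_act p a i) = face_act p a (nxt p i) \<or> nxt p (face_act p a (nxt p i)) = face_act p a i" if i: "i < p" for i
  proof -
    consider "e" "c" | "e" "\<not> c" | "\<not> e" "c" | "\<not> e" "\<not> c" by blast
    then show ?thesis
    proof cases
      case 1
      consider "Suc i < h" | "Suc i = h" | "h \<le> i" "Suc i < p" | "Suc i = p" using i by linarith
      then show ?thesis using 1 p h i by cases (auto simp: a ns)
    next
      case 2
      consider "Suc i \<le> 2" | "i = 2" | "2 < i" "Suc i < p" | "Suc i = p" using i by linarith
      then show ?thesis using 2 p h i by cases (auto simp: a ns)
    next
      case 3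
      consider "Suc i \<le> h + 2" | "i = h + 2" | "h + 2 < i" "Suc i < p" | "h + 2 < i" "Suc i = p" using i by linarith
      then show ?thesis using 3 p h i by cases (auto simp: a ns)
    qed (simp add: a)
  qed
  show ?thesis using assms * face_act_lt unfolding adjacent_def by metis
qed

lemma face_act_parity:
  assumes "i < p" "c \<Longrightarrow> 4 dvd p"
  shows "even (face_act p (n, e, c) i) \<longleftrightarrow> even i"
proof -
  obtain h where p: "p = 2 * h" "p div 2 = h" using half by blast
  have "even h" if c using assms(2)[OF that] p by auto
  then show ?thesis using assms p by (cases e; cases c) auto
qed

text \<open>
  The group \<open>D\<close> describes the symmetries of a face. If the reflection \<open>i \<mapsto> 2 - i\<close>
  belongs to it, then 4 divides \<open>p\<close>, so that the axis passes through the sides 1 and \<open>p / 2 +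
  1\<close>, both odd; their generator is the central involution, hence different from this reflection,
  which is a dihedral one. Likewise, if \<open>p\<close> is 4 modulo 8, then the axis of the other reflection
  passes through the sides \<open>p / 4 + 1\<close> and \<open>3 p / 4 + 1\<close>, both even, whereas this reflection is
  the central involution of the group. As all these symmetries preserve the parity of labels,
  one that preserves a vertex fixes an even and an odd side, which only the identity does. The
  two values of \<open>f\<close> ensure that the rotation by 1 is a product of two generators.
\<close>

lemma surface_data_dihedral:
  assumes m: "0 < m"
    and D: "(False, False) \<in> D" "\<And>e c e' c'. (e, c) \<in> D \<Longrightarrow> (e', c') \<in> D \<Longrightarrow> (e \<noteq> e', c \<noteq> c') \<in> D"
    and D4: "\<And>c. (True, c) \<in> D \<Longrightarrow> 4 dvd p" and D8: "\<And>e. (e, True) \<in> D \<Longrightarrow> p mod 8 = 4"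
    and f: "f 0 = 1" "f 4 = 0"
    and f_act: "\<And>e c i. (e, c) \<in> D \<Longrightarrow> i < p \<Longrightarrow> even i \<Longrightarrow> f (face_act p (0, e, c) i) = flip e (f i)"
  shows "surface_data p (dihedral2 m) (side_gen m f) (face_group D) (face_act p) (face_iso p) face_ori"
proof -
  let ?B = "dihedral2 m" and ?g = "side_gen m f"
  interpret B: group ?B by (rule dihedral2_group[OF m])
  obtain h where p: "p = 2 * h" "p div 2 = h" using half by blast
  have h3: "3 \<le> h" using p p_ge by simp
  have gc: "?g i \<in> carrier ?B" for i using m by (simp add: side_gen_def dihedral2_carrier)
  have par: "even (nxt p i) \<longleftrightarrow> odd i" if "i < p" for i using nxt_simp[OF that] that p_even by auto
  have adj_par: "even i \<longleftrightarrow> odd j" if "adjacent p i j" for i j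
    using that par unfolding adjacent_def by auto
  have D4': "4 dvd p" if "(e, c) \<in> D" c for e c
  proof -
    have "p mod 8 = 4" using D8 that by auto
    then show ?thesis by presburger
  qed
  have sgpar: "even (face_act p (0, e, c) i) \<longleftrightarrow> even i" if "(e, c) \<in> D" "i < p" for e c i
    using face_act_parity[OF that(2), of c] D4'[OF that(1)] by blast
  have invol: "(0, e, c) \<otimes>\<^bsub>?B\<^esub> (0, e, c) = \<one>\<^bsub>?B\<^esub>" for e c
    by (simp add: dihedral2_mult dihedral2_one flip_def)
  have inv: "inv\<^bsub>?B\<^esub> (0, e, c) = (0, e, c)" for e c
    using m by (intro B.inv_equality invol) (simp_all add: dihedral2_carrier)
  have gen: "\<exists>u. set u \<subseteq> {..<p} \<and> b = foldr (\<lambda>i x. ?g i \<otimes>\<^bsub>?B\<^esub> x) u \<one>\<^bsub>?B\<^esub>" if b: "b \<in> carrier ?B" for b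
  proof -
    obtain n e c where be: "b = (n, e, c)" by (metis prod.exhaust)
    have n: "0 \<le> n" "n < m" using b by (simp_all add: be dihedral2_carrier)
    let ?F = "\<lambda>u. foldr (\<lambda>i x. ?g i \<otimes>\<^bsub>?B\<^esub> x) u \<one>\<^bsub>?B\<^esub>"
    have ec: "\<exists>u. set u \<subseteq> {..<p} \<and> (0, e, c) = ?F u"
      using p h3 by (intro exI[of _ "(if e then [4] else []) @ (if c then [1] else [])"])
        (auto simp: side_gen_def dihedral2_mult dihedral2_one flip_def f)
    have "\<exists>u. set u \<subseteq> {..<p} \<and> (int k mod m, e, c) = ?F u" for k
    proof (induction k)
      case 0
      then show ?case using ec by simp
    next
      case (Suc k)
      then obtain u where u: "set u \<subseteq> {..<p}" "(int k mod m, e, c) = ?F u" by blast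
      have "?F ([0, 4] @ u) = ?g 0 \<otimes>\<^bsub>?B\<^esub> (?g 4 \<otimes>\<^bsub>?B\<^esub> (int k mod m, e, c))" unfolding u(2) by simp
      also have "\<dots> = ((1 + int k) mod m, e, c)"
        by (simp add: side_gen_def dihedral2_mult flip_def f mod_simps)
      finally show ?case using u(1) p h3 by (intro exI[of _ "[0, 4] @ u"]) auto
    qed
    from this[of "nat n"] show ?thesis using n by (simp add: be)
  qed
  show ?thesis
  proof (intro surface_data.intro surface_data_axioms.intro)
    show "even_polygon p" by (rule even_polygon_axioms)
    show "group ?B" by (rule B.group_axioms)
    show "finite (carrier ?B)" by (rule finite_dihedral2)
    show "?g i \<in> carrier ?B" for i by (rule gc)
    show "?g i \<otimes>\<^bsub>?B\<^esub> ?g i = \<one>\<^bsub>?B\<^esub>" for i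
      by (simp add: side_gen_def dihedral2_mult dihedral2_one flip_def)
    show "?g i \<otimes>\<^bsub>?B\<^esub> ?g j = ?g j \<otimes>\<^bsub>?B\<^esub> ?g i" if "adjacent p i j" for i j
      using adj_par[OF that] by (auto simp: side_gen_def dihedral2_mult flip_def)
    show "?g i \<noteq> \<one>\<^bsub>?B\<^esub>" for i by (simp add: side_gen_def dihedral2_one)
    show "?g i \<noteq> ?g j" if "adjacent p i j" for i j
      using adj_par[OF that] by (auto simp: side_gen_def)
    show "subgroup (face_group D) ?B"
    proof (rule B.subgroupI)
      show "face_group D \<subseteq> carrier ?B" using m by (auto simp: face_group_def dihedral2_def)
      show "face_group D \<noteq> {}" using D(1) by (auto simp: face_group_def)
      show "inv\<^bsub>?B\<^esub> a \<in> face_group D" if "a \<in> face_group D" for a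
        using that inv by (auto simp: face_group_def)
      show "a \<otimes>\<^bsub>?B\<^esub> b \<in> face_group D" if "a \<in> face_group D" "b \<in> face_group D" for a b
        using that D(2) by (auto simp: face_group_def dihedral2_mult flip_def)
    qed
    show "face_act p a i < p" if "i < p" for a i by (rule face_act_lt[OF that])
    show "face_act p (a \<otimes>\<^bsub>?B\<^esub> b) i = face_act p a (face_act p b i)"
      if "a \<in> face_group D" "b \<in> face_group D" "i < p" for a b i
      using that face_act_mult[OF that(3)] by (auto simp: face_group_def simp del: face_act.simps)
    show "face_act p \<one>\<^bsub>?B\<^esub> i = i" for i by (simp add: dihedral2_one)
    show "adjacent p (face_act p a i) (face_act p a j)" if "adjacent p i j" for a i j
      by (rule face_act_adjacent[OF that])
    show "?g (face_act p a i) = a \<otimes>\<^bsub>?B\<^esub> ?g i \<otimes>\<^bsub>?B\<^esub> inv\<^bsub>?B\<^esub> a" if aD: "a \<in> face_group D" and ip: "i < p" for a i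
    proof -
      obtain e c where a: "a = (0, e, c)" "(e, c) \<in> D" using aD by (auto simp: face_group_def)
      show ?thesis
      proof (cases "even i")
        case True
        have "?g (face_act p a i) = (flip e (f i) mod m, True, False)"
          using sgpar[OF a(2) ip] f_act[OF a(2) ip True] True by (simp add: side_gen_def a(1) del: face_act.simps)
        also have "\<dots> = a \<otimes>\<^bsub>?B\<^esub> ?g i \<otimes>\<^bsub>?B\<^esub> inv\<^bsub>?B\<^esub> a"
          unfolding a(1) inv using True by (simp add: side_gen_def dihedral2_mult flip_def mod_minus_eq)
        finally show ?thesis .
      next
        case False
        then show ?thesis using sgpar[OF a(2) ip]
          unfolding a(1) inv by (simp add: side_gen_def dihedral2_mult flip_def del: face_act.simps)
      qed
    qed
    show "face_iso p (a \<otimes>\<^bsub>?B\<^esub> b) z = face_iso p a (face_iso p b z)"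
      if "a \<in> face_group D" "b \<in> face_group D" for a b z
      using that face_iso_mult by (auto simp: face_group_def simp del: face_iso.simps)
    show "face_iso p \<one>\<^bsub>?B\<^esub> z = z" for z by (simp add: dihedral2_one)
    show "disc_isometry (face_ori a) (face_iso p a)" for a by (rule face_iso_isometry)
    show "side p (face_act p a i) (face_iso p a z) = side p i z" if "i < p" for a i z
      by (rule face_iso_side(1)[OF that])
    show "face_iso p a (mirror i z) = mirror (face_act p a i) (face_iso p a z)" if "i < p" "cmod z < 1" for a i z
      by (rule face_iso_side(2)[OF that])
    show "face_ori (x \<otimes>\<^bsub>?B\<^esub> y) \<longleftrightarrow> face_ori x = face_ori y" for x y
      by (cases x; cases y) (auto simp: dihedral2_mult)
    show "\<not> face_ori (?g i)" for i by (simp add: side_gen_def)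
    show "\<exists>u. set u \<subseteq> {..<p} \<and> b = foldr (\<lambda>i x. ?g i \<otimes>\<^bsub>?B\<^esub> x) u \<one>\<^bsub>?B\<^esub>" if "b \<in> carrier ?B" for b
      by (rule gen[OF that])
    have fix_e: "odd i" if "(True, False) \<in> D" "i < p" "face_act p (0, True, False) i = i" for i
      using D4[OF that(1)] that(2,3) by (auto split: if_splits) presburger+
    have fix_c: "even i" if "(False, True) \<in> D" "i < p" "face_act p (0, False, True) i = i" for i
    proof -
      have "p + p div 2 + 2 - i = i \<or> p div 2 + 2 - i = i" using that(3) by (simp split: if_splits)
      then have "2 * i = 3 * h + 2 \<or> 2 * i = h + 2 \<or> i = 0" using p by linarith
      moreover have "h mod 4 = 2" using D8[OF that(1)] p by presburger
      ultimately show ?thesis by presburger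
    qed
    have fix_ec: "face_act p (0, True, True) i \<noteq> i" if "i < p" for i using that p h3 by auto
    show "a \<noteq> ?g i" if aD: "a \<in> face_group D" and ip: "i < p" and fx0: "face_act p a i = i" for a i
    proof
      assume eq: "a = ?g i"
      obtain e c where a: "a = (0, e, c)" "(e, c) \<in> D" using aD by (auto simp: face_group_def)
      show False
        using eq a fix_e[OF _ ip] fix_c[OF _ ip] fx0
        by (cases "even i") (simp_all add: side_gen_def del: face_act.simps)
    qed
    show "a = \<one>\<^bsub>?B\<^esub>" if aD: "a \<in> face_group D" and ip: "i < p" and fx0: "face_act p a ` {i, nxt p i} = {i, nxt p i}" for a i
    proof -
      obtain e c where a: "a = (0, e, c)" "(e, c) \<in> D" using aD by (auto simp: face_group_def)
      have l: "nxt p i < p" by (rule nxt(1)[OF ip])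
      have "face_act p a i \<in> {i, nxt p i}" "face_act p a (nxt p i) \<in> {i, nxt p i}" using fx0 by blast+
      moreover have "even (face_act p a i) \<longleftrightarrow> even i" "even (face_act p a (nxt p i)) \<longleftrightarrow> even (nxt p i)"
        unfolding a(1) using sgpar[OF a(2)] ip l by blast+
      ultimately have fx: "face_act p a i = i" "face_act p a (nxt p i) = nxt p i"
        using par[OF ip] by auto
      show ?thesis
        using fx fix_e[of i] fix_e[of "nxt p i"] fix_c[of i] fix_c[of "nxt p i"] fix_ec[of i] par[OF ip] ip l a
        by (cases e; cases c) (simp_all add: dihedral2_one del: face_act.simps)
    qed
  qed
qed

lemma surface_exists:
  assumes "surface_data p (dihedral2 m) (side_gen m f) (face_group D) (face_act p) (face_iso p) face_ori"
    and "4 * nat m = n * card D" "n * (p - 4) = 8 * (g - 1)" "1 \<le> g"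
  shows "\<exists>(q :: nat \<Rightarrow> nat) \<Gamma> \<A>.
           (\<forall>i<p. 3 \<le> q i) \<and>
           lattice_in (Aut_building p q) (Aut_topology p q) \<Gamma> \<and>
           compact_oriented_hyperbolic_surface (building_quotient p q \<Gamma>) \<A> \<and>
           chambers_locally_isometric p q \<Gamma> \<A> \<and>
           has_genus (building_quotient p q \<Gamma>) g"
proof -
  interpret S: surface_data p "dihedral2 m" "side_gen m f" "face_group D" "face_act p" "face_iso p" face_ori
    by (rule assms(1))
  have "card (carrier (dihedral2 m)) = n * card (face_group D)"
    using assms(2) by (simp add: card_dihedral2 face_group_def card_cartesian_product)
  from S.genus[OF this assms(3,4)] S.lattice_Gam S.surface_Y S.chambers_isometric
  show ?thesis by (intro exI[of _ "\<lambda>_. 4"] exI[of _ S.Gam] exI[of _ S.atlas]) auto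
qed

end

theorem corollary1p4:
  fixes g p :: nat
  assumes "2 \<le> g" and "6 \<le> p" and "even p" and "(p - 4) dvd 8 * (g - 1)"
  shows "\<exists>(q :: nat \<Rightarrow> nat) \<Gamma> \<A>.
           (\<forall>i<p. 3 \<le> q i) \<and>
           lattice_in (Aut_building p q) (Aut_topology p q) \<Gamma> \<and>
           compact_oriented_hyperbolic_surface (building_quotient p q \<Gamma>) \<A> \<and>
           chambers_locally_isometric p q \<Gamma> \<A> \<and>
           has_genus (building_quotient p q \<Gamma>) g"
proof -
  interpret even_polygon p by unfold_locales (use assms in auto)
  obtain n where n: "n * (p - 4) = 8 * (g - 1)" using assms(4) by (metis dvd_def mult.commute)
  then have n0: "0 < n" using assms(1) by (cases n) auto
  obtain h where h: "p = 2 * h" "p div 2 = h" "3 \<le> h" using assms by auto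
  have g: "1 \<le> g" using assms by simp
  have nh: "n * (h - 2) = 4 * (g - 1)" using n h by (simp add: algebra_simps)
  have "4 dvd n \<or> n mod 4 = 2 \<or> odd n" by presburger
  then consider (a) "4 dvd n" | (b) "n mod 4 = 2" | (c) "odd n" by blast
  then show ?thesis
  proof cases
    case a
    let ?f = "\<lambda>i::nat. if i = 0 then 1 else 0 :: int"
    have "surface_data p (dihedral2 (int (n div 4))) (side_gen (int (n div 4)) ?f)
        (face_group {(False, False)}) (face_act p) (face_iso p) face_ori"
      using a n0 by (intro surface_data_dihedral) (auto simp: flip_def)
    from surface_exists[OF this _ n g] show ?thesis using a by simp
  next
    case b
    then obtain k where k: "n = 4 * k + 2" by (metis mult.commute mult_div_mod_eq)
    (* n / 2 is odd, and (n / 2) (h - 2) = 2 (g - 1) is even *)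
    have "even h"
    proof -
      have "n * (h - 2) = 2 * ((2 * k + 1) * (h - 2))" unfolding k by (simp add: algebra_simps)
      then have "(2 * k + 1) * (h - 2) = 2 * (g - 1)" using nh by simp
      then have "even ((2 * k + 1) * (h - 2))" by simp
      then have "even (h - 2)" by simp
      then show ?thesis using h(3) by simp
    qed
    then have p4: "4 dvd p" "8 \<le> p" using h by auto
    (* the reflection exchanges the sides 0 and 2 and inverts rotations, so their offsets are
       opposite; the even sides different from 0 and 2 are permuted and have offset 0 *)
    let ?f = "\<lambda>i::nat. if i = 0 then 1 else if i = 2 then - 1 else 0 :: int"
    have "surface_data p (dihedral2 (int (n div 2))) (side_gen (int (n div 2)) ?f)
        (face_group {(False, False), (True, False)}) (face_act p) (face_iso p) face_ori"
    proof (rule surface_data_dihedral)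
      fix e c and i :: nat
      assume D: "(e, c) \<in> {(False, False), (True, False)}" and i: "i < p" "even i"
      show "?f (face_act p (0, e, c) i) = flip e (?f i)"
      proof (cases e)
        case True
        then have c: "\<not> c" using D by simp
        have "i = 0 \<or> i = 2 \<or> 2 < i" using i(2) by presburger
        then consider "i = 0" | "i = 2" | "2 < i" by blast
        then show ?thesis
        proof cases
          case 3
          then have "face_act p (0, e, c) i = p + 2 - i" using True c by simp
          moreover have "p + 2 - i \<noteq> 0" "p + 2 - i \<noteq> 2" using i(1) by linarith+
          ultimately show ?thesis using 3 by (simp add: flip_def del: face_act.simps)
        qed (use True c in \<open>simp_all add: flip_def\<close>)
      qed (use D in \<open>simp add: flip_def\<close>)
    qed (use b p4 n0 in auto)
    moreover have "4 * nat (int (n div 2)) = n * card {(False, False), (True, False)}" by (simp add: k)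
    ultimately show ?thesis by (rule surface_exists[OF _ _ n g])
  next
    case c
    (* an odd n forces h - 2 to be divisible by 4, that is, p = 2 h to be 4 modulo 8 *)
    have "4 dvd n * (h - 2)" unfolding nh by simp
    moreover have "coprime 4 n" using c by (metis coprime_left_2_iff_odd coprime_power_left_iff numeral_Bit0 mult_2 power2_eq_square semiring_norm(13) even_numeral odd_one)
    ultimately have "4 dvd h - 2" by (simp add: coprime_dvd_mult_right_iff)
    then have p8: "p mod 8 = 4" "12 \<le> p" using h by presburger+
    then have p4: "4 dvd p" by presburger
    (* the first reflection exchanges 0 with 2 and h with h + 2 and inverts offsets; the second
       one exchanges 0 with h + 2 and 2 with h and preserves them *)
    let ?f = "\<lambda>i::nat. if i = 0 \<or> i = h + 2 then 1 else if i = 2 \<or> i = h then - 1 else 0 :: int"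
    have h6: "6 \<le> h" using p8 h by simp
    have "surface_data p (dihedral2 (int n)) (side_gen (int n) ?f) (face_group UNIV) (face_act p) (face_iso p) face_ori"
    proof (rule surface_data_dihedral)
      fix e c and i :: nat assume i: "i < p" "even i"
      show "?f (face_act p (0, e, c) i) = flip e (?f i)"
        using i h h6 by (cases e; cases c) (auto simp: flip_def)
    qed (use p8 p4 n0 h6 in auto)
    from surface_exists[OF this _ n g] show ?thesis by (simp add: card_UNIV_bool flip: UNIV_Times_UNIV) 
  qed
qed

end
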